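(* In the two-dimensional setting of the context, let $u$ satisfy the corner expansion $$u(r,\theta)=\Lambda\,r^\lambda\,\Phi(\theta)+w,\qquad w\in(H^{1+\lambda+\varepsilon})^2\ \text{locally near }x_0,\ \varepsilon>0,$$ with $\Lambda\ne0$ and a real exponent $\lambda\notin\mathbb N$, $0<\lambda<p$, and suppose that the junction $x_0$ lies in the interior of a cell $K^*\in T^h_\Omega$ with $\operatorname{dist}(x_0,\partial K^* )\ge\rho h$ for some fixed $\rho>0$. Then there exist $c>0$ and $h_1>0$, independent of $h$ and of the discrete solution, such that for all $h\le h_1$, $$\|\nabla(u-u_h)\|_{L^2(\Omega)}\ \ge\ c\,|\Lambda|\,h^\lambda\qquad\text{for every }u_h\in\mathbb V_h .$$
   Context: $d=2$. $\Omega\subset\mathbb R^2$ is a bounded domain and $x_0\in\partial\Omega$ is a junction point at which two straight boundary segments meet, so that near $x_0$ the domain $\Omega$ coincides with a sector (cone) of interior opening angle $\omega$; $(r,\theta)$ are polar coordinates centred at $x_0$. $\Phi(\theta)$ is the (smooth, nonzero) vector-valued angular eigenfunction associated with the singular exponent $\lambda$ of the corner, and $\Lambda$ is the stress-intensity factor. $u$ is the exact displacement, $u\in(H^1(\Omega))^2$. $\{\mathcal T^h\}$ is a family of quasi-uniform Cartesian background meshes, $h=\max_T\operatorname{diam}T$, $T^h_\Omega=\{T\in\mathcal T^h:T\cap\Omega\ne\emptyset\}$, $\Omega_T=\bigcup_{T\in T^h_\Omega}T$, and, for $p\ge1$, $\mathbb V_h=\{v\in[C^0(\Omega_T)]^2:v|_T\in[\mathcal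 Q_p(T)]^2\ \forall T\in T^h_\Omega\}$, where $\mathcal Q_p(T)$ is the space of polynomials of degree at most $p$ in each coordinate. The constant $\rho$ is the same for all meshes in the family (the cell $K^*$ may depend on $h$). *)

theory Defs
  imports "HOL-Analysis.Analysis"
begin

text \<open>Functions are total; only their restriction to the set \<open>U\<close> matters, and equality almost
  everywhere is not factored out.\<close>

definition L2 :: "(real^2) set \<Rightarrow> (real^2 \<Rightarrow> real) set" where
  "L2 U = {f. f \<in> borel_measurable (lebesgue_on U) \<and> integrable (lebesgue_on U) (\<lambda>x. (f x)\<^sup>2)}"

definition partial :: "2 \<Rightarrow> (real^2 \<Rightarrow> real) \<Rightarrow> real^2 \<Rightarrow> real" where
  "partial i f x = frechet_derivative f (at x) (axis i 1)"

primrec C_k :: "nat \<Rightarrow> (real^2 \<Rightarrow> real) \<Rightarrow> bool" where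
  "C_k 0 f \<longleftrightarrow> continuous_on UNIV f"
| "C_k (Suc k) f \<longleftrightarrow> (\<forall>x. f differentiable (at x)) \<and> (\<forall>i. C_k k (partial i f))"

definition test_functions :: "(real^2) set \<Rightarrow> (real^2 \<Rightarrow> real) set" where
  "test_functions U = {\<phi>. (\<forall>k. C_k k \<phi>) \<and> compact (closure {x. \<phi> x \<noteq> 0}) \<and> closure {x. \<phi> x \<noteq> 0} \<subseteq> U}"

definition has_weak_partial :: "(real^2) set \<Rightarrow> 2 \<Rightarrow> (real^2 \<Rightarrow> real) \<Rightarrow> (real^2 \<Rightarrow> real) \<Rightarrow> bool" where
  "has_weak_partial U i f g \<longleftrightarrow> f \<in> L2 U \<and> g \<in> L2 U \<and>
     (\<forall>\<phi>\<in>test_functions U.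
        (LINT x|lebesgue_on U. f x * partial i \<phi> x) = - (LINT x|lebesgue_on U. g x * \<phi> x))"

definition weak_partial :: "(real^2) set \<Rightarrow> 2 \<Rightarrow> (real^2 \<Rightarrow> real) \<Rightarrow> real^2 \<Rightarrow> real" where
  "weak_partial U i f = (SOME g. has_weak_partial U i f g)"

text \<open>The squared Sobolev--Slobodeckij (Gagliardo) seminorm of order \<open>\<sigma>\<close>, for \<open>0 < \<sigma> < 1\<close>, with
  kernel exponent \<open>d + 2\<sigma>\<close> and \<open>d = 2\<close>.\<close>

definition slobodeckij :: "real \<Rightarrow> (real^2) set \<Rightarrow> (real^2 \<Rightarrow> real) \<Rightarrow> ennreal" where
  "slobodeckij \<sigma> U f =
     (\<integral>\<^sup>+x. (\<integral>\<^sup>+y. ennreal ((f x - f y)\<^sup>2 / norm (x - y) powr (2 + 2 * \<sigma>)) \<partial>lebesgue_on U)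
        \<partial>lebesgue_on U)"

text \<open>\<open>sobolev_aux m \<sigma> U\<close> is $H^{m+\sigma}(U)$ with $0 \le \sigma < 1$: all weak derivatives of order
  at most \<open>m\<close> lie in $L^2(U)$, and those of order \<open>m\<close> have finite seminorm of order \<open>\<sigma>\<close> if
  \<open>\<sigma> > 0\<close>.\<close>

primrec sobolev_aux :: "nat \<Rightarrow> real \<Rightarrow> (real^2) set \<Rightarrow> (real^2 \<Rightarrow> real) set" where
  "sobolev_aux 0 \<sigma> U = {f \<in> L2 U. \<sigma> > 0 \<longrightarrow> slobodeckij \<sigma> U f < \<infinity>}"
| "sobolev_aux (Suc m) \<sigma> U = {f \<in> L2 U. \<forall>i. \<exists>g. has_weak_partial U i f g \<and> g \<in> sobolev_aux m \<sigma> U}"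

definition sobolev :: "real \<Rightarrow> (real^2) set \<Rightarrow> (real^2 \<Rightarrow> real) set" where
  "sobolev s U = sobolev_aux (nat \<lfloor>s\<rfloor>) (frac s) U"

definition sobolev_vec :: "real \<Rightarrow> (real^2) set \<Rightarrow> (real^2 \<Rightarrow> real^2) set" where
  "sobolev_vec s U = {v. \<forall>i. (\<lambda>x. v x $ i) \<in> sobolev s U}"

definition grad_L2_norm :: "(real^2) set \<Rightarrow> (real^2 \<Rightarrow> real^2) \<Rightarrow> real" where
  "grad_L2_norm U v =
     sqrt (LINT x|lebesgue_on U. (\<Sum>i\<in>UNIV. \<Sum>j\<in>UNIV. (weak_partial U j (\<lambda>y. v y $ i) x)\<^sup>2))"

definition polar :: "real^2 \<Rightarrow> real \<Rightarrow> real \<Rightarrow> real^2" where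
  "polar x\<^sub>0 r \<theta> = x\<^sub>0 + r *\<^sub>R vector [cos \<theta>, sin \<theta>]"

definition sector :: "real^2 \<Rightarrow> real \<Rightarrow> real \<Rightarrow> (real^2) set" where
  "sector x\<^sub>0 \<alpha> \<omega> = {polar x\<^sub>0 r \<theta> | r \<theta>. 0 < r \<and> \<alpha> < \<theta> \<and> \<theta> < \<alpha> + \<omega>}"

definition corner_at :: "(real^2) set \<Rightarrow> real^2 \<Rightarrow> real \<Rightarrow> real \<Rightarrow> bool" where
  "corner_at \<Omega> x\<^sub>0 \<alpha> \<omega> \<longleftrightarrow> x\<^sub>0 \<in> frontier \<Omega> \<and> 0 < \<omega> \<and> \<omega> \<le> 2 * pi \<and>
     (\<exists>R>0. \<Omega> \<inter> ball x\<^sub>0 R = sector x\<^sub>0 \<alpha> \<omega> \<inter> ball x\<^sub>0 R)"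

text \<open>One-sided derivatives of all orders are meant at the end points.\<close>

definition smooth_on_interval :: "real \<Rightarrow> real \<Rightarrow> (real \<Rightarrow> real^2) \<Rightarrow> bool" where
  "smooth_on_interval a b \<Phi> \<longleftrightarrow>
     (\<exists>D. D 0 = \<Phi> \<and>
        (\<forall>k::nat. \<forall>\<theta>\<in>{a..b}. (D k has_vector_derivative D (Suc k) \<theta>) (at \<theta> within {a..b})))"

text \<open>As the opening angle is at most \<open>2 * pi\<close>, polar coordinates in the sector are unique.\<close>

definition corner_expansion ::
  "(real^2) set \<Rightarrow> real^2 \<Rightarrow> real \<Rightarrow> real \<Rightarrow> real \<Rightarrow> real \<Rightarrow> (real \<Rightarrow> real^2) \<Rightarrow> real \<Rightarrow>
   (real^2 \<Rightarrow> real^2) \<Rightarrow> (real^2 \<Rightarrow> real^2) \<Rightarrow> bool" where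
  "corner_expansion \<Omega> x\<^sub>0 \<alpha> \<omega> \<Lambda> lam \<Phi> \<epsilon> u w \<longleftrightarrow>
     (\<exists>R>0. w \<in> sobolev_vec (1 + lam + \<epsilon>) (\<Omega> \<inter> ball x\<^sub>0 R) \<and>
        (AE x in lebesgue_on (\<Omega> \<inter> ball x\<^sub>0 R).
           \<forall>r \<theta>. 0 < r \<and> \<alpha> < \<theta> \<and> \<theta> < \<alpha> + \<omega> \<and> x = polar x\<^sub>0 r \<theta>
             \<longrightarrow> u x = (\<Lambda> * r powr lam) *\<^sub>R \<Phi> \<theta> + w x))"

definition consecutive :: "real set \<Rightarrow> real \<Rightarrow> real \<Rightarrow> bool" where
  "consecutive X a b \<longleftrightarrow> a \<in> X \<and> b \<in> X \<and> a < b \<and> X \<inter> {a<..<b} = {}"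

definition cartesian_mesh :: "(real^2) set set \<Rightarrow> bool" where
  "cartesian_mesh \<T> \<longleftrightarrow>
     (\<exists>X Y. finite X \<and> finite Y \<and>
        \<T> = {cbox (vector [a, c]) (vector [b, d]) | a b c d. consecutive X a b \<and> consecutive Y c d})"

definition mesh_size :: "(real^2) set set \<Rightarrow> real" where
  "mesh_size \<T> = Max (diameter ` \<T>)"

definition quasi_uniform :: "(real^2) set set set \<Rightarrow> bool" where
  "quasi_uniform \<F> \<longleftrightarrow> (\<exists>\<kappa>>0. \<forall>\<T>\<in>\<F>. \<forall>T\<in>\<T>. \<exists>z. cball z (\<kappa> * mesh_size \<T>) \<subseteq> T)"

definition active_mesh :: "(real^2) set \<Rightarrow> (real^2) set set \<Rightarrow> (real^2) set set" where
  "active_mesh \<Omega> \<T> = {T \<in> \<T>. T \<inter> \<Omega> \<noteq> {}}"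

definition Q_poly :: "nat \<Rightarrow> (real^2 \<Rightarrow> real) set" where
  "Q_poly p = {q. \<exists>a :: nat \<Rightarrow> nat \<Rightarrow> real.
     \<forall>x. q x = (\<Sum>j\<le>p. \<Sum>k\<le>p. a j k * (x $ 1) ^ j * (x $ 2) ^ k)}"

definition fe_space :: "(real^2) set \<Rightarrow> (real^2) set set \<Rightarrow> nat \<Rightarrow> (real^2 \<Rightarrow> real^2) set" where
  "fe_space \<Omega> \<T> p = {v. continuous_on (\<Union>(active_mesh \<Omega> \<T>)) v \<and>
     (\<forall>T\<in>active_mesh \<Omega> \<T>. \<forall>i. \<exists>q\<in>Q_poly p. \<forall>x\<in>T. v x $ i = q x)}"

end

theory Submission
  imports Defs
begin

text \<open>The bound is proved by duality, with a single scaled test function. The singular part extends to a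
  function \<open>s\<close> on the plane that is homogeneous of degree \<open>lam\<close>. If \<open>\<phi> \<mapsto> \<integral> s \<phi>\<close> vanished on all
  derivatives of order \<open>N\<close> of test functions supported in the sector, Euler's identity would force it to
  vanish identically, because \<open>lam\<close> is none of the integers \<open>0, \<dots>, N - 1\<close>. So some
  \<open>N\<close>-th derivative \<open>\<xi> = \<partial>\<^sub>j \<psi>\<close> satisfies \<open>\<integral> s \<xi> \<noteq> 0\<close>. Scaled to the mesh
  cell around the corner, \<open>\<xi>\<close> annihilates the polynomials of \<open>Q_poly p\<close> once \<open>N > 2 * p\<close>, it sees the
  singular part at the scale \<open>h powr (2 + lam)\<close>, and, once \<open>N > 1 + lam + \<epsilon>\<close>, integrating by parts
  against the Sobolev remainder leaves only \<open>O(h powr (2 + lam + \<epsilon>))\<close>. Moving \<open>\<partial>\<^sub>j\<close> back to the error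
  and using Cauchy--Schwarz gives the bound.\<close>

section \<open>Partial derivatives and test functions\<close>

text \<open>The corner is a boundary point, so the test function must be supported strictly inside
  the sector; duality then asks for no trace and no extension of the remainder across the boundary.
  The mesh enters through one cell only: a ball of radius \<open>\<rho> * h\<close> about the corner
  lies in \<open>K\<close>, where \<open>u\<^sub>h\<close> is polynomial, so one reference function
  serves all meshes and all discrete functions. Noninteger \<open>lam\<close> excludes a singular
  part that is itself a homogeneous polynomial of degree below \<open>N\<close>, which
  \<open>N\<close>-th derivatives of test functions cannot distinguish from \<open>0\<close>. The
  number \<open>2 * p\<close> arises because \<open>Q_poly p\<close> limits the degree per
  coordinate, so total degrees reach \<open>2 * p\<close>. Count of powers: the singular part has
  size \<open>h powr lam\<close> on an area \<open>h\<^sup>2\<close>. The remainder gives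
  \<open>1 + lam + \<epsilon>\<close> powers by its regularity and one more from the
  \<open>L2\<close> norm of the scaled test function, so it is smaller by
  \<open>h powr \<epsilon>\<close>. On the other side, moving the derivative to the error costs one
  \<open>h\<close> and the \<open>L2\<close> norm of the scaled primitive another, and
  \<open>h powr (2 + lam)\<close> divided by \<open>h\<^sup>2\<close> is the claimed rate.\<close>

lemma partial_eqI: "(f has_derivative f') (at x) \<Longrightarrow> partial i f x = f' (axis i 1)"
  unfolding partial_def by (metis frechet_derivative_at)

lemma has_derivative_partials:
  assumes "f differentiable (at x)"
  shows "(f has_derivative (\<lambda>v. \<Sum>i\<in>UNIV. v $ i * partial i f x)) (at x)"
proof -
  have d: "(f has_derivative frechet_derivative f (at x)) (at x)"
    using assms frechet_derivative_works by blast
  then have lin: "linear (frechet_derivative f (at x))"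
    by (simp add: has_derivative_linear)
  have "frechet_derivative f (at x) v = (\<Sum>i\<in>UNIV. v $ i * partial i f x)" for v
  proof -
    have "frechet_derivative f (at x) v
        = frechet_derivative f (at x) (\<Sum>i\<in>UNIV. (v $ i) *\<^sub>R axis i 1)"
      by (metis (no_types) basis_expansion scalar_mult_eq_scaleR sum.cong)
    also have "\<dots> = (\<Sum>i\<in>UNIV. v $ i * partial i f x)"
      by (simp add: linear_sum[OF lin] linear_scale[OF lin] partial_def)
    finally show ?thesis .
  qed
  with d show ?thesis by (metis (no_types, lifting) ext)
qed

lemma has_field_derivative_partial:
  assumes "f differentiable (at (x + t *\<^sub>R axis i 1))"
  shows "((\<lambda>t. f (x + t *\<^sub>R axis i 1)) has_real_derivative partial i f (x + t *\<^sub>R axis i 1)) (at t within S)"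
proof -
  have "((\<lambda>t. x + t *\<^sub>R axis i 1) has_derivative (\<lambda>s. s *\<^sub>R axis i 1)) (at t within S)"
    by (auto intro!: derivative_eq_intros)
  from has_derivative_compose[OF this has_derivative_partials[OF assms]]
  have "((\<lambda>t. f (x + t *\<^sub>R axis i 1)) has_derivative
     (\<lambda>s. \<Sum>j\<in>UNIV. (s *\<^sub>R axis i 1) $ j * partial j f (x + t *\<^sub>R axis i 1))) (at t within S)" .
  moreover have "(\<Sum>j\<in>UNIV. (s *\<^sub>R axis i 1) $ j * partial j f y) = s * partial i f y" for s y
    by (simp add: axis_def if_distrib[of "\<lambda>u. s * u * _"] mult.assoc cong: if_cong)
       (simp add: if_distrib[of "\<lambda>u. u * _"] if_distrib[of "\<lambda>u. s * u"] sum.delta cong: if_cong)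
  moreover have "(\<lambda>s. s * partial i f (x + t *\<^sub>R axis i 1)) = (*) (partial i f (x + t *\<^sub>R axis i 1))"
    by (rule ext) simp
  ultimately show ?thesis
    by (simp only: has_field_derivative_def)
qed

lemma C_k_continuous: "C_k k f \<Longrightarrow> continuous_on UNIV f"
  by (cases k) (simp_all add: continuous_at_imp_continuous_on differentiable_imp_continuous_within)

lemma C_1_mult:
  assumes "C_k 1 f" "C_k 1 g"
  shows "C_k 1 (\<lambda>x. f x * g x)"
    and "partial i (\<lambda>x. f x * g x) = (\<lambda>x. f x * partial i g x + partial i f x * g x)"
proof -
  have f: "\<And>x. f differentiable (at x)" "\<And>i. continuous_on UNIV (partial i f)" "continuous_on UNIV f"
    and g: "\<And>x. g differentiable (at x)" "\<And>i. continuous_on UNIV (partial i g)" "continuous_on UNIV g"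
    using assms C_k_continuous[OF assms(1)] C_k_continuous[OF assms(2)] by auto
  have p: "partial i (\<lambda>x. f x * g x) = (\<lambda>x. f x * partial i g x + partial i f x * g x)" for i
  proof
    fix x
    show "partial i (\<lambda>x. f x * g x) x = f x * partial i g x + partial i f x * g x"
      unfolding partial_def
      by (rule partial_eqI[unfolded partial_def, OF has_derivative_mult])
         (use f(1) g(1) frechet_derivative_works in auto)
  qed
  then show "partial i (\<lambda>x. f x * g x) = (\<lambda>x. f x * partial i g x + partial i f x * g x)" .
  show "C_k 1 (\<lambda>x. f x * g x)"
    using f g by (auto simp: p intro!: continuous_intros differentiable_mult)
qed

section \<open>Dilation about the corner\<close>

definition rescale :: "real^2 \<Rightarrow> real \<Rightarrow> (real^2 \<Rightarrow> real) \<Rightarrow> real^2 \<Rightarrow> real" where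
  "rescale x\<^sub>0 h f = (\<lambda>x. f ((1/h) *\<^sub>R (x - x\<^sub>0)))"

lemma rescale_has_derivative:
  assumes "f differentiable (at ((1/h) *\<^sub>R (x - x\<^sub>0)))"
  shows "(rescale x\<^sub>0 h f has_derivative
           (\<lambda>v. frechet_derivative f (at ((1/h) *\<^sub>R (x - x\<^sub>0))) ((1/h) *\<^sub>R v))) (at x)"
proof -
  have 1: "((\<lambda>x. (1/h) *\<^sub>R (x - x\<^sub>0)) has_derivative (\<lambda>v. (1/h) *\<^sub>R v)) (at x)"
    by (auto intro!: derivative_eq_intros)
  show ?thesis unfolding rescale_def
    using has_derivative_compose[OF 1] assms frechet_derivative_works by blast
qed

lemma partial_rescale:
  assumes "\<And>x. f differentiable (at x)"
  shows "partial i (rescale x\<^sub>0 h f) = (\<lambda>x. (1/h) * rescale x\<^sub>0 h (partial i f) x)"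
proof
  fix x
  have "linear (frechet_derivative f (at ((1/h) *\<^sub>R (x - x\<^sub>0))))"
    using assms linear_frechet_derivative by blast
  then show "partial i (rescale x\<^sub>0 h f) x = (1/h) * rescale x\<^sub>0 h (partial i f) x"
    using partial_eqI[OF rescale_has_derivative[OF assms]]
    by (simp add: linear_scale rescale_def partial_def)
qed

lemma C_k_cmult:
  "C_k k f \<Longrightarrow> C_k k (\<lambda>x. c * f x)"
proof (induction k arbitrary: f)
  case 0 then show ?case by (auto intro!: continuous_intros)
next
  case (Suc k)
  have d: "\<And>x. f differentiable (at x)" using Suc.prems by simp
  have "partial i (\<lambda>x. c * f x) = (\<lambda>x. c * partial i f x)" for i
  proof
    fix x
    have "((\<lambda>x. c * f x) has_derivative (\<lambda>v. c * frechet_derivative f (at x) v)) (at x)"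
      using d frechet_derivative_works by (intro has_derivative_mult_right) auto
    from partial_eqI[OF this] show "partial i (\<lambda>x. c * f x) x = c * partial i f x"
      by (simp add: partial_def)
  qed
  with Suc d show ?case by (auto intro!: differentiable_mult)
qed

lemma C_k_rescale: "C_k k f \<Longrightarrow> C_k k (rescale x\<^sub>0 h f)"
proof (induction k arbitrary: f)
  case 0
  have "continuous_on UNIV (\<lambda>x. (1/h) *\<^sub>R (x - x\<^sub>0))" by (intro continuous_intros)
  with 0 show ?case
    using continuous_on_compose2[of UNIV f UNIV "\<lambda>x. (1/h) *\<^sub>R (x - x\<^sub>0)"] by (simp add: rescale_def)
next
  case (Suc k)
  have d: "\<And>x. f differentiable (at x)" using Suc.prems by simp
  have "rescale x\<^sub>0 h f differentiable (at x)" for x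
    using rescale_has_derivative[OF d] differentiable_def by blast
  with Suc show ?case by (auto simp: partial_rescale[OF d] intro!: C_k_cmult simp del: times_divide_eq_left)
qed

section \<open>Compactly supported functions\<close>

lemma test_functionsD:
  assumes "\<phi> \<in> test_functions U"
  shows "C_k k \<phi>" "continuous_on UNIV \<phi>" "\<phi> differentiable (at x)" "continuous_on UNIV (partial i \<phi>)"
    "x \<notin> U \<Longrightarrow> \<phi> x = 0" "x \<notin> U \<Longrightarrow> partial i \<phi> x = 0" 
    "x \<notin> closure {x. \<phi> x \<noteq> 0} \<Longrightarrow> partial i \<phi> x = 0"
proof -
  have c: "C_k k \<phi>" for k using assms by (simp add: test_functions_def)
  then show "C_k k \<phi>" "continuous_on UNIV \<phi>" by (auto intro: C_k_continuous)
  show "\<phi> differentiable (at x)" "continuous_on UNIV (partial i \<phi>)" using c[of 1] by auto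
  have s: "closure {x. \<phi> x \<noteq> 0} \<subseteq> U" using assms by (simp add: test_functions_def)
  then show "x \<notin> U \<Longrightarrow> \<phi> x = 0" using closure_subset[of "{x. \<phi> x \<noteq> 0}"] by blast
  show *: "partial i \<phi> x = 0" if "x \<notin> closure {x. \<phi> x \<noteq> 0}" for x
  proof -
    have "(\<phi> has_derivative (\<lambda>v. 0)) (at x)"
    proof (rule has_derivative_transform_within_open[of "\<lambda>x. 0"])
      show "open (- closure {x. \<phi> x \<noteq> 0})" by (simp only: open_Compl closed_closure)
      show "x \<in> - closure {x. \<phi> x \<noteq> 0}" using that by simp
      show "\<And>y. y \<in> - closure {x. \<phi> x \<noteq> 0} \<Longrightarrow> 0 = \<phi> y"
        using closure_subset[of "{x. \<phi> x \<noteq> 0}"] by auto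
    qed simp
    from partial_eqI[OF this] show ?thesis by simp
  qed
  then show "x \<notin> U \<Longrightarrow> partial i \<phi> x = 0" using s by blast
qed

lemma test_functions_partial:
  assumes "\<phi> \<in> test_functions U"
  shows "partial i \<phi> \<in> test_functions U"
proof -
  have "{x. partial i \<phi> x \<noteq> 0} \<subseteq> closure {x. \<phi> x \<noteq> 0}"
    using test_functionsD(7)[OF assms] by blast
  then have cl: "closure {x. partial i \<phi> x \<noteq> 0} \<subseteq> closure {x. \<phi> x \<noteq> 0}"
    by (simp add: closure_minimal)
  have "C_k (Suc k) \<phi>" for k using assms by (simp add: test_functions_def)
  then have "C_k k (partial i \<phi>)" for k by simp
  moreover have "compact (closure {x. partial i \<phi> x \<noteq> 0})"
    using assms cl compact_Int_closed[OF _ closed_closure, of "closure {x. \<phi> x \<noteq> 0}" "{x. partial i \<phi> x \<noteq> 0}"]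
    by (simp add: test_functions_def Int_absorb1)
  ultimately show ?thesis using assms cl by (auto simp: test_functions_def)
qed

lemma test_functions_rescale:
  assumes "\<phi> \<in> test_functions U" "h > 0" "(\<lambda>y. x\<^sub>0 + h *\<^sub>R y) ` U \<subseteq> V"
  shows "rescale x\<^sub>0 h \<phi> \<in> test_functions V"
proof -
  let ?K = "(\<lambda>y. x\<^sub>0 + h *\<^sub>R y) ` closure {x. \<phi> x \<noteq> 0}"
  have K: "compact ?K" 
    using assms(1) by (intro compact_continuous_image) (auto simp: test_functions_def intro!: continuous_intros)
  have "{x. rescale x\<^sub>0 h \<phi> x \<noteq> 0} \<subseteq> ?K"
  proof
    fix x assume "x \<in> {x. rescale x\<^sub>0 h \<phi> x \<noteq> 0}"
    then have "(1/h) *\<^sub>R (x - x\<^sub>0) \<in> closure {x. \<phi> x \<noteq> 0}"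
      using closure_subset[of "{x. \<phi> x \<noteq> 0}"] by (auto simp: rescale_def)
    moreover have "x = x\<^sub>0 + h *\<^sub>R ((1/h) *\<^sub>R (x - x\<^sub>0))" using assms(2) by simp
    ultimately show "x \<in> ?K" by blast
  qed
  then have s: "closure {x. rescale x\<^sub>0 h \<phi> x \<noteq> 0} \<subseteq> ?K"
    using K by (simp add: closure_minimal compact_imp_closed)
  then have "compact (closure {x. rescale x\<^sub>0 h \<phi> x \<noteq> 0})"
    using K by (metis bounded_subset closed_closure compact_eq_bounded_closed)
  moreover have "?K \<subseteq> V" using assms(1,3) by (force simp: test_functions_def)
  moreover have "C_k k (rescale x\<^sub>0 h \<phi>)" for k using assms(1) by (intro C_k_rescale) (simp add: test_functions_def)
  ultimately show ?thesis using s by (auto simp: test_functions_def)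
qed

lemma continuous_compact_support_bounded:
  fixes f :: "real^2 \<Rightarrow> real"
  assumes "continuous_on UNIV f" "\<And>x. x \<notin> K \<Longrightarrow> f x = 0" "bounded K"
  obtains M where "M > 0" "\<And>x. \<bar>f x\<bar> \<le> M"
proof -
  obtain B where B: "K \<subseteq> cball 0 B" using bounded_subset_ballD[OF assms(3)] ball_subset_cball by (metis subset_trans)
  have "compact (f ` cball 0 B)" 
    by (intro compact_continuous_image continuous_on_subset[OF assms(1)]) auto
  then obtain M where M: "M > 0" "\<And>x. x \<in> cball 0 B \<Longrightarrow> \<bar>f x\<bar> \<le> M"
    using compact_imp_bounded bounded_pos by (metis imageI real_norm_def)
  have "\<bar>f x\<bar> \<le> M" for x
  proof (cases "x \<in> cball 0 B")
    case False
    then have "x \<notin> K" using B by blast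
    with M(1) assms(2) show ?thesis by simp
  qed (rule M(2))
  with M show ?thesis using that by blast
qed

text \<open>Bounded support makes the continuous partial derivatives bounded on the whole plane; the
  mean value inequality on the convex set \<open>UNIV\<close> turns this into a global Lipschitz
  constant.\<close>

lemma C_1_lipschitz:
  assumes "C_k 1 f" "\<And>x. x \<notin> K \<Longrightarrow> f x = 0" "bounded K"
  obtains M where "M > 0" "\<And>x y. \<bar>f x - f y\<bar> \<le> M * norm (x - y)"
proof -
  obtain B where B: "K \<subseteq> ball 0 B" using assms(3) bounded_subset_ballD by blast
  have d: "f differentiable (at x)" for x using assms(1) by simp
  have p0: "partial i f x = 0" if "x \<notin> cball 0 B" for i x
  proof -
    have "(f has_derivative (\<lambda>v. 0)) (at x)"
    proof (rule has_derivative_transform_within_open[of "\<lambda>x. 0"])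
      show "open (- cball (0::real^2) B)" by (simp add: open_Compl)
      show "\<And>y. y \<in> - cball 0 B \<Longrightarrow> 0 = f y" using B assms(2) by force
    qed (use that in auto)
    from partial_eqI[OF this] show ?thesis by simp
  qed
  have "\<exists>M>0. \<forall>x. \<bar>partial i f x\<bar> \<le> M" for i
  proof -
    have "continuous_on UNIV (partial i f)" using assms(1) by simp
    then obtain M where "M > 0" "\<And>x. \<bar>partial i f x\<bar> \<le> M"
      using continuous_compact_support_bounded[of "partial i f" "cball 0 B"] p0 bounded_cball by blast
    then show ?thesis by blast
  qed
  then obtain M where M: "\<And>i. M i > 0" "\<And>i x. \<bar>partial i f x\<bar> \<le> M i" by metis
  have "norm (f x - f y) \<le> (\<Sum>i\<in>UNIV. M i) * norm (x - y)" for x y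
  proof (rule differentiable_bound[of UNIV f "\<lambda>x v. \<Sum>i\<in>UNIV. v $ i * partial i f x"])
    show "onorm (\<lambda>v. \<Sum>i\<in>UNIV. v $ i * partial i f x) \<le> (\<Sum>i\<in>UNIV. M i)" for x
    proof (rule onorm_le)
      fix v :: "real^2"
      have "norm (\<Sum>i\<in>UNIV. v $ i * partial i f x) \<le> (\<Sum>i\<in>UNIV. \<bar>v $ i * partial i f x\<bar>)"
        unfolding real_norm_def by (rule sum_abs)
      also have "\<dots> \<le> (\<Sum>i\<in>UNIV. norm v * M i)"
        using M(2) component_le_norm_cart[of v] by (auto simp: abs_mult intro!: sum_mono mult_mono)
      finally show "norm (\<Sum>i\<in>UNIV. v $ i * partial i f x) \<le> (\<Sum>i\<in>UNIV. M i) * norm v"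
        by (simp add: sum_distrib_left mult.commute)
    qed
  qed (use has_derivative_partials[OF d] in auto)
  moreover have "(\<Sum>i\<in>UNIV. M i) > 0" using M(1) by (intro sum_pos) auto
  ultimately show ?thesis using that by (metis real_norm_def)
qed

lemma test_functions_support_bounded:
  "\<phi> \<in> test_functions U \<Longrightarrow> bounded {x. \<phi> x \<noteq> 0}"
  unfolding test_functions_def
  using bounded_subset[OF compact_imp_bounded closure_subset] by blast

section \<open>Tensor product test functions\<close>

text \<open>The derivative is an existential witness instead of \<open>deriv g\<close>, so that
  closure under sums, products and affine substitutions is proved by supplying a formula.\<close>

primrec diff_times :: "nat \<Rightarrow> (real \<Rightarrow> real) \<Rightarrow> bool" where
  "diff_times 0 g \<longleftrightarrow> True"
| "diff_times (Suc k) g \<longleftrightarrow> (\<exists>g'. (\<forall>t. (g has_real_derivative g' t) (at t)) \<and> diff_times k g')"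

definition smooth1 :: "(real \<Rightarrow> real) \<Rightarrow> bool" where
  "smooth1 g \<longleftrightarrow> (\<forall>k. diff_times k g)"

lemma diff_times_Suc_imp: "diff_times (Suc k) g \<Longrightarrow> diff_times k g"
  by (induction k arbitrary: g) auto

lemma diff_times_add: "diff_times k f \<Longrightarrow> diff_times k g \<Longrightarrow> diff_times k (\<lambda>t. f t + g t)"
proof (induction k arbitrary: f g)
  case (Suc k)
  then obtain f' g' where "\<forall>t. (f has_real_derivative f' t) (at t)" "diff_times k f'"
      "\<forall>t. (g has_real_derivative g' t) (at t)" "diff_times k g'" by auto
  with Suc.IH[of f' g'] show ?case
    by (auto intro!: exI[of _ "\<lambda>t. f' t + g' t"] DERIV_add)
qed simp

lemma diff_times_mult: "diff_times k f \<Longrightarrow> diff_times k g \<Longrightarrow> diff_times k (\<lambda>t. f t * g t)"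
proof (induction k arbitrary: f g)
  case (Suc k)
  then obtain f' g' where *: "\<forall>t. (f has_real_derivative f' t) (at t)" "diff_times k f'"
      "\<forall>t. (g has_real_derivative g' t) (at t)" "diff_times k g'" by auto
  \<comment> \<open>The product rule retains undifferentiated factors, which are known to order
    \<open>Suc k\<close> and have to be lowered to order \<open>k\<close>.\<close>
  then have "diff_times k (\<lambda>t. f' t * g t + g' t * f t)"
    using Suc diff_times_Suc_imp by (intro diff_times_add Suc.IH) blast+
  with * show ?case
    by (auto intro!: exI[of _ "\<lambda>t. f' t * g t + g' t * f t"] DERIV_mult)
qed simp

lemma diff_times_const: "diff_times k (\<lambda>t. c)"
proof (induction k arbitrary: c)
  case (Suc k)
  then show ?case by (auto intro!: exI[of _ "\<lambda>t. 0::real"])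
qed simp

lemma diff_times_ident: "diff_times k (\<lambda>t. t)"
  by (cases k) (auto intro!: exI[of _ "\<lambda>t. 1::real"] diff_times_const)

lemma diff_times_affine: "diff_times k g \<Longrightarrow> diff_times k (\<lambda>t. g (c * t + d))"
proof (induction k arbitrary: g)
  case (Suc k)
  then obtain g' where *: "\<forall>t. (g has_real_derivative g' t) (at t)" "diff_times k g'" by auto
  have "((\<lambda>t. g (c * t + d)) has_real_derivative g' (c * t + d) * c) (at t)" for t
  proof -
    have "((\<lambda>t. c * t + d) has_real_derivative c) (at t)" by (auto intro!: derivative_eq_intros)
    from DERIV_chain2[OF _ this, of g] * show ?thesis by blast
  qed
  moreover have "diff_times k (\<lambda>t. g' (c * t + d) * c)"
    using Suc.IH[OF *(2)] by (intro diff_times_mult diff_times_const)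
  ultimately show ?case by (auto intro!: exI[of _ "\<lambda>t. g' (c * t + d) * c"])
qed simp

text \<open>Each order \<open>k\<close> brings its own witness, but derivatives are unique, so all
  witnesses coincide with \<open>deriv g\<close>.\<close>

lemma smooth1_deriv:
  assumes "smooth1 g"
  shows "(g has_real_derivative deriv g t) (at t)" "smooth1 (deriv g)"
proof -
  have *: "\<exists>g'. (\<forall>t. (g has_real_derivative g' t) (at t)) \<and> diff_times k g'" for k
    using assms unfolding smooth1_def by (metis diff_times.simps(2))
  then show "(g has_real_derivative deriv g t) (at t)" by (metis DERIV_imp_deriv)
  have "diff_times k (deriv g)" for k
  proof -
    obtain g' where g': "\<And>t. (g has_real_derivative g' t) (at t)" "diff_times k g'" using * by blast
    then have "deriv g = g'" using DERIV_imp_deriv by blast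
    with g' show ?thesis by simp
  qed
  then show "smooth1 (deriv g)" by (simp add: smooth1_def)
qed

lemma smooth1_mult: "smooth1 f \<Longrightarrow> smooth1 g \<Longrightarrow> smooth1 (\<lambda>t. f t * g t)"
  by (simp add: smooth1_def diff_times_mult)

lemma smooth1_ident: "smooth1 (\<lambda>t. t)"
  by (simp add: smooth1_def diff_times_ident)

text \<open>The flat function \<open>exp (- (1/t))\<close>, extended by \<open>0\<close>, with a
  polynomial factor in \<open>1/t\<close>: the factor makes the class closed under differentiation,
  so smoothness is an induction over it.\<close>

definition flat_exp :: "real poly \<Rightarrow> real \<Rightarrow> real" where
  "flat_exp P t = (if t > 0 then poly P (1/t) * exp (- (1/t)) else 0)"

lemma poly_mult_exp_tendsto_0: "((\<lambda>y::real. poly P y * exp (-y)) \<longlongrightarrow> 0) at_top"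
proof -
  have "((\<lambda>y::real. \<Sum>i\<le>degree P. coeff P i * (y ^ i / exp y)) \<longlongrightarrow> (\<Sum>i\<le>degree P. coeff P i * 0)) at_top"
    by (intro tendsto_sum tendsto_mult tendsto_const tendsto_power_div_exp_0)
  then show ?thesis
    by (simp add: poly_altdef exp_minus divide_inverse sum_distrib_right mult.assoc)
qed

text \<open>With \<open>y = 1/t\<close> one has \<open>dy/dt = - y\<^sup>2\<close>, so
  differentiating \<open>P(y) * exp (-y)\<close> gives
  \<open>y\<^sup>2 * (P(y) - P'(y)) * exp (-y)\<close>; this is the new polynomial.\<close>

lemma flat_exp_has_derivative:
  "(flat_exp P has_real_derivative flat_exp (monom 1 2 * (P - pderiv P)) t) (at t)"
proof (cases t "0::real" rule: linorder_cases)
  case less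
  have "((\<lambda>t. 0) has_real_derivative 0) (at t)" by simp
  then have "(flat_exp P has_real_derivative 0) (at t)"
    by (rule has_field_derivative_transform_within_open[where S="{..<0}"]) (use less in \<open>auto simp: flat_exp_def\<close>)
  with less show ?thesis by (simp add: flat_exp_def)
next
  case greater
  have "((\<lambda>t. poly P (1/t) * exp (- (1/t))) has_real_derivative
      poly P (1/t) * (exp (- (1/t)) * (1/t^2)) + poly (pderiv P) (1/t) * (- (1/t^2)) * exp (-(1/t))) (at t)"
    using greater
    by (auto intro!: derivative_eq_intros DERIV_chain2[OF poly_DERIV] simp: field_simps power2_eq_square)
  then have "((\<lambda>t. poly P (1/t) * exp (- (1/t))) has_real_derivative
      flat_exp (monom 1 2 * (P - pderiv P)) t) (at t)"
    using greater by (simp add: flat_exp_def poly_monom algebra_simps power_one_over)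
  then show ?thesis
    by (rule has_field_derivative_transform_within_open[where S="{0<..}"]) (use greater in \<open>auto simp: flat_exp_def\<close>)
next
  case equal
  have "((\<lambda>h. (flat_exp P (0 + h) - flat_exp P 0) / h) \<longlongrightarrow> 0) (at 0)"
    unfolding filterlim_split_at_real filterlim_at_split
  proof
    show "((\<lambda>h. (flat_exp P (0 + h) - flat_exp P 0) / h) \<longlongrightarrow> 0) (at_left 0)"
      by (rule tendsto_eventually)
         (auto simp: flat_exp_def eventually_at_filter)
    \<comment> \<open>For \<open>y = 1/h\<close> the right difference quotient at \<open>0\<close>
      is \<open>y * P(y) * exp (-y)\<close>, and \<open>pCons 0 P\<close> is the polynomial
      \<open>y * P(y)\<close>.\<close>
    have "((\<lambda>h. poly (pCons 0 P) (1/h) * exp (-(1/h))) \<longlongrightarrow> 0) (at_right 0)"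
      using poly_mult_exp_tendsto_0[of "pCons 0 P"]
      by (simp add: filterlim_at_right_to_top divide_inverse)
    then show "((\<lambda>h. (flat_exp P (0 + h) - flat_exp P 0) / h) \<longlongrightarrow> 0) (at_right 0)"
      by (rule Lim_transform_eventually) (auto simp: flat_exp_def eventually_at_filter field_simps)
  qed
  then show ?thesis using equal by (simp add: DERIV_def flat_exp_def)
qed

lemma smooth1_flat_exp: "smooth1 (flat_exp P)"
proof -
  have "diff_times k (flat_exp P)" for k
    by (induction k arbitrary: P) (auto intro: flat_exp_has_derivative)
  then show ?thesis by (simp add: smooth1_def)
qed

text \<open>The factors cut off at \<open>a - \<delta>\<close> and at \<open>a + \<delta>\<close>.
  The seemingly idle \<open>1 * t\<close> and \<open>-1 * t\<close> give the arguments the shape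
  \<open>c * t + d\<close> of \<open>diff_times_affine\<close>.\<close>

definition bump1 :: "real \<Rightarrow> real \<Rightarrow> real \<Rightarrow> real" where
  "bump1 a \<delta> t = flat_exp 1 (1 * t + (\<delta> - a)) * flat_exp 1 (-1 * t + (a + \<delta>))"

lemma bump1:
  "smooth1 (bump1 a \<delta>)" "bump1 a \<delta> t \<ge> 0" "bump1 a \<delta> t > 0 \<longleftrightarrow> \<bar>t - a\<bar> < \<delta>"
proof -
  show "smooth1 (bump1 a \<delta>)"
    unfolding bump1_def smooth1_def
    using smooth1_flat_exp unfolding smooth1_def
    by (intro allI diff_times_mult diff_times_affine) auto
qed (auto simp: bump1_def flat_exp_def zero_less_mult_iff)

section \<open>Products of one-variable functions\<close>

definition tensor :: "(real \<Rightarrow> real) \<Rightarrow> (real \<Rightarrow> real) \<Rightarrow> real^2 \<Rightarrow> real" where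
  "tensor f g x = f (x $ 1) * g (x $ 2)"

lemma tensor_has_derivative:
  assumes "smooth1 f" "smooth1 g"
  shows "(tensor f g has_derivative
     (\<lambda>v. f (x $ 1) * (v $ 2 * deriv g (x $ 2)) + (v $ 1 * deriv f (x $ 1)) * g (x $ 2))) (at x)"
proof -
  have c: "((\<lambda>x. x $ i) has_derivative (\<lambda>v. v $ i)) (at x)" for x :: "real^2" and i :: 2
    by (simp add: bounded_linear_imp_has_derivative bounded_linear_vec_nth)
  have 1: "((\<lambda>x. h (x $ i)) has_derivative (\<lambda>v. v $ i * deriv h (x $ i))) (at x)" if "smooth1 h" for h and i :: 2
    using has_derivative_compose[OF c] smooth1_deriv(1)[OF that]
    by (metis (no_types, lifting) ext has_field_derivative_def mult.commute)
  show ?thesis unfolding tensor_def[abs_def]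
    by (rule has_derivative_mult[OF 1[OF assms(1)] 1[OF assms(2)]])
qed

lemma partial_tensor:
  assumes "smooth1 f" "smooth1 g"
  shows "partial 1 (tensor f g) = tensor (deriv f) g" "partial 2 (tensor f g) = tensor f (deriv g)"
  using partial_eqI[OF tensor_has_derivative[OF assms]] by (auto simp: fun_eq_iff tensor_def axis_def)

lemma C_k_tensor: "smooth1 f \<Longrightarrow> smooth1 g \<Longrightarrow> C_k k (tensor f g)"
proof (induction k arbitrary: f g)
  case 0
  have "tensor f g differentiable (at x)" for x
    using tensor_has_derivative[OF 0] differentiable_def by blast
  then show ?case by (auto intro!: continuous_at_imp_continuous_on differentiable_imp_continuous_within)
next
  case (Suc k)
  have "tensor f g differentiable (at x)" for x
    using tensor_has_derivative[OF Suc.prems] differentiable_def by blast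
  with Suc show ?case by (simp add: forall_2 partial_tensor smooth1_deriv)
qed

text \<open>On tensor products mixed partial derivatives commute by inspection, and the class is closed
  under differentiation and under multiplication by coordinates.\<close>

definition tensor_tests :: "(real^2) set \<Rightarrow> (real^2 \<Rightarrow> real) set" where
  "tensor_tests U = {\<phi> \<in> test_functions U. \<exists>f g. smooth1 f \<and> smooth1 g \<and> \<phi> = tensor f g}"

lemma tensor_tests_partial:
  assumes "\<phi> \<in> tensor_tests U" shows "partial i \<phi> \<in> tensor_tests U"
proof -
  obtain f g where *: "smooth1 f" "smooth1 g" "\<phi> = tensor f g" using assms by (auto simp: tensor_tests_def)
  have "\<exists>f g. smooth1 f \<and> smooth1 g \<and> partial i \<phi> = tensor f g"
    using exhaust_2[of i] * partial_tensor[OF *(1,2)] smooth1_deriv(2) by metis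
  with assms show ?thesis by (auto simp: tensor_tests_def test_functions_partial)
qed

lemma tensor_tests_mult_component:
  assumes "\<phi> \<in> tensor_tests U" shows "(\<lambda>x. x $ i * \<phi> x) \<in> tensor_tests U"
proof -
  obtain f g where *: "smooth1 f" "smooth1 g" "\<phi> = tensor f g" using assms by (auto simp: tensor_tests_def)
  have "(\<lambda>x. x $ 1 * \<phi> x) = tensor (\<lambda>t. t * f t) g" "(\<lambda>x. x $ 2 * \<phi> x) = tensor f (\<lambda>t. t * g t)"
    using * by (auto simp: tensor_def)
  then obtain f' g' where f': "smooth1 f'" "smooth1 g'" "(\<lambda>x. x $ i * \<phi> x) = tensor f' g'"
    using exhaust_2[of i] * smooth1_mult[OF smooth1_ident] by metis
  have "closure {x. x $ i * \<phi> x \<noteq> 0} \<subseteq> closure {x. \<phi> x \<noteq> 0}" by (rule closure_mono) auto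
  moreover from this have "compact (closure {x. x $ i * \<phi> x \<noteq> 0})"
    using assms compact_Int_closed[OF _ closed_closure, of "closure {x. \<phi> x \<noteq> 0}" "{x. x $ i * \<phi> x \<noteq> 0}"]
    by (simp add: tensor_tests_def test_functions_def Int_absorb1)
  moreover have "C_k k (\<lambda>x. x $ i * \<phi> x)" for k using C_k_tensor f' by metis
  moreover have "closure {x. \<phi> x \<noteq> 0} \<subseteq> U" using assms by (simp add: tensor_tests_def test_functions_def)
  ultimately have "(\<lambda>x. x $ i * \<phi> x) \<in> test_functions U" unfolding test_functions_def by blast
  with f' show ?thesis unfolding tensor_tests_def by blast
qed

section \<open>Derivatives of coordinate multiples\<close>

lemma partial_add:
  assumes "f differentiable (at x)" "g differentiable (at x)"
  shows "partial i (\<lambda>x. f x + g x) x = partial i f x + partial i g x"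
proof -
  have "((\<lambda>x. f x + g x) has_derivative (\<lambda>v. frechet_derivative f (at x) v + frechet_derivative g (at x) v)) (at x)"
    using assms frechet_derivative_works by (intro has_derivative_add) auto
  from partial_eqI[OF this] show ?thesis by (simp add: partial_def)
qed

lemma C_k_add: "C_k k f \<Longrightarrow> C_k k g \<Longrightarrow> C_k k (\<lambda>x. f x + g x)"
proof (induction k arbitrary: f g)
  case 0 then show ?case by (auto intro!: continuous_intros)
next
  case (Suc k)
  then have "partial i (\<lambda>x. f x + g x) = (\<lambda>x. partial i f x + partial i g x)" for i
    by (auto intro!: partial_add)
  with Suc show ?case by (auto intro!: differentiable_add)
qed

lemma partial_mult_component:
  assumes "\<phi> \<in> test_functions U"
  shows "partial j (\<lambda>x. x $ i * \<phi> x) = (\<lambda>x. (if i = j then \<phi> x else 0) + x $ i * partial j \<phi> x)"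
proof
  fix x
  have "((\<lambda>x. x $ i) has_derivative (\<lambda>v. v $ i)) (at x)" for x :: "real^2" and i :: 2
    by (simp add: bounded_linear_imp_has_derivative bounded_linear_vec_nth)
  moreover have "(\<phi> has_derivative frechet_derivative \<phi> (at x)) (at x)"
    using test_functionsD(3)[OF assms] frechet_derivative_works by blast
  ultimately have "((\<lambda>x. x $ i * \<phi> x) has_derivative
      (\<lambda>v. x $ i * frechet_derivative \<phi> (at x) v + v $ i * \<phi> x)) (at x)"
    by (rule has_derivative_mult)
  from partial_eqI[OF this]
  show "partial j (\<lambda>x. x $ i * \<phi> x) x = (if i = j then \<phi> x else 0) + x $ i * partial j \<phi> x"
    by (auto simp: partial_def axis_def)
qed

text \<open>This commutator is what lowers the degree of homogeneity by one when \<open>L\<close> is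
  replaced by \<open>L\<close> after \<open>partial j\<close>: the extra term survives for
  \<open>i = j\<close> only. Exchanging the two derivatives is legitimate by the product
  form.\<close>

lemma partial_partial_mult_component:
  assumes "\<phi> \<in> tensor_tests U"
  shows "partial j (partial i (\<lambda>x. x $ i * \<phi> x)) =
    (\<lambda>x. partial i (\<lambda>x. x $ i * partial j \<phi> x) x + (if i = j then partial i \<phi> x else 0))"
proof -
  have comm: "partial j (partial i \<psi>) = partial i (partial j \<psi>)" if \<psi>: "\<psi> \<in> tensor_tests U" for \<psi>
  proof -
    obtain f g where *: "smooth1 f" "smooth1 g" "\<psi> = tensor f g" using \<psi> by (auto simp: tensor_tests_def)
    then show ?thesis using exhaust_2[of i] exhaust_2[of j] by (auto simp: partial_tensor smooth1_deriv)
  qed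
  have t: "\<phi> \<in> test_functions U" "(\<lambda>x. x $ i * partial j \<phi> x) \<in> test_functions U"
    using assms tensor_tests_partial tensor_tests_mult_component unfolding tensor_tests_def by blast+
  have "partial j (partial i (\<lambda>x. x $ i * \<phi> x)) = partial i (partial j (\<lambda>x. x $ i * \<phi> x))"
    by (rule comm[OF tensor_tests_mult_component[OF assms]])
  also have "\<dots> = partial i (\<lambda>x. (if i = j then \<phi> x else 0) + x $ i * partial j \<phi> x)"
    by (simp add: partial_mult_component[OF t(1)])
  also have "\<dots> = (\<lambda>x. partial i (\<lambda>x. x $ i * partial j \<phi> x) x + (if i = j then partial i \<phi> x else 0))"
    using test_functionsD(3)[OF t(1)] test_functionsD(3)[OF t(2)]
    by (cases "i = j") (auto simp: partial_add fun_eq_iff)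
  finally show ?thesis .
qed

text \<open>The second hypothesis is Euler's identity for a functional homogeneous of degree \<open>\<mu>\<close>; it
  passes to \<open>L \<circ> \<partial>\<^sub>j\<close> with degree \<open>\<mu> - 1\<close>, and for \<open>\<mu> \<noteq> 0\<close> it shows that not all
  \<open>L \<circ> \<partial>\<^sub>j\<close> vanish unless \<open>L\<close> does.\<close>

lemma homogeneous_functional_word_nonzero:
  fixes L :: "(real^2 \<Rightarrow> real) \<Rightarrow> real"
  assumes "\<And>\<phi> \<psi>. \<phi> \<in> test_functions U \<Longrightarrow> \<psi> \<in> test_functions U \<Longrightarrow> L (\<lambda>x. \<phi> x + \<psi> x) = L \<phi> + L \<psi>"
    and "\<And>\<phi>. \<phi> \<in> tensor_tests U \<Longrightarrow> (\<Sum>i\<in>UNIV. L (partial i (\<lambda>x. x $ i * \<phi> x))) = - \<mu> * L \<phi>"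
    and "\<zeta> \<in> tensor_tests U" "L \<zeta> \<noteq> 0"
    and "\<And>k. k < N \<Longrightarrow> \<mu> \<noteq> real k"
  shows "\<exists>a \<eta>. length a = N \<and> \<eta> \<in> tensor_tests U \<and> L (foldr partial a \<eta>) \<noteq> 0"
  using assms
proof (induction N arbitrary: L \<mu> \<zeta>)
  case 0
  then show ?case by (auto intro!: exI[of _ "[]"])
next
  case (Suc N)
  have "\<mu> \<noteq> 0" using Suc.prems(5)[of 0] by simp
  then have "(\<Sum>i\<in>UNIV. L (partial i (\<lambda>x. x $ i * \<zeta> x))) \<noteq> 0"
    using Suc.prems by simp
  then obtain j where j: "L (partial j (\<lambda>x. x $ j * \<zeta> x)) \<noteq> 0" by (meson sum.neutral)
  have T: "\<phi> \<in> tensor_tests U \<Longrightarrow> \<phi> \<in> test_functions U" for \<phi> by (simp add: tensor_tests_def)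
  have "\<exists>a \<eta>. length a = N \<and> \<eta> \<in> tensor_tests U \<and> L (partial j (foldr partial a \<eta>)) \<noteq> 0"
  proof (rule Suc.IH[where L = "\<lambda>\<phi>. L (partial j \<phi>)" and \<mu> = "\<mu> - 1"])
    \<comment> \<open>The coordinate multiple found above witnesses that the new functional is
      nonzero. The degrees to be avoided shift along: \<open>\<mu> - 1 = k\<close> would mean
      \<open>\<mu> = Suc k\<close>.\<close>
    show "(\<lambda>x. x $ j * \<zeta> x) \<in> tensor_tests U" by (rule tensor_tests_mult_component[OF Suc.prems(3)])
    show "\<mu> - 1 \<noteq> real k" if "k < N" for k using Suc.prems(5)[of "Suc k"] that by auto
    show "L (partial j (\<lambda>x. \<phi> x + \<psi> x)) = L (partial j \<phi>) + L (partial j \<psi>)"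
      if "\<phi> \<in> test_functions U" "\<psi> \<in> test_functions U" for \<phi> \<psi>
    proof -
      have "partial j (\<lambda>x. \<phi> x + \<psi> x) = (\<lambda>x. partial j \<phi> x + partial j \<psi> x)"
        using that test_functionsD(3) by (auto intro!: partial_add)
      with that show ?thesis by (simp add: Suc.prems(1) test_functions_partial)
    qed
    show "(\<Sum>i\<in>UNIV. L (partial j (partial i (\<lambda>x. x $ i * \<phi> x)))) = - (\<mu> - 1) * L (partial j \<phi>)"
      if \<phi>: "\<phi> \<in> tensor_tests U" for \<phi>
    proof -
      have "L (partial j (partial i (\<lambda>x. x $ i * \<phi> x)))
          = L (partial i (\<lambda>x. x $ i * partial j \<phi> x)) + (if i = j then L (partial j \<phi>) else 0)" for i
        using \<phi> by (auto simp: partial_partial_mult_component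
            intro!: Suc.prems(1) T tensor_tests_partial tensor_tests_mult_component)
      then have "(\<Sum>i\<in>UNIV. L (partial j (partial i (\<lambda>x. x $ i * \<phi> x))))
          = (\<Sum>i\<in>UNIV. L (partial i (\<lambda>x. x $ i * partial j \<phi> x))) + L (partial j \<phi>)"
        by (simp add: sum.distrib)
      also have "\<dots> = - \<mu> * L (partial j \<phi>) + L (partial j \<phi>)"
        using Suc.prems(2) tensor_tests_partial[OF \<phi>] by simp
      finally show ?thesis by (simp add: algebra_simps)
    qed
  qed (use j in auto)
  then obtain a \<eta> where "length a = N" "\<eta> \<in> tensor_tests U" "L (partial j (foldr partial a \<eta>)) \<noteq> 0" by blast
  \<comment> \<open>\<open>foldr\<close> applies the head of the list last, so \<open>j\<close>
    becomes the outermost derivative.\<close>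
  then show ?case by (intro exI[of _ "j # a"] exI[of _ \<eta>]) auto
qed

section \<open>Integration by parts, scaling and homogeneity\<close>

lemma integrable_ball:
  "integrable lebesgue (\<lambda>x. M * indicator (ball (0::real^2) B) x :: real)"
proof -
  have "emeasure lebesgue (ball (0::real^2) B) < \<infinity>"
    using emeasure_bounded_finite[of "ball (0::real^2) B"] by simp
  then show ?thesis by (intro integrable_mult_right integrable_real_indicator) auto
qed

lemma integrable_bounded_support:
  fixes f :: "real^2 \<Rightarrow> real"
  assumes "f \<in> borel_measurable lebesgue" "\<And>x. \<bar>f x\<bar> \<le> M" "\<And>x. x \<notin> K \<Longrightarrow> f x = 0" "bounded K"
  shows "integrable lebesgue f"
proof -
  obtain B where B: "K \<subseteq> ball 0 B" using assms(4) bounded_subset_ballD by blast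
  have "\<bar>f x\<bar> \<le> \<bar>M * indicator (ball 0 B) x\<bar>" for x
    using assms(2)[of x] assms(3)[of x] B by (cases "x \<in> ball 0 B") (auto simp: subset_iff)
  then have "AE x in lebesgue. norm (f x) \<le> norm (M * indicator (ball (0::real^2) B) x :: real)"
    by (simp only: real_norm_def AE_I2)
  from Bochner_Integration.integrable_bound[OF integrable_ball assms(1) this]
  show ?thesis .
qed

lemma continuous_measurable_lebesgue:
  "continuous_on UNIV f \<Longrightarrow> f \<in> borel_measurable lebesgue" for f :: "real^2 \<Rightarrow> real"
  by (intro measurable_completion) (simp add: borel_measurable_continuous_onI)

text \<open>The factor is the Jacobian in dimension two. Borel measurability allows the passage from
  \<open>lebesgue\<close> to \<open>lborel\<close>, where the affine transformation rule lives, and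
  back.\<close>

lemma integral_affine:
  fixes f :: "real^2 \<Rightarrow> real"
  assumes [measurable]: "f \<in> borel_measurable borel" and "c \<noteq> 0"
  shows "integral\<^sup>L lebesgue f = c\<^sup>2 * (LINT x|lebesgue. f (t + c *\<^sub>R x))"
proof -
  have "integral\<^sup>L lebesgue f = integral\<^sup>L lborel f"
    by (rule integral_completion) simp
  also have "\<dots> = integral\<^sup>L (density (distr lborel borel (\<lambda>x. t + c *\<^sub>R x)) (\<lambda>_. c\<^sup>2)) f"
    using lborel_affine[OF assms(2), of t] by simp
  also have "\<dots> = c\<^sup>2 * (LINT x|lborel. f (t + c *\<^sub>R x))"
    by (subst integral_density) (auto simp: integral_distr)
  also have "(LINT x|lborel. f (t + c *\<^sub>R x)) = (LINT x|lebesgue. f (t + c *\<^sub>R x))"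
    by (rule integral_completion[symmetric]) simp
  finally show ?thesis .
qed

text \<open>Dominated convergence runs along sequences, so derivatives are read off along the steps
  \<open>1 / Suc n\<close>.\<close>

lemma DERIV_tendsto_sequence:
  assumes "(g has_real_derivative D) (at 0)"
  shows "(\<lambda>n. (g (1 / real (Suc n)) - g 0) * real (Suc n)) \<longlonglongrightarrow> D"
proof -
  have "((\<lambda>t. (g (0 + t) - g 0) / t) \<longlongrightarrow> D) (at 0)" using assms by (simp add: DERIV_def)
  moreover have "filterlim (\<lambda>n. 1 / real (Suc n)) (at 0) sequentially"
    unfolding filterlim_at using LIMSEQ_inverse_real_of_nat by (simp add: inverse_eq_divide del: of_nat_Suc)
  ultimately have "(\<lambda>n. (g (0 + 1 / real (Suc n)) - g 0) / (1 / real (Suc n))) \<longlonglongrightarrow> D"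
    by (rule filterlim_compose)
  then show ?thesis by simp
qed

text \<open>By translation invariance the difference quotients of \<open>F\<close> have integral \<open>0\<close>.\<close>

lemma integral_directional_derivative_eq_0:
  fixes F d :: "real^2 \<Rightarrow> real"
  assumes lip: "\<And>x t. \<bar>F (x + t *\<^sub>R axis j 1) - F x\<bar> \<le> M * \<bar>t\<bar>"
    and meas: "continuous_on UNIV F" "d \<in> borel_measurable lebesgue"
    and supp: "\<And>x. x \<notin> K \<Longrightarrow> F x = 0" "bounded K"
    and deriv: "AE x in lebesgue. ((\<lambda>t. F (x + t *\<^sub>R axis j 1)) has_real_derivative d x) (at 0)"
  shows "integrable lebesgue d" "integral\<^sup>L lebesgue d = 0"
proof -
  obtain B where B: "K \<subseteq> ball 0 B" using supp(2) bounded_subset_ballD by blast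
  define e :: "real^2" where "e = axis j 1"
  define s where "s n x = (F (x + (1 / real (Suc n)) *\<^sub>R e) - F x) * real (Suc n)" for n x
  have cont: "continuous_on UNIV (\<lambda>x. F (x + a))" for a
    by (intro continuous_on_compose2[OF meas(1), of UNIV "\<lambda>x. x + a"]) (auto intro!: continuous_intros)
  obtain M' where M': "\<And>x. \<bar>F x\<bar> \<le> M'"
    using continuous_compact_support_bounded[OF meas(1) supp] by blast
  have int: "integrable lebesgue (\<lambda>x. F (x + a))" for a
  proof (rule integrable_bounded_support)
    show "F (x + a) = 0" if "x \<notin> (\<lambda>x. x - a) ` K" for x
      using supp(1)[of "x + a"] that by force
    show "bounded ((\<lambda>x. x - a) ` K)" using supp(2) by (simp add: bounded_translation_minus)
  qed (use M' continuous_measurable_lebesgue[OF cont] in auto)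
  have F_borel: "F \<in> borel_measurable borel" using meas(1) by (rule borel_measurable_continuous_onI)
  have shift: "(LINT x|lebesgue. F (x + a)) = integral\<^sup>L lebesgue F" for a
    using integral_affine[OF F_borel, of 1 a] by (simp add: add.commute)
  have zero: "integral\<^sup>L lebesgue (s n) = 0" for n
    using int[of "(1 / real (Suc n)) *\<^sub>R e"] int[of 0] shift[of "(1 / real (Suc n)) *\<^sub>R e"]
    by (simp add: s_def[abs_def] del: of_nat_Suc)
  have s_meas: "s n \<in> borel_measurable lebesgue" for n
    unfolding s_def using cont meas(1)
    by (intro continuous_measurable_lebesgue continuous_intros)
  \<comment> \<open>The steps are at most \<open>1\<close> and \<open>e\<close> is a unit vector, so
    every difference quotient lives on the ball enlarged by \<open>1\<close>, where the Lipschitz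
    constant \<open>M\<close> dominates it.\<close>
  have w_int: "integrable lebesgue (\<lambda>x. M * indicator (ball (0::real^2) (B + 1)) x)"
    by (rule integrable_ball)
  have bound: "norm (s n x) \<le> M * indicator (ball (0::real^2) (B + 1)) x" for n x
  proof (cases "x \<in> ball 0 (B + 1)")
    case True
    have "\<bar>F (x + (1 / real (Suc n)) *\<^sub>R e) - F x\<bar> \<le> M * (1 / real (Suc n))"
      using lip[of x "1 / real (Suc n)"] by (simp add: e_def)
    then have "\<bar>F (x + (1 / real (Suc n)) *\<^sub>R e) - F x\<bar> * real (Suc n) \<le> M"
      by (simp add: field_simps del: of_nat_Suc)
    with True show ?thesis by (simp add: s_def abs_mult del: of_nat_Suc)
  next
    case False
    define z where "z = (1 / real (Suc n)) *\<^sub>R e"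
    have "norm z \<le> 1" by (simp add: e_def z_def)
    moreover have "norm x \<le> norm (x + z) + norm z"
      using norm_triangle_ineq4[of "x + z" z] by simp
    ultimately have "norm (x + (1 / real (Suc n)) *\<^sub>R e) \<ge> B"
      using False unfolding z_def[symmetric] by simp
    then have "x + (1 / real (Suc n)) *\<^sub>R e \<notin> K" "x \<notin> K" using B False by (auto simp: subset_iff)
    with False supp(1) show ?thesis by (simp add: s_def)
  qed
  have lim: "AE x in lebesgue. (\<lambda>n. s n x) \<longlonglongrightarrow> d x"
    using deriv
  proof (rule AE_mp, intro AE_I2 impI)
    fix x assume "((\<lambda>t. F (x + t *\<^sub>R axis j 1)) has_real_derivative d x) (at 0)"
    from DERIV_tendsto_sequence[OF this] show "(\<lambda>n. s n x) \<longlonglongrightarrow> d x"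
      by (simp add: s_def e_def del: of_nat_Suc)
  qed
  show "integrable lebesgue d"
    by (rule integrable_dominated_convergence[OF meas(2) s_meas w_int lim]) (intro AE_I2 bound)
  have "(\<lambda>n. integral\<^sup>L lebesgue (s n)) \<longlonglongrightarrow> integral\<^sup>L lebesgue d"
    by (rule integral_dominated_convergence[OF meas(2) s_meas w_int lim]) (intro AE_I2 bound)
  then show "integral\<^sup>L lebesgue d = 0" by (simp add: zero LIMSEQ_const_iff)
qed

lemma integrable_mult_test:
  assumes "\<phi> \<in> test_functions U" "continuous_on UNIV f"
  shows "integrable lebesgue (\<lambda>x. f x * \<phi> x)"
proof -
  have c: "continuous_on UNIV (\<lambda>x. f x * \<phi> x)"
    using assms test_functionsD(2) by (intro continuous_intros) auto
  have s: "f x * \<phi> x = 0" if "x \<notin> {x. \<phi> x \<noteq> 0}" for x using that by simp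
  obtain M where "\<And>x. \<bar>f x * \<phi> x\<bar> \<le> M"
    using continuous_compact_support_bounded[OF c s test_functions_support_bounded[OF assms(1)]] by blast
  then show ?thesis
    using integrable_bounded_support[OF continuous_measurable_lebesgue[OF c] _ s test_functions_support_bounded[OF assms(1)]]
    by blast
qed

text \<open>\<open>f\<close> need not decay: the product with \<open>\<phi>\<close> is Lipschitz
  with bounded support, so its derivative integrates to \<open>0\<close>, and the product rule
  splits that integral.\<close>

lemma integral_by_parts_test:
  assumes "\<phi> \<in> test_functions U" "C_k 1 f"
  shows "(LINT x|lebesgue. f x * partial j \<phi> x) = - (LINT x|lebesgue. partial j f x * \<phi> x)"
proof -
  let ?F = "\<lambda>x. f x * \<phi> x"
  have C: "C_k 1 ?F" and p: "partial j ?F = (\<lambda>x. f x * partial j \<phi> x + partial j f x * \<phi> x)"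
    using C_1_mult[OF assms(2) test_functionsD(1)[OF assms(1)]] by auto
  have s: "f x * \<phi> x = 0" if "x \<notin> {x. \<phi> x \<noteq> 0}" for x using that by simp
  obtain M where M: "\<And>x y. \<bar>?F x - ?F y\<bar> \<le> M * norm (x - y)"
    by (rule C_1_lipschitz[OF C s test_functions_support_bounded[OF assms(1)]]) (assumption | rule that)+
  have "integral\<^sup>L lebesgue (partial j ?F) = 0"
  proof (rule integral_directional_derivative_eq_0(2)[OF _ _ _ s test_functions_support_bounded[OF assms(1)]])
    show "\<bar>?F (x + t *\<^sub>R axis j 1) - ?F x\<bar> \<le> M * \<bar>t\<bar>" for x t
      using M[of "x + t *\<^sub>R axis j 1" x] by simp
    show "continuous_on UNIV ?F" using C C_k_continuous by blast
    show "partial j ?F \<in> borel_measurable lebesgue"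
      using C by (intro continuous_measurable_lebesgue) simp
    have "((\<lambda>t. ?F (x + t *\<^sub>R axis j 1)) has_real_derivative partial j ?F x) (at 0)" for x
      using has_field_derivative_partial[of ?F x 0 j UNIV] C by simp
    then show "AE x in lebesgue. ((\<lambda>t. ?F (x + t *\<^sub>R axis j 1)) has_real_derivative partial j ?F x) (at 0)"
      by simp
  qed
  moreover have "integrable lebesgue (\<lambda>x. f x * partial j \<phi> x)"
    using integrable_mult_test[OF test_functions_partial[OF assms(1)]] C_k_continuous[OF assms(2)] by blast
  moreover have "integrable lebesgue (\<lambda>x. partial j f x * \<phi> x)"
    using integrable_mult_test[OF assms(1)] assms(2) by auto
  ultimately show ?thesis unfolding p by simp
qed

text \<open>Polynomials of total degree below \<open>n\<close>, described by the vanishing of all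
  \<open>n\<close>-fold derivatives, since this is what repeated integration by parts
  consumes.\<close>

primrec degree_below :: "nat \<Rightarrow> (real^2 \<Rightarrow> real) \<Rightarrow> bool" where
  "degree_below 0 f \<longleftrightarrow> f = (\<lambda>_. 0)"
| "degree_below (Suc n) f \<longleftrightarrow> C_k 1 f \<and> (\<forall>i. degree_below n (partial i f))"

lemma degree_below_add: "degree_below n f \<Longrightarrow> degree_below n g \<Longrightarrow> degree_below n (\<lambda>x. f x + g x)"
proof (induction n arbitrary: f g)
  case (Suc n)
  have "partial i (\<lambda>x. f x + g x) = (\<lambda>x. partial i f x + partial i g x)" for i
    using Suc.prems by (intro ext partial_add) auto
  with Suc C_k_add[of 1 f g] show ?case by (auto simp del: C_k.simps)
qed simp

lemma smooth1_power: "smooth1 (\<lambda>t. t ^ j)"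
proof (induction j)
  case 0
  then show ?case by (simp add: smooth1_def diff_times_const)
next
  case (Suc j)
  then show ?case using smooth1_mult[OF smooth1_ident] by simp
qed

lemma degree_below_zero: "degree_below n (\<lambda>x. 0)"
proof (induction n)
  case (Suc n)
  have "partial i (\<lambda>x. 0) = (\<lambda>x. 0)" for i
    using partial_eqI[of "\<lambda>x. 0" "\<lambda>v. 0"] by auto
  with Suc show ?case by simp
qed simp

text \<open>The coefficient \<open>a\<close> is kept general because differentiating a power
  produces a numerical factor, which the induction has to absorb.\<close>

lemma degree_below_monomial: "j + k < n \<Longrightarrow> degree_below n (\<lambda>x. a * (x $ 1) ^ j * (x $ 2) ^ k)"
proof (induction n arbitrary: j k a)
  case (Suc n)
  let ?f = "\<lambda>t::real. t ^ j" and ?g = "\<lambda>t::real. t ^ k"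
  have d: "deriv (\<lambda>t::real. t ^ j) = (\<lambda>t. real j * t ^ (j - 1))" for j
    by (auto intro!: DERIV_imp_deriv derivative_eq_intros)
  have t: "(\<lambda>x. a * (x $ 1) ^ j * (x $ 2) ^ k) = (\<lambda>x. a * tensor ?f ?g x)" by (simp add: tensor_def mult.assoc)
  have diff: "tensor ?f ?g differentiable (at x)" for x
    using C_k_tensor[OF smooth1_power smooth1_power, of "Suc 0"] by simp
  have cm: "partial i (\<lambda>x. a * tensor ?f ?g x) = (\<lambda>x. a * partial i (tensor ?f ?g) x)" for i
  proof
    fix x
    have "((\<lambda>x. a * tensor ?f ?g x) has_derivative (\<lambda>v. a * frechet_derivative (tensor ?f ?g) (at x) v)) (at x)"
      using diff frechet_derivative_works by (intro has_derivative_mult_right) auto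
    from partial_eqI[OF this] show "partial i (\<lambda>x. a * tensor ?f ?g x) x = a * partial i (tensor ?f ?g) x"
      by (simp add: partial_def)
  qed
  have "degree_below n (\<lambda>x. a * partial 1 (tensor ?f ?g) x)"
  proof (cases j)
    case 0
    then show ?thesis
      by (simp only: partial_tensor smooth1_power d tensor_def) (simp add: degree_below_zero)
  next
    case (Suc j')
    have "(\<lambda>x. a * partial 1 (tensor ?f ?g) x) = (\<lambda>x. (a * real j) * (x $ 1) ^ j' * (x $ 2) ^ k)"
      using Suc by (simp only: partial_tensor smooth1_power d tensor_def) (simp add: mult_ac)
    with Suc Suc.IH[of j' k "a * real j"] Suc.prems show ?thesis by simp
  qed
  moreover have "degree_below n (\<lambda>x. a * partial 2 (tensor ?f ?g) x)"
  proof (cases k)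
    case 0
    then show ?thesis
      by (simp only: partial_tensor smooth1_power d tensor_def) (simp add: degree_below_zero)
  next
    case (Suc k')
    have "(\<lambda>x. a * partial 2 (tensor ?f ?g) x) = (\<lambda>x. (a * real k) * (x $ 1) ^ j * (x $ 2) ^ k')"
      using Suc by (simp only: partial_tensor smooth1_power d tensor_def) (simp add: mult_ac)
    with Suc Suc.IH[of j k' "a * real k"] Suc.prems show ?thesis by simp
  qed
  moreover have "C_k 1 (\<lambda>x. a * tensor ?f ?g x)"
    by (intro C_k_cmult C_k_tensor smooth1_power)
  ultimately show ?case unfolding t degree_below.simps forall_2 cm by blast
qed simp

text \<open>The top monomial has degree \<open>p\<close> in each of the two coordinates, hence total
  degree \<open>2 * p\<close>.\<close>

lemma degree_below_Q_poly:
  assumes "q \<in> Q_poly p" "2 * p < n"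
  shows "degree_below n q"
proof -
  have sum: "degree_below n (\<lambda>x. \<Sum>j\<in>A. f j x)" if "finite A" "\<And>j. j \<in> A \<Longrightarrow> degree_below n (f j)"
    for A :: "nat set" and f
    using that by (induction A rule: finite_induct) (auto intro: degree_below_zero degree_below_add)
  obtain a where q: "q = (\<lambda>x. \<Sum>j\<le>p. \<Sum>k\<le>p. a j k * (x $ 1) ^ j * (x $ 2) ^ k)"
    using assms(1) by (auto simp: Q_poly_def fun_eq_iff)
  show ?thesis unfolding q
    using assms(2) by (intro sum degree_below_monomial) auto
qed

lemma foldr_partial_test: "\<eta> \<in> test_functions U \<Longrightarrow> foldr partial a \<eta> \<in> test_functions U"
  by (induction a) (simp_all add: test_functions_partial)

text \<open>The chain rule read backwards: every derivative taken out of a rescaled function earns a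
  factor \<open>h\<close>. All powers of \<open>h\<close> below are counted with it, as
  \<open>rescale\<close> itself carries no normalisation.\<close>

lemma rescale_partial:
  assumes "\<psi> \<in> test_functions U" "h > 0"
  shows "rescale x\<^sub>0 h (partial j \<psi>) = (\<lambda>x. h * partial j (rescale x\<^sub>0 h \<psi>) x)"
  using partial_rescale[of \<psi> j x\<^sub>0 h] test_functionsD(3)[OF assms(1)] assms(2) by (simp add: fun_eq_iff)

text \<open>Each integration by parts removes one letter of the word and lowers the degree bound of
  \<open>q\<close> by one; when the word is used up, \<open>q\<close> is \<open>0\<close>.\<close>

lemma integral_degree_below_word_eq_0:
  assumes "degree_below (length a) q" "\<eta> \<in> test_functions U" "h > 0"
  shows "(LINT x|lebesgue. q x * rescale x\<^sub>0 h (foldr partial a \<eta>) x) = 0"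
  using assms(1)
proof (induction a arbitrary: q)
  case (Cons j a)
  let ?\<psi> = "foldr partial a \<eta>"
  have \<psi>: "?\<psi> \<in> test_functions U" using assms(2) by (rule foldr_partial_test)
  have r: "rescale x\<^sub>0 h ?\<psi> \<in> test_functions UNIV"
    using test_functions_rescale[OF \<psi> assms(3)] by blast
  have "(LINT x|lebesgue. q x * rescale x\<^sub>0 h (partial j ?\<psi>) x)
      = (LINT x|lebesgue. h * (q x * partial j (rescale x\<^sub>0 h ?\<psi>) x))"
    by (simp add: rescale_partial[OF \<psi> assms(3)] mult_ac)
  also have "\<dots> = - h * (LINT x|lebesgue. partial j q x * rescale x\<^sub>0 h ?\<psi> x)"
    using integral_by_parts_test[OF r, of q j] Cons.prems by simp
  also have "\<dots> = 0" using Cons by simp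
  finally show ?case by simp
qed simp

lemma integral_rescale:
  assumes "f \<in> borel_measurable borel" "h > 0" "continuous_on UNIV \<phi>"
  shows "(LINT x|lebesgue. f (x - x\<^sub>0) * rescale x\<^sub>0 h \<phi> x) = h\<^sup>2 * (LINT y|lebesgue. f (h *\<^sub>R y) * \<phi> y)"
proof -
  have [measurable]: "\<phi> \<in> borel_measurable borel" using assms(3) by (rule borel_measurable_continuous_onI)
  note assms(1)[measurable]
  have "(LINT x|lebesgue. f (x - x\<^sub>0) * rescale x\<^sub>0 h \<phi> x)
     = h\<^sup>2 * (LINT x|lebesgue. f (x\<^sub>0 + h *\<^sub>R x - x\<^sub>0) * rescale x\<^sub>0 h \<phi> (x\<^sub>0 + h *\<^sub>R x))"
    using assms(2) by (intro integral_affine) (auto simp: rescale_def)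
  then show ?thesis using assms(2) by (simp add: rescale_def)
qed

lemma integrable_growth:
  fixes s :: "real^2 \<Rightarrow> real"
  assumes s[measurable]: "s \<in> borel_measurable borel" and "\<And>x. \<bar>s x\<bar> \<le> C * norm x powr lam" "C \<ge> 0" "lam > 0"
    and \<phi>: "continuous_on UNIV \<phi>" "bounded {x. \<phi> x \<noteq> 0}"
  shows "integrable lebesgue (\<lambda>x. s (x - x\<^sub>0) * \<phi> x)"
proof -
  obtain B where B: "{x. \<phi> x \<noteq> 0} \<subseteq> ball x\<^sub>0 B"
    using bounded_subset_ballD[OF \<phi>(2)] by blast
  obtain M where M: "\<And>x. \<bar>\<phi> x\<bar> \<le> M"
    using continuous_compact_support_bounded[OF \<phi>(1), of "{x. \<phi> x \<noteq> 0}"] \<phi>(2) by blast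
  have [measurable]: "\<phi> \<in> borel_measurable borel"
    using \<phi>(1) by (rule borel_measurable_continuous_onI)
  show ?thesis
  proof (rule integrable_bounded_support)
    show "(\<lambda>x. s (x - x\<^sub>0) * \<phi> x) \<in> borel_measurable lebesgue"
      by (intro measurable_completion) simp
    show "\<bar>s (x - x\<^sub>0) * \<phi> x\<bar> \<le> (C * B powr lam) * M" for x
    proof (cases "\<phi> x = 0")
      case True
      then show ?thesis using M[of x] assms(3) by simp
    next
      case False
      then have "norm (x - x\<^sub>0) \<le> B" using B by (auto simp: dist_norm norm_minus_commute subset_iff less_imp_le)
      then have "norm (x - x\<^sub>0) powr lam \<le> B powr lam" using assms(4) by (intro powr_mono2) auto
      then have "\<bar>s (x - x\<^sub>0)\<bar> \<le> C * B powr lam"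
        using assms(2)[of "x - x\<^sub>0"] assms(3) by (meson mult_left_mono order_trans)
      then show ?thesis unfolding abs_mult using assms(3) by (intro mult_mono M) auto
    qed
    show "s (x - x\<^sub>0) * \<phi> x = 0" if "x \<notin> {x. \<phi> x \<noteq> 0}" for x using that by simp
    show "bounded {x. \<phi> x \<noteq> 0}" by (rule \<phi>(2))
  qed
qed

text \<open>Differentiate \<open>\<integral> s(x) \<phi>(t x) dx = t powr -(2 + lam) * \<integral> s \<phi>\<close> at \<open>t = 1\<close>.\<close>

lemma homogeneous_euler:
  fixes s :: "real^2 \<Rightarrow> real"
  assumes [measurable]: "s \<in> borel_measurable borel"
    and hom: "\<And>t x. t > 0 \<Longrightarrow> s (t *\<^sub>R x) = t powr lam * s x"
    and bnd: "\<And>x. \<bar>s x\<bar> \<le> C * norm x powr lam" and "lam > 0" "C \<ge> 0"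
    and \<phi>: "\<phi> \<in> test_functions U"
  shows "(\<Sum>i\<in>UNIV. (LINT x|lebesgue. s x * partial i (\<lambda>x. x $ i * \<phi> x) x)) = - lam * (LINT x|lebesgue. s x * \<phi> x)"
proof -
  have "bounded (closure {x. \<phi> x \<noteq> 0})"
    using \<phi> by (simp add: test_functions_def compact_imp_bounded)
  then obtain B where "B > 0" and B0: "closure {x. \<phi> x \<noteq> 0} \<subseteq> ball 0 B"
    using bounded_subset_ballD by blast
  have B: "\<phi> x = 0" "partial i \<phi> x = 0" if "norm x \<ge> B" for x i
  proof -
    have "x \<notin> closure {x. \<phi> x \<noteq> 0}" using B0 that by auto
    then show "\<phi> x = 0" "partial i \<phi> x = 0"
      using closure_subset[of "{x. \<phi> x \<noteq> 0}"] test_functionsD(7)[OF \<phi>] by auto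
  qed
  have \<phi>c: "continuous_on UNIV \<phi>" and \<phi>m[measurable]: "\<phi> \<in> borel_measurable borel"
    using test_functionsD(2)[OF \<phi>] by (auto intro: borel_measurable_continuous_onI)
  obtain M where M: "M > 0" "\<And>x y. \<bar>\<phi> x - \<phi> y\<bar> \<le> M * norm (x - y)"
    using C_1_lipschitz[OF test_functionsD(1)[OF \<phi>] _ test_functions_support_bounded[OF \<phi>]] by blast
  have int: "integrable lebesgue (\<lambda>x. s x * g x)"
    if g: "continuous_on UNIV g" "\<And>x. norm x \<ge> B \<Longrightarrow> g x = 0" for g
  proof -
    have "{x. g x \<noteq> 0} \<subseteq> ball 0 B" using g(2) by force
    then have "bounded {x. g x \<noteq> 0}" using bounded_subset bounded_ball by blast
    then show ?thesis using integrable_growth[OF assms(1) bnd \<open>C \<ge> 0\<close> \<open>lam > 0\<close> g(1), of 0] by simp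
  qed
  define E where "E x = (\<Sum>i\<in>UNIV. x $ i * partial i \<phi> x)" for x
  define t where "t n = 1 + 1 / real (Suc n)" for n
  \<comment> \<open>Dilating from above matters: \<open>t n > 1\<close> pushes points outwards, so
    \<open>\<phi> (t n *\<^sub>R x)\<close> vanishes wherever \<open>norm x \<ge> B\<close>, and one
    ball dominates all quotients.\<close>
  have t: "t n > 1" for n by (simp add: t_def)
  define r where "r n x = (s x * \<phi> (t n *\<^sub>R x) - s x * \<phi> x) * real (Suc n)" for n x
  have d: "((\<lambda>\<tau>. \<phi> ((1 + \<tau>) *\<^sub>R x)) has_real_derivative E x) (at 0)" for x
  proof -
    have "((\<lambda>\<tau>. (1 + \<tau>) *\<^sub>R x) has_derivative (\<lambda>\<tau>. \<tau> *\<^sub>R x)) (at 0)"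
      by (auto intro!: derivative_eq_intros)
    from has_derivative_compose[OF this has_derivative_partials[OF test_functionsD(3)[OF \<phi>]]]
    have "((\<lambda>\<tau>. \<phi> ((1 + \<tau>) *\<^sub>R x)) has_derivative (\<lambda>\<tau>. \<Sum>i\<in>UNIV. (\<tau> *\<^sub>R x) $ i * partial i \<phi> x)) (at 0)"
      by simp
    moreover have "(\<lambda>\<tau>. \<Sum>i\<in>UNIV. (\<tau> *\<^sub>R x) $ i * partial i \<phi> x) = (*) (E x)"
      by (simp add: fun_eq_iff E_def sum_distrib_left mult_ac)
    ultimately show ?thesis by (simp only: has_field_derivative_def)
  qed
  have lim: "(\<lambda>n. r n x) \<longlonglongrightarrow> s x * E x" for x
    using tendsto_mult_left[OF DERIV_tendsto_sequence[OF d[of x]], of "s x"]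
    by (simp add: r_def t_def algebra_simps del: of_nat_Suc)
  have bound: "norm (r n x) \<le> C * B powr lam * (M * B) * indicator (ball (0::real^2) B) x" for n x
  proof (cases "norm x < B")
    case True
    then have "norm x powr lam \<le> B powr lam" using \<open>lam > 0\<close> by (intro powr_mono2) auto
    then have sB: "\<bar>s x\<bar> \<le> C * B powr lam" using bnd[of x] \<open>C \<ge> 0\<close> by (meson mult_left_mono order_trans)
    have "t n *\<^sub>R x - x = (1 / real (Suc n)) *\<^sub>R x" by (simp add: t_def algebra_simps)
    then have "\<bar>\<phi> (t n *\<^sub>R x) - \<phi> x\<bar> \<le> M * (1 / real (Suc n) * norm x)"
      using M(2)[of "t n *\<^sub>R x" x] by simp
    then have "\<bar>\<phi> (t n *\<^sub>R x) - \<phi> x\<bar> * real (Suc n) \<le> M * norm x"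
      by (simp add: field_simps del: of_nat_Suc)
    also have "\<dots> \<le> M * B" using True M(1) by simp
    finally have "\<bar>s x\<bar> * (\<bar>\<phi> (t n *\<^sub>R x) - \<phi> x\<bar> * real (Suc n)) \<le> C * B powr lam * (M * B)"
      by (rule mult_mono[OF sB]) (simp_all add: \<open>C \<ge> 0\<close>)
    moreover have "norm (r n x) = \<bar>s x\<bar> * (\<bar>\<phi> (t n *\<^sub>R x) - \<phi> x\<bar> * real (Suc n))"
      by (simp add: r_def abs_mult right_diff_distrib[symmetric] del: of_nat_Suc)
    ultimately show ?thesis using True by simp
  next
    case False
    have "norm (t n *\<^sub>R x) \<ge> norm x" using t[of n] by (simp add: mult_le_cancel_right1)
    with False B show ?thesis by (simp add: r_def)
  qed
  have Ec: "continuous_on UNIV E" unfolding E_def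
    using test_functionsD(4)[OF \<phi>] by (intro continuous_intros) auto
  have Em[measurable]: "E \<in> borel_measurable borel" using Ec by (rule borel_measurable_continuous_onI)
  have "(\<lambda>n. integral\<^sup>L lebesgue (r n)) \<longlonglongrightarrow> (LINT x|lebesgue. s x * E x)"
  proof (rule integral_dominated_convergence)
    show "integrable lebesgue (\<lambda>x. C * B powr lam * (M * B) * indicator (ball (0::real^2) B) x)"
      by (rule integrable_ball)
    show "r n \<in> borel_measurable lebesgue" for n
      unfolding r_def by (intro measurable_completion) simp
    show "(\<lambda>x. s x * E x) \<in> borel_measurable lebesgue"
      by (intro measurable_completion) simp
  qed (use lim bound in auto)
  moreover have "integral\<^sup>L lebesgue (r n) = (((1 + 1 / real (Suc n)) powr - (2 + lam)) - 1) * real (Suc n) * (LINT x|lebesgue. s x * \<phi> x)" for n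
  proof -
    \<comment> \<open>Substituting \<open>t n *\<^sub>R x\<close> takes out
      \<open>t n powr (2 + lam)\<close>: two powers from the Jacobian, \<open>lam\<close> from the
      homogeneity of \<open>s\<close>.\<close>
    have "(LINT x|lebesgue. s x * \<phi> x) = (t n)\<^sup>2 * (LINT x|lebesgue. s (0 + t n *\<^sub>R x) * \<phi> (0 + t n *\<^sub>R x))"
      using t[of n] by (intro integral_affine) auto
    also have "\<dots> = (t n)\<^sup>2 * (t n powr lam * (LINT x|lebesgue. s x * \<phi> (t n *\<^sub>R x)))"
      using t[of n] by (simp add: hom mult.assoc)
    also have "\<dots> = t n powr (2 + lam) * (LINT x|lebesgue. s x * \<phi> (t n *\<^sub>R x))"
      using t[of n] by (simp add: powr_add powr_numeral)
    finally have "(LINT x|lebesgue. s x * \<phi> (t n *\<^sub>R x)) = t n powr (-(2 + lam)) * (LINT x|lebesgue. s x * \<phi> x)"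
      using t[of n] by (simp only: powr_minus) (simp add: field_simps)
    moreover have "integrable lebesgue (\<lambda>x. s x * \<phi> (t n *\<^sub>R x))"
    proof (rule int)
      show "continuous_on UNIV (\<lambda>x. \<phi> (t n *\<^sub>R x))"
        by (intro continuous_on_compose2[OF \<phi>c, of UNIV "\<lambda>x. t n *\<^sub>R x"]) (auto intro!: continuous_intros)
      show "\<phi> (t n *\<^sub>R x) = 0" if "norm x \<ge> B" for x
      proof -
        have "norm (t n *\<^sub>R x) \<ge> norm x" using t[of n] by (simp add: mult_le_cancel_right1)
        with that B show ?thesis by simp
      qed
    qed
    moreover have "integrable lebesgue (\<lambda>x. s x * \<phi> x)" by (rule int[OF \<phi>c]) (use B in auto)
    ultimately have "integral\<^sup>L lebesgue (r n) =
        (t n powr (-(2 + lam)) * (LINT x|lebesgue. s x * \<phi> x) - (LINT x|lebesgue. s x * \<phi> x)) * real (Suc n)"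
      unfolding r_def by (simp del: of_nat_Suc)
    also have "\<dots> = (t n powr (-(2 + lam)) - 1) * real (Suc n) * (LINT x|lebesgue. s x * \<phi> x)"
      by (simp only: left_diff_distrib) (simp only: mult_ac mult_1)
    finally show ?thesis by (simp only: t_def)
  qed
  moreover have "(\<lambda>n. (((1 + 1 / real (Suc n)) powr - (2 + lam)) - 1) * real (Suc n) * (LINT x|lebesgue. s x * \<phi> x))
     \<longlonglongrightarrow> (- (2 + lam)) * (LINT x|lebesgue. s x * \<phi> x)"
  proof (rule tendsto_mult_right)
    have "((\<lambda>\<tau>. (1 + \<tau>) powr - (2 + lam)) has_real_derivative - (2 + lam)) (at 0)"
      by (auto intro!: derivative_eq_intros)
    from DERIV_tendsto_sequence[OF this]
    show "(\<lambda>n. ((1 + 1 / real (Suc n)) powr - (2 + lam) - 1) * real (Suc n)) \<longlonglongrightarrow> - (2 + lam)" by simp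
  qed
  ultimately have E: "(LINT x|lebesgue. s x * E x) = - (2 + lam) * (LINT x|lebesgue. s x * \<phi> x)"
    using LIMSEQ_unique by force
  have ip: "integrable lebesgue (\<lambda>x. s x * (x $ i * partial i \<phi> x))" for i
    by (rule int) (use test_functionsD(4)[OF \<phi>] B in \<open>auto intro!: continuous_intros\<close>)
  have is0: "integrable lebesgue (\<lambda>x. s x * \<phi> x)" by (rule int[OF \<phi>c]) (use B in auto)
  \<comment> \<open>Summed over the two coordinates, the product rule yields
    \<open>2 * \<phi> + E\<close>; the dimension cancels the \<open>2\<close> in
    \<open>- (2 + lam)\<close> and leaves \<open>- lam\<close>.\<close>
  have "(LINT x|lebesgue. s x * partial i (\<lambda>x. x $ i * \<phi> x) x)
      = (LINT x|lebesgue. s x * \<phi> x) + (LINT x|lebesgue. s x * (x $ i * partial i \<phi> x))" for i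
    using ip[of i] is0 by (simp add: partial_mult_component[OF \<phi>] ring_distribs)
  then have "(\<Sum>i\<in>UNIV. (LINT x|lebesgue. s x * partial i (\<lambda>x. x $ i * \<phi> x) x))
      = 2 * (LINT x|lebesgue. s x * \<phi> x) + (\<Sum>i\<in>UNIV. LINT x|lebesgue. s x * (x $ i * partial i \<phi> x))"
    by (simp add: sum.distrib)
  also have "(\<Sum>i\<in>UNIV. LINT x|lebesgue. s x * (x $ i * partial i \<phi> x)) = (LINT x|lebesgue. s x * E x)"
    unfolding E_def sum_distrib_left using ip by (intro Bochner_Integration.integral_sum[symmetric]) auto
  finally show ?thesis using E by (simp add: algebra_simps)
qed

section \<open>Weak derivatives of finite element functions\<close>

lemma L2_bounded:
  assumes "V \<in> lmeasurable" "f \<in> borel_measurable (lebesgue_on V)" "\<And>x. x \<in> V \<Longrightarrow> \<bar>f x\<bar> \<le> M"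
  shows "f \<in> L2 V"
proof -
  interpret finite_measure "lebesgue_on V" using assms(1) by (rule finite_measure_lebesgue_on)
  have "(f x)\<^sup>2 \<le> M\<^sup>2" if "x \<in> V" for x using assms(3)[OF that] by (metis abs_ge_zero power2_abs power_mono)
  then have "integrable (lebesgue_on V) (\<lambda>x. (f x)\<^sup>2)"
    using assms(2) by (intro integrable_const_bound[of _ "M\<^sup>2"]) auto
  with assms(2) show ?thesis by (simp add: L2_def)
qed

lemma L2_mult_integrable:
  assumes "f \<in> L2 V" "g \<in> L2 V"
  shows "integrable (lebesgue_on V) (\<lambda>x. f x * g x)"
proof (rule Bochner_Integration.integrable_bound)
  show "integrable (lebesgue_on V) (\<lambda>x. (f x)\<^sup>2 + (g x)\<^sup>2)" using assms by (simp add: L2_def)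
  show "(\<lambda>x. f x * g x) \<in> borel_measurable (lebesgue_on V)" using assms by (auto simp: L2_def intro: borel_measurable_times)
  have "\<bar>f x * g x\<bar> \<le> \<bar>(f x)\<^sup>2 + (g x)\<^sup>2\<bar>" for x
  proof -
    have "2 * (\<bar>f x\<bar> * \<bar>g x\<bar>) \<le> (f x)\<^sup>2 + (g x)\<^sup>2"
      using sum_squares_bound[of "\<bar>f x\<bar>" "\<bar>g x\<bar>"] by simp
    moreover have "0 \<le> \<bar>f x\<bar> * \<bar>g x\<bar>" by simp
    ultimately have "\<bar>f x\<bar> * \<bar>g x\<bar> \<le> (f x)\<^sup>2 + (g x)\<^sup>2" by linarith
    then show ?thesis by (simp add: abs_mult)
  qed
  then show "AE x in lebesgue_on V. norm (f x * g x) \<le> norm ((f x)\<^sup>2 + (g x)\<^sup>2)" by simp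
qed

lemma L2_add: "f \<in> L2 V \<Longrightarrow> g \<in> L2 V \<Longrightarrow> (\<lambda>x. f x + g x) \<in> L2 V"
  and L2_cmult: "f \<in> L2 V \<Longrightarrow> (\<lambda>x. c * f x) \<in> L2 V"
  using L2_mult_integrable[of f V g]
  by (auto simp: L2_def power2_sum power_mult_distrib mult.assoc)

lemma L2_diff: "f \<in> L2 V \<Longrightarrow> g \<in> L2 V \<Longrightarrow> (\<lambda>x. f x - g x) \<in> L2 V"
  using L2_add[of f V "\<lambda>x. (-1) * g x"] L2_cmult[of g V "-1"] by simp

lemma L2_Cauchy_Schwarz:
  assumes f: "f \<in> L2 V" and g: "g \<in> L2 V"
  shows "\<bar>LINT x|lebesgue_on V. f x * g x\<bar>
    \<le> sqrt (LINT x|lebesgue_on V. (f x)\<^sup>2) * sqrt (LINT x|lebesgue_on V. (g x)\<^sup>2)"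
proof -
  define A I B where "A = (LINT x|lebesgue_on V. (f x)\<^sup>2)" and "I = (LINT x|lebesgue_on V. f x * g x)"
    and "B = (LINT x|lebesgue_on V. (g x)\<^sup>2)"
  have A: "A \<ge> 0" by (simp add: A_def)
  \<comment> \<open>The classical discriminant argument, on the quadratic
    \<open>t \<mapsto> \<integral> (t f - g)\<^sup>2\<close>.\<close>
  have q: "0 \<le> t\<^sup>2 * A - 2 * t * I + B" for t
  proof -
    have "0 \<le> (LINT x|lebesgue_on V. (t * f x - g x)\<^sup>2)" by simp
    also have "\<dots> = (LINT x|lebesgue_on V. t\<^sup>2 * (f x)\<^sup>2 - 2 * t * (f x * g x) + (g x)\<^sup>2)"
      by (simp add: power2_eq_square algebra_simps)
    also have "\<dots> = t\<^sup>2 * A - 2 * t * I + B"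
      using f g L2_mult_integrable[OF f g] by (simp add: A_def I_def B_def L2_def)
    finally show ?thesis .
  qed
  have "I\<^sup>2 \<le> A * B"
  proof (cases "A = 0")
    case True
    have "I = 0"
    proof (rule ccontr)
      assume "I \<noteq> 0"
      \<comment> \<open>With \<open>A = 0\<close> the quadratic is affine in \<open>t\<close>, and
        this \<open>t\<close> gives it the value \<open>- 1\<close>.\<close>
      with q[of "(B + 1) / (2 * I)"] True show False by (simp add: field_simps)
    qed
    then show ?thesis using True by simp
  next
    case False
    with A have "A > 0" by simp
    \<comment> \<open>\<open>I / A\<close> is the minimiser of the quadratic.\<close>
    with q[of "I / A"] show ?thesis
      by (simp add: power2_eq_square field_simps)
  qed
  then have "sqrt (I\<^sup>2) \<le> sqrt (A * B)" by (rule real_sqrt_le_mono)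
  then show ?thesis by (simp add: A_def I_def B_def real_sqrt_mult)
qed

lemma continuous_lebesgue_on_measurable:
  "continuous_on UNIV f \<Longrightarrow> f \<in> borel_measurable (lebesgue_on V)" for f :: "real^2 \<Rightarrow> real"
  by (intro measurable_restrict_space1 measurable_completion) (simp add: borel_measurable_continuous_onI)

lemma integral_lebesgue_on_support:
  fixes k :: "real^2 \<Rightarrow> real"
  assumes "V \<in> sets lebesgue" "\<And>x. x \<notin> V \<Longrightarrow> k x = 0"
  shows "(LINT x|lebesgue_on V. k x) = integral\<^sup>L lebesgue k"
proof -
  have "(LINT x|lebesgue_on V. k x) = (LINT x|lebesgue. indicator V x *\<^sub>R k x)"
    using assms(1) by (intro integral_restrict_space) auto
  also have "(\<lambda>x. indicator V x *\<^sub>R k x) = k" using assms(2) by (auto simp: fun_eq_iff indicator_def)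
  finally show ?thesis .
qed

lemma test_function_L2:
  assumes "\<phi> \<in> test_functions U" "V \<in> lmeasurable"
  shows "\<phi> \<in> L2 V"
proof -
  have "bounded {x. \<phi> x \<noteq> 0}" by (rule test_functions_support_bounded[OF assms(1)])
  then obtain M where "\<And>x. \<bar>\<phi> x\<bar> \<le> M"
    using continuous_compact_support_bounded[OF test_functionsD(2)[OF assms(1)], of "{x. \<phi> x \<noteq> 0}"] by blast
  then show ?thesis
    using assms test_functionsD(2)[OF assms(1)] by (intro L2_bounded continuous_lebesgue_on_measurable) auto
qed

lemma bounded_open_lmeasurable: "open V \<Longrightarrow> bounded V \<Longrightarrow> V \<in> lmeasurable"
  by (simp add: lmeasurable_open)

lemma has_weak_partial_diff:
  assumes "has_weak_partial V j f f'" "has_weak_partial V j g g'" "V \<in> lmeasurable"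
  shows "has_weak_partial V j (\<lambda>x. f x - g x) (\<lambda>x. f' x - g' x)"
proof -
  have L: "f \<in> L2 V" "f' \<in> L2 V" "g \<in> L2 V" "g' \<in> L2 V" using assms by (auto simp: has_weak_partial_def)
  have "(LINT x|lebesgue_on V. (f x - g x) * partial j \<phi> x) = - (LINT x|lebesgue_on V. (f' x - g' x) * \<phi> x)"
    if \<phi>: "\<phi> \<in> test_functions V" for \<phi>
  proof -
    have t: "\<phi> \<in> L2 V" "partial j \<phi> \<in> L2 V"
      using test_function_L2[OF _ assms(3)] \<phi> test_functions_partial by blast+
    show ?thesis
      using assms(1,2) \<phi> L t by (simp add: has_weak_partial_def left_diff_distrib L2_mult_integrable)
  qed
  with L show ?thesis by (simp add: has_weak_partial_def L2_diff)
qed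

text \<open>On the segment from \<open>x\<close> to \<open>y\<close> the finitely many closed pieces
  leave closed parameter sets that cover \<open>{0..1}\<close>; a function Lipschitz on each of them
  is Lipschitz on the interval. The pieces may be nonconvex, which is used for the complement of
  \<open>\<Omega>\<close>.\<close>

lemma piecewise_C_1_lipschitz:
  fixes F :: "real^2 \<Rightarrow> real"
  assumes "finite \<A>" "\<And>T. T \<in> \<A> \<Longrightarrow> closed T" "\<Union>\<A> = UNIV"
    and "\<And>T. T \<in> \<A> \<Longrightarrow> \<exists>M\<ge>0. \<forall>x\<in>T. \<forall>y\<in>T. \<bar>F x - F y\<bar> \<le> M * norm (x - y)"
  obtains M where "\<And>x y. \<bar>F x - F y\<bar> \<le> M * norm (x - y)"
proof -
  obtain m where m: "\<And>T. T \<in> \<A> \<Longrightarrow> m T \<ge> 0"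
      "\<And>T x y. T \<in> \<A> \<Longrightarrow> x \<in> T \<Longrightarrow> y \<in> T \<Longrightarrow> \<bar>F x - F y\<bar> \<le> m T * norm (x - y)"
    using assms(4) by metis
  define M where "M = (\<Sum>T\<in>\<A>. m T)"
  have M: "m T \<le> M" if "T \<in> \<A>" for T
    unfolding M_def using assms(1) m(1) that by (intro member_le_sum) auto
  have "M \<ge> 0" unfolding M_def using m(1) by (intro sum_nonneg)
  have "\<bar>F x - F y\<bar> \<le> M * norm (x - y)" for x y
  proof -
    define \<gamma> where "\<gamma> \<tau> = x + \<tau> *\<^sub>R (y - x)" for \<tau> :: real
    have \<gamma>: "continuous_on UNIV \<gamma>" unfolding \<gamma>_def by (intro continuous_intros)
    have d: "norm (\<gamma> s - \<gamma> t) = \<bar>s - t\<bar> * norm (x - y)" for s t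
    proof -
      have "\<gamma> s - \<gamma> t = (s - t) *\<^sub>R (y - x)" by (simp add: \<gamma>_def algebra_simps)
      then show ?thesis by (simp add: norm_minus_commute)
    qed
    have "(M * norm (x - y))-lipschitz_on {0..1} (F \<circ> \<gamma>)"
    proof (rule lipschitz_on_closed_Union[where I = \<A> and U = "\<lambda>T. \<gamma> -` T"])
      show "(M * norm (x - y))-lipschitz_on (\<gamma> -` T) (F \<circ> \<gamma>)" if T: "T \<in> \<A>" for T
      proof (rule lipschitz_onI)
        fix s t assume st: "s \<in> \<gamma> -` T" "t \<in> \<gamma> -` T"
        have "\<bar>F (\<gamma> s) - F (\<gamma> t)\<bar> \<le> m T * norm (\<gamma> s - \<gamma> t)" using st T by (intro m(2)) auto
        also have "\<dots> \<le> M * norm (\<gamma> s - \<gamma> t)" using M[OF T] by (intro mult_right_mono) auto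
        finally show "dist ((F \<circ> \<gamma>) s) ((F \<circ> \<gamma>) t) \<le> M * norm (x - y) * dist s t"
          by (simp add: d dist_real_def mult_ac)
      qed (use \<open>M \<ge> 0\<close> in auto)
      show "closed (\<gamma> -` T)" if "T \<in> \<A>" for T
        using assms(2)[OF that] \<gamma> by (simp add: closed_vimage)
      show "{0..1} \<subseteq> (\<Union>T\<in>\<A>. \<gamma> -` T)" using assms(3) by blast
    qed (use assms \<open>M \<ge> 0\<close> in auto)
    from lipschitz_onD[OF this, of 0 1] show ?thesis by (simp add: \<gamma>_def dist_real_def)
  qed
  then show ?thesis using that by blast
qed

text \<open>The pieces agree on common edges because \<open>v\<close> is one function on closed
  boxes. Hence \<open>v * \<phi>\<close> is globally Lipschitz and classically differentiable off
  the edges, its derivative integrates to \<open>0\<close>, and no jump terms have to be cancelled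
  edge by edge.\<close>

lemma piecewise_C_1_weak_partial:
  fixes v :: "real^2 \<Rightarrow> real"
  assumes fin: "finite \<A>" and box: "\<And>T. T \<in> \<A> \<Longrightarrow> \<exists>a b. T = cbox a b"
    and cover: "\<Omega> \<subseteq> \<Union>\<A>" and "open \<Omega>"
    and piece: "\<And>T. T \<in> \<A> \<Longrightarrow> \<exists>q. C_k 1 q \<and> (\<forall>x\<in>T. v x = q x)"
  shows "\<exists>g. has_weak_partial \<Omega> j v g"
proof -
  obtain q where q: "\<And>T. T \<in> \<A> \<Longrightarrow> C_k 1 (q T)" "\<And>T x. T \<in> \<A> \<Longrightarrow> x \<in> T \<Longrightarrow> v x = q T x"
    using piece by metis
  have cpt: "compact T" if "T \<in> \<A>" for T using box[OF that] by auto
  have "bounded (\<Union>\<A>)" using fin cpt by (auto intro: compact_imp_bounded)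
  then have "bounded \<Omega>" using cover bounded_subset by blast
  then have \<Omega>: "\<Omega> \<in> lmeasurable" "\<Omega> \<in> sets lebesgue"
    using bounded_open_lmeasurable[OF \<open>open \<Omega>\<close>] by auto
  define O' where "O' = (\<Union>T\<in>\<A>. interior T)"
  \<comment> \<open>On the edges \<open>v\<close> may fail to be differentiable and
    \<open>partial j v\<close> is then arbitrary; the default \<open>0\<close> keeps
    \<open>g\<close> Borel measurable and bounded.\<close>
  define g where "g x = (if x \<in> O' then partial j v x else 0)" for x
  have inner: "(v has_derivative frechet_derivative (q T) (at x)) (at x)" "partial j v x = partial j (q T) x"
    if T: "T \<in> \<A>" "x \<in> interior T" for T x
  proof -
    have "(q T has_derivative frechet_derivative (q T) (at x)) (at x)"
      using q(1)[OF T(1)] frechet_derivative_works by auto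
    then show "(v has_derivative frechet_derivative (q T) (at x)) (at x)"
      by (rule has_derivative_transform_within_open[OF _ open_interior T(2)])
         (use q(2)[OF T(1)] interior_subset[of T] in force)
    from partial_eqI[OF this] show "partial j v x = partial j (q T) x" by (simp add: partial_def)
  qed
  have "open O'" unfolding O'_def by auto
  have "continuous_on O' (partial j v)"
    unfolding O'_def
  proof (rule continuous_on_open_UN)
    show "continuous_on (interior T) (partial j v)" if T: "T \<in> \<A>" for T
    proof (rule continuous_on_eq)
      show "continuous_on (interior T) (partial j (q T))"
        using q(1)[OF T] by (auto intro: continuous_on_subset)
    qed (use inner(2)[OF T] in auto)
  qed auto
  then have "(\<lambda>x. indicator O' x *\<^sub>R partial j v x) \<in> borel_measurable borel"
    using \<open>open O'\<close> by (intro borel_measurable_continuous_on_indicator) auto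
  also have "(\<lambda>x. indicator O' x *\<^sub>R partial j v x) = g" by (auto simp: g_def fun_eq_iff indicator_def)
  finally have g_meas: "g \<in> borel_measurable lebesgue" by (intro measurable_completion) simp
  have bdd: "\<exists>M\<ge>0. \<forall>T\<in>\<A>. \<forall>x\<in>T. \<bar>f T x\<bar> \<le> M" if "\<And>T. T \<in> \<A> \<Longrightarrow> continuous_on UNIV (f T)" for f :: "_ \<Rightarrow> real^2 \<Rightarrow> real"
  proof -
    have "\<exists>M\<ge>0. \<forall>x\<in>T. \<bar>f T x\<bar> \<le> M" if T: "T \<in> \<A>" for T
    proof -
      have "compact (f T ` T)"
        using that \<open>\<And>T. T \<in> \<A> \<Longrightarrow> continuous_on UNIV (f T)\<close> cpt[OF T]
        by (intro compact_continuous_image) (auto intro: continuous_on_subset)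
      then obtain M where "M > 0" "\<And>x. x \<in> T \<Longrightarrow> \<bar>f T x\<bar> \<le> M"
        using compact_imp_bounded bounded_pos by (metis imageI real_norm_def)
      then show ?thesis by (metis less_imp_le)
    qed
    then obtain m where m: "\<And>T. T \<in> \<A> \<Longrightarrow> m T \<ge> 0" "\<And>T x. T \<in> \<A> \<Longrightarrow> x \<in> T \<Longrightarrow> \<bar>f T x\<bar> \<le> m T"
      by metis
    have "\<bar>f T x\<bar> \<le> sum m \<A>" if "T \<in> \<A>" "x \<in> T" for T x
    proof -
      have "m T \<le> sum m \<A>" using m(1) fin that by (intro member_le_sum) auto
      with m(2)[OF that] show ?thesis by linarith
    qed
    then show ?thesis using sum_nonneg[of \<A> m] m(1) by blast
  qed
  obtain M1 where M1: "M1 \<ge> 0" "\<And>T x. T \<in> \<A> \<Longrightarrow> x \<in> T \<Longrightarrow> \<bar>q T x\<bar> \<le> M1"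
    using bdd[of q] q(1) C_k_continuous by metis
  obtain M2 where M2: "M2 \<ge> 0" "\<And>T x. T \<in> \<A> \<Longrightarrow> x \<in> T \<Longrightarrow> \<bar>partial j (q T) x\<bar> \<le> M2"
    using bdd[of "\<lambda>T. partial j (q T)"] q(1) by auto
  have v_bd: "\<bar>v x\<bar> \<le> M1" if "x \<in> \<Omega>" for x using that cover M1(2) q(2) by (metis UnionE subsetD)
  have g_bd: "\<bar>g x\<bar> \<le> M2" for x
    using M2 inner(2) interior_subset unfolding g_def O'_def by fastforce
  have v_cont: "continuous_on (\<Union>\<A>) v"
  proof -
    have "continuous_on (\<Union>T\<in>\<A>. T) v"
    proof (rule continuous_on_closed_Union[OF fin])
      show "continuous_on T v" if "T \<in> \<A>" for T
      proof (rule continuous_on_eq)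
        show "continuous_on T (q T)" using q(1)[OF that] C_k_continuous continuous_on_subset by blast
      qed (use q(2)[OF that] in auto)
    qed (use cpt compact_imp_closed in auto)
    then show ?thesis by simp
  qed
  then have v_meas: "v \<in> borel_measurable (lebesgue_on \<Omega>)"
    using cover \<Omega>(2) continuous_on_subset by (intro continuous_imp_measurable_on_sets_lebesgue) blast+
  have vL: "v \<in> L2 \<Omega>" using L2_bounded[OF \<Omega>(1) v_meas] v_bd by blast
  have gL: "g \<in> L2 \<Omega>" using L2_bounded[OF \<Omega>(1) measurable_restrict_space1[OF g_meas]] g_bd by blast
  have parts: "(LINT x|lebesgue_on \<Omega>. v x * partial j \<phi> x) = - (LINT x|lebesgue_on \<Omega>. g x * \<phi> x)"
    if \<phi>: "\<phi> \<in> test_functions \<Omega>" for \<phi>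
  proof -
    define d where "d x = v x * partial j \<phi> x + g x * \<phi> x" for x
    have off: "d x = 0" "v x * \<phi> x = 0" if "x \<notin> \<Omega>" for x
      using test_functionsD(5,6)[OF \<phi> that] by (auto simp: d_def)
    have t: "\<phi> \<in> L2 \<Omega>" "partial j \<phi> \<in> L2 \<Omega>"
      using test_function_L2[OF _ \<Omega>(1)] \<phi> test_functions_partial by blast+
    \<comment> \<open>The closed set \<open>- \<Omega>\<close>, on which \<open>v * \<phi>\<close>
      vanishes, completes the cells to a cover of the plane.\<close>
    have lip: "\<exists>M\<ge>0. \<forall>x\<in>T. \<forall>y\<in>T. \<bar>v x * \<phi> x - v y * \<phi> y\<bar> \<le> M * norm (x - y)" if T: "T \<in> insert (-\<Omega>) \<A>" for T
    proof (cases "T = -\<Omega>")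
      case True
      then show ?thesis by (intro exI[of _ 0]) (simp add: off(2) del: mult_eq_0_iff)
    next
      case False
      with T have T: "T \<in> \<A>" by blast
      have C: "C_k 1 (\<lambda>x. q T x * \<phi> x)" by (rule C_1_mult(1)[OF q(1)[OF T] test_functionsD(1)[OF \<phi>]])
      obtain M where "M > 0" "\<And>x y. \<bar>q T x * \<phi> x - q T y * \<phi> y\<bar> \<le> M * norm (x - y)"
        by (rule C_1_lipschitz[OF C _ test_functions_support_bounded[OF \<phi>]]) (auto intro: that)
      then show ?thesis using q(2)[OF T] by (intro exI[of _ M]) (auto simp: less_imp_le)
    qed
    obtain M where M: "\<And>x y. \<bar>v x * \<phi> x - v y * \<phi> y\<bar> \<le> M * norm (x - y)"
    proof (rule piecewise_C_1_lipschitz[of "insert (-\<Omega>) \<A>" "\<lambda>x. v x * \<phi> x"])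
      show "closed T" if "T \<in> insert (-\<Omega>) \<A>" for T
        using that cpt compact_imp_closed \<open>open \<Omega>\<close> by auto
      show "\<Union>(insert (-\<Omega>) \<A>) = UNIV" using cover by blast
    qed (use fin lip that in auto)
    have "integral\<^sup>L lebesgue d = 0"
    proof (rule integral_directional_derivative_eq_0(2)[where F = "\<lambda>x. v x * \<phi> x" and K = \<Omega> and M = M])
      show "\<bar>v (x + t *\<^sub>R axis j 1) * \<phi> (x + t *\<^sub>R axis j 1) - v x * \<phi> x\<bar> \<le> M * \<bar>t\<bar>" for x t
        using M[of "x + t *\<^sub>R axis j 1" x] by simp
      have "M-lipschitz_on UNIV (\<lambda>x. v x * \<phi> x)" if "M \<ge> 0"
        using M that by (intro lipschitz_onI) (auto simp: dist_norm)
      moreover have "M \<ge> 0" using M[of "axis 1 1" 0] by (simp add: order_trans[OF abs_ge_zero])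
      ultimately show "continuous_on UNIV (\<lambda>x. v x * \<phi> x)" using lipschitz_on_continuous_on by blast
      have "(\<lambda>x. if x \<in> \<Omega> then d x else 0) \<in> borel_measurable lebesgue"
        unfolding d_def using vL gL t \<Omega>(2)
        by (intro borel_measurable_if_I borel_measurable_add borel_measurable_times) (auto simp: L2_def)
      also have "(\<lambda>x. if x \<in> \<Omega> then d x else 0) = d" using off by (auto simp: fun_eq_iff)
      finally show "d \<in> borel_measurable lebesgue" .
      show "bounded \<Omega>" by fact
      \<comment> \<open>Points on cell edges are discarded as a null set; elsewhere the pointwise
        product rule applies.\<close>
      have "negligible (\<Union>T\<in>\<A>. T - interior T)"
      proof (rule negligible_Union)
        fix N assume "N \<in> (\<lambda>T. T - interior T) ` \<A>"
        then obtain T a b where "N = T - interior T" "T = cbox a b" using box by blast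
        then show "negligible N" using negligible_frontier_interval[of a b] by (simp add: interior_cbox)
      qed (use fin in auto)
      then have "(\<Union>T\<in>\<A>. T - interior T) \<in> null_sets lebesgue" by (simp add: negligible_iff_null_sets)
      from AE_not_in[OF this]
      show "AE x in lebesgue. ((\<lambda>t. v (x + t *\<^sub>R axis j 1) * \<phi> (x + t *\<^sub>R axis j 1)) has_real_derivative d x) (at 0)"
      proof (rule AE_mp, intro AE_I2 impI)
        fix x assume x: "x \<notin> (\<Union>T\<in>\<A>. T - interior T)"
        have line: "((\<lambda>t. x + t *\<^sub>R axis j 1) has_derivative (\<lambda>s. s *\<^sub>R axis j 1)) (at 0)"
          by (auto intro!: derivative_eq_intros)
        have "\<exists>D. ((\<lambda>x. v x * \<phi> x) has_derivative D) (at x) \<and> D (axis j 1) = d x"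
        proof (cases "x \<in> \<Omega>")
          case True
          then obtain T where T: "T \<in> \<A>" "x \<in> interior T" using x cover by blast
          have "(\<phi> has_derivative frechet_derivative \<phi> (at x)) (at x)"
            using test_functionsD(3)[OF \<phi>] frechet_derivative_works by blast
          from has_derivative_mult[OF inner(1)[OF T] this] show ?thesis
            using inner(2)[OF T] T unfolding d_def g_def O'_def by (auto simp: partial_def)
        next
          case False
          \<comment> \<open>Even at a boundary point of \<open>\<Omega>\<close> the product vanishes
            in a whole neighbourhood, since the closed support of \<open>\<phi>\<close> lies in
            \<open>\<Omega>\<close>.\<close>
          then have x0: "x \<in> - closure {x. \<phi> x \<noteq> 0}" using \<phi> by (auto simp: test_functions_def)
          have "((\<lambda>x. v x * \<phi> x) has_derivative (\<lambda>_. 0)) (at x)"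
            by (rule has_derivative_transform_within_open[of "\<lambda>_. 0", OF _ _ x0])
               (use closure_subset[of "{x. \<phi> x \<noteq> 0}"] in \<open>auto simp: open_Compl simp del: closure_closure\<close>)
          then show ?thesis using off(1)[OF False] by force
        qed
        then obtain D where D: "((\<lambda>x. v x * \<phi> x) has_derivative D) (at (x + 0 *\<^sub>R axis j 1))" "D (axis j 1) = d x"
          by auto
        have "linear D" using D(1) has_derivative_linear by blast
        then have "(\<lambda>s. D (s *\<^sub>R axis j 1)) = (*) (d x)" using D(2) by (auto simp: linear_scale fun_eq_iff)
        with has_derivative_compose[OF line D(1)]
        show "((\<lambda>t. v (x + t *\<^sub>R axis j 1) * \<phi> (x + t *\<^sub>R axis j 1)) has_real_derivative d x) (at 0)"
          by (simp only: has_field_derivative_def)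
      qed
    qed (use off in auto)
    moreover have "(LINT x|lebesgue_on \<Omega>. d x) = integral\<^sup>L lebesgue d"
      by (rule integral_lebesgue_on_support[OF \<Omega>(2) off(1)])
    moreover have "(LINT x|lebesgue_on \<Omega>. d x)
        = (LINT x|lebesgue_on \<Omega>. v x * partial j \<phi> x) + (LINT x|lebesgue_on \<Omega>. g x * \<phi> x)"
      unfolding d_def by (intro Bochner_Integration.integral_add L2_mult_integrable vL gL t)
    ultimately show ?thesis by simp
  qed
  then show ?thesis using vL gL by (auto simp: has_weak_partial_def)
qed

text \<open>Positive diameters are recorded because they force \<open>mesh_size\<close> to be
  positive, as the scaling argument requires.\<close>

lemma cartesian_mesh_cells:
  assumes "cartesian_mesh \<T>"
  shows "finite \<T>" "\<And>T. T \<in> \<T> \<Longrightarrow> \<exists>a b. T = cbox a b" "\<And>T. T \<in> \<T> \<Longrightarrow> 0 < diameter T"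
proof -
  obtain X Y where XY: "finite X" "finite Y"
      "\<T> = {cbox (vector [a, c]) (vector [b, d]) | a b c d. consecutive X a b \<and> consecutive Y c d}"
    using assms by (auto simp: cartesian_mesh_def)
  have "\<T> \<subseteq> (\<lambda>(a, b, c, d). cbox (vector [a, c]) (vector [b, d])) ` (X \<times> X \<times> Y \<times> Y)"
    unfolding XY(3) consecutive_def by force
  then show "finite \<T>" by (rule finite_subset) (use XY in auto)
  show "\<exists>a b. T = cbox a b" if "T \<in> \<T>" for T using that XY(3) by blast
  show "0 < diameter T" if cell: "T \<in> \<T>" for T
  proof -
    obtain a b c d where T: "T = cbox (vector [a, c]) (vector [b, d])" "a < b" "c < d"
      using cell unfolding XY(3) consecutive_def by blast
    have in_T: "vector [a, c] \<in> T" "vector [b, d] \<in> T" and ne: "(vector [a, c] :: real^2) \<noteq> vector [b, d]"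
      using T by (auto simp: mem_box_cart forall_2 vec_eq_iff)
    have "0 < dist (vector [a, c] :: real^2) (vector [b, d])" using ne by simp
    also have "\<dots> \<le> diameter T" using in_T T(1) by (intro diameter_bounded_bound) auto
    finally show ?thesis .
  qed
qed

lemma Q_poly_C_1: "q \<in> Q_poly p \<Longrightarrow> C_k 1 q"
  using degree_below_Q_poly[of q p "Suc (2 * p)"] by simp

text \<open>\<open>grad_L2_norm\<close> rests on the choice in \<open>weak_partial\<close>, which
  says something only once a weak derivative exists. For the error this needs existence for
  \<open>u\<close> and for the discrete function.\<close>

lemma fe_space_weak_partial:
  assumes "cartesian_mesh \<T>" "open \<Omega>" "\<Omega> \<subseteq> \<Union>\<T>" "v \<in> fe_space \<Omega> \<T> p"
  shows "\<exists>g. has_weak_partial \<Omega> j (\<lambda>x. v x $ i) g"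
proof (rule piecewise_C_1_weak_partial)
  show "finite (active_mesh \<Omega> \<T>)" "\<And>T. T \<in> active_mesh \<Omega> \<T> \<Longrightarrow> \<exists>a b. T = cbox a b"
    using cartesian_mesh_cells[OF assms(1)] by (auto simp: active_mesh_def)
  show "\<Omega> \<subseteq> \<Union>(active_mesh \<Omega> \<T>)" using assms(3) by (auto simp: active_mesh_def)
  show "\<exists>q. C_k 1 q \<and> (\<forall>x\<in>T. v x $ i = q x)" if "T \<in> active_mesh \<Omega> \<T>" for T
    using assms(4) that Q_poly_C_1 unfolding fe_space_def by blast
qed fact

section \<open>The Sobolev remainder\<close>

text \<open>As \<open>\<integral> g = 0\<close>, the product \<open>(\<integral> k) (\<integral> f g)\<close> is the double integral of
  \<open>(f x - f y) g x k y\<close>, and Young's inequality with weight \<open>\<tau>\<close> splits off the kernel of the seminorm.\<close>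

lemma slobodeckij_mean_bound:
  fixes f g k :: "real^2 \<Rightarrow> real"
  assumes V: "V \<in> lmeasurable" and f: "f \<in> L2 V" and slob: "slobodeckij \<sigma> V f < \<infinity>"
    and g: "g \<in> L2 V" "integrable (lebesgue_on V) g" "(LINT x|lebesgue_on V. g x) = 0"
    and k: "k \<in> L2 V" "integrable (lebesgue_on V) k"
    and diam: "\<And>x y. g x \<noteq> 0 \<Longrightarrow> k y \<noteq> 0 \<Longrightarrow> norm (x - y) \<le> D"
    and "\<tau> > 0" "\<sigma> \<ge> 0"
  shows "\<bar>LINT x|lebesgue_on V. k x\<bar> * \<bar>LINT x|lebesgue_on V. f x * g x\<bar>
    \<le> \<tau> * enn2real (slobodeckij \<sigma> V f)
      + D powr (2 + 2 * \<sigma>) / \<tau> * (LINT x|lebesgue_on V. (g x)\<^sup>2) * (LINT x|lebesgue_on V. (k x)\<^sup>2)"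
proof -
  let ?M = "lebesgue_on V"
  interpret finite_measure ?M using V by (rule finite_measure_lebesgue_on)
  have f_meas[measurable]: "f \<in> borel_measurable ?M" and g_meas[measurable]: "g \<in> borel_measurable ?M"
    and k_meas[measurable]: "k \<in> borel_measurable ?M"
    using f g k by (auto simp: L2_def)
  have [measurable]: "(\<lambda>x. x) \<in> ?M \<rightarrow>\<^sub>M (borel :: (real^2) measure)"
    using id_borel_measurable_lebesgue_on[of V] by (simp add: id_def)
  define Q where "Q x y = (f x - f y)\<^sup>2 / norm (x - y) powr (2 + 2 * \<sigma>)" for x y
  define E where "E = D powr (2 + 2 * \<sigma>) / \<tau>"
  have E: "E \<ge> 0" using \<open>\<tau> > 0\<close> by (simp add: E_def)
  have Q0: "Q x y \<ge> 0" for x y by (simp add: Q_def)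
  have Q_meas[measurable]: "(\<lambda>(x, y). ennreal (Q x y)) \<in> borel_measurable (?M \<Otimes>\<^sub>M ?M)"
    unfolding Q_def by measurable
  define K c where "K = (LINT x|?M. k x)" and "c = (LINT x|?M. f x * k x)"
  \<comment> \<open>\<open>F x\<close> is the inner integral over \<open>y\<close> of
    \<open>g x * (f x - f y) * k y\<close>; the part with \<open>c\<close> disappears on integrating
    over \<open>x\<close> because \<open>g\<close> has mean zero.\<close>
  define F where "F x = g x * (f x * K - c)" for x
  have fg: "integrable ?M (\<lambda>x. f x * g x)" and fk: "integrable ?M (\<lambda>x. f x * k x)"
    using L2_mult_integrable f g k by blast+
  have F_eq: "F = (\<lambda>x. K * (f x * g x) - c * g x)" by (auto simp: F_def fun_eq_iff algebra_simps)
  have F_int: "integrable ?M F" unfolding F_eq using fg g(2) by simp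
  have F_val: "integral\<^sup>L ?M F = K * (LINT x|?M. f x * g x)"
    unfolding F_eq using fg g(2,3) by simp
  \<comment> \<open>The weight in Young's inequality depends on the points:
    \<open>\<tau> / N\<close> with \<open>N\<close> the kernel denominator. Where \<open>g x\<close>
    and \<open>k y\<close> are both nonzero, \<open>N\<close> is bounded by the power of
    \<open>D\<close>.\<close>
  have young: "\<bar>g x * (f x - f y) * k y\<bar> \<le> \<tau> * Q x y + E * (g x)\<^sup>2 * (k y)\<^sup>2" for x y
  proof (cases "x = y \<or> g x = 0 \<or> k y = 0")
    case True
    then show ?thesis using \<open>\<tau> > 0\<close> E Q0[of x y] by auto
  next
    case False
    define N where "N = norm (x - y) powr (2 + 2 * \<sigma>)"
    define a b where "a = \<bar>f x - f y\<bar>" and "b = \<bar>g x * k y\<bar>"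
    have N: "N > 0" "N \<le> D powr (2 + 2 * \<sigma>)"
      using False diam[of x y] \<open>\<sigma> \<ge> 0\<close> by (auto simp: N_def intro!: powr_mono2)
    have "2 * ((\<tau> / N * a) * b) \<le> (\<tau> / N * a)\<^sup>2 + b\<^sup>2" using sum_squares_bound[of "\<tau> / N * a" b] by simp
    moreover have "0 \<le> (\<tau> / N * a) * b" using N(1) \<open>\<tau> > 0\<close> by (simp add: a_def b_def)
    ultimately have "(\<tau> / N * a) * b \<le> (\<tau> / N * a)\<^sup>2 + b\<^sup>2" by linarith
    then have "(N / \<tau>) * ((\<tau> / N * a) * b) \<le> (N / \<tau>) * ((\<tau> / N * a)\<^sup>2 + b\<^sup>2)"
      using N(1) \<open>\<tau> > 0\<close> by (intro mult_left_mono) auto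
    also have "(N / \<tau>) * ((\<tau> / N * a) * b) = a * b"
      using N(1) \<open>\<tau> > 0\<close> by simp
    also have "(N / \<tau>) * ((\<tau> / N * a)\<^sup>2 + b\<^sup>2) = \<tau> * (a\<^sup>2 / N) + (N / \<tau>) * b\<^sup>2"
      using N(1) \<open>\<tau> > 0\<close> by (simp add: field_simps power2_eq_square)
    finally have "a * b \<le> \<tau> * (a\<^sup>2 / N) + (N / \<tau>) * b\<^sup>2" .
    also have "(N / \<tau>) * b\<^sup>2 \<le> E * b\<^sup>2"
      using N(2) \<open>\<tau> > 0\<close> unfolding E_def by (intro mult_right_mono divide_right_mono) auto
    finally show ?thesis
      by (simp add: a_def b_def N_def Q_def abs_mult power_mult_distrib mult_ac)
  qed
  have sq: "(\<integral>\<^sup>+x. ennreal ((h x)\<^sup>2) \<partial>?M) = ennreal (LINT x|?M. (h x)\<^sup>2)" if "h \<in> L2 V" for h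
    using that by (intro nn_integral_eq_integral) (auto simp: L2_def)
  \<comment> \<open>Estimating for fixed \<open>x\<close> first reproduces the iterated integral in
    \<open>slobodeckij\<close>, so the order of integration is never exchanged.\<close>
  have inner: "ennreal \<bar>F x\<bar> \<le> ennreal \<tau> * (\<integral>\<^sup>+y. ennreal (Q x y) \<partial>?M)
      + ennreal (E * (g x)\<^sup>2) * ennreal (LINT y|?M. (k y)\<^sup>2)" if x: "x \<in> V" for x
  proof -
    have i: "integrable ?M (\<lambda>y. g x * (f x - f y) * k y)"
    proof -
      have "integrable ?M (\<lambda>y. g x * (f x * k y - f y * k y))" using fk k(2) by simp
      then show ?thesis by (simp add: algebra_simps)
    qed
    have "F x = (LINT y|?M. g x * (f x - f y) * k y)"
    proof -
      have "(LINT y|?M. g x * (f x - f y) * k y) = (LINT y|?M. g x * (f x * k y - f y * k y))"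
        by (simp add: algebra_simps)
      also have "\<dots> = F x" using fk k(2) by (simp add: F_def K_def c_def)
      finally show ?thesis by simp
    qed
    then have "ennreal \<bar>F x\<bar> \<le> (\<integral>\<^sup>+y. ennreal \<bar>g x * (f x - f y) * k y\<bar> \<partial>?M)"
      using integral_norm_bound_ennreal[OF i] by simp
    also have "\<dots> \<le> (\<integral>\<^sup>+y. ennreal \<tau> * ennreal (Q x y) + ennreal (E * (g x)\<^sup>2) * ennreal ((k y)\<^sup>2) \<partial>?M)"
      using young E Q0 \<open>\<tau> > 0\<close>
      by (intro nn_integral_mono) (simp add: ennreal_mult[symmetric] ennreal_plus[symmetric] del: ennreal_plus)
    also have "\<dots> = ennreal \<tau> * (\<integral>\<^sup>+y. ennreal (Q x y) \<partial>?M) + ennreal (E * (g x)\<^sup>2) * (\<integral>\<^sup>+y. ennreal ((k y)\<^sup>2) \<partial>?M)"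
    proof -
      have [measurable]: "(\<lambda>y. ennreal (Q x y)) \<in> borel_measurable ?M"
        using measurable_Pair2[OF Q_meas, of x] x by simp
      show ?thesis by (subst nn_integral_add) (auto simp: nn_integral_cmult)
    qed
    finally show ?thesis by (simp add: sq[OF k(1)])
  qed
  have Qx_meas[measurable]: "(\<lambda>x. \<integral>\<^sup>+y. ennreal (Q x y) \<partial>?M) \<in> borel_measurable ?M"
    by (rule borel_measurable_nn_integral) (rule Q_meas)
  have S: "(\<integral>\<^sup>+x. (\<integral>\<^sup>+y. ennreal (Q x y) \<partial>?M) \<partial>?M) = slobodeckij \<sigma> V f"
    by (simp add: slobodeckij_def Q_def)
  have "ennreal \<bar>integral\<^sup>L ?M F\<bar> \<le> (\<integral>\<^sup>+x. ennreal \<bar>F x\<bar> \<partial>?M)"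
    using integral_norm_bound_ennreal[OF F_int] by simp
  also have "\<dots> \<le> (\<integral>\<^sup>+x. ennreal \<tau> * (\<integral>\<^sup>+y. ennreal (Q x y) \<partial>?M)
      + ennreal (E * (g x)\<^sup>2) * ennreal (LINT y|?M. (k y)\<^sup>2) \<partial>?M)"
    using inner by (intro nn_integral_mono) auto
  also have "\<dots> = ennreal \<tau> * slobodeckij \<sigma> V f
      + (\<integral>\<^sup>+x. ennreal (E * (g x)\<^sup>2) \<partial>?M) * ennreal (LINT y|?M. (k y)\<^sup>2)"
    by (subst nn_integral_add) (auto simp: nn_integral_cmult nn_integral_multc S)
  also have "(\<integral>\<^sup>+x. ennreal (E * (g x)\<^sup>2) \<partial>?M) = ennreal (E * (LINT x|?M. (g x)\<^sup>2))"
    using E by (simp add: ennreal_mult nn_integral_cmult sq[OF g(1)])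
  also have "slobodeckij \<sigma> V f = ennreal (enn2real (slobodeckij \<sigma> V f))" using slob by simp
  also have "ennreal \<tau> * ennreal (enn2real (slobodeckij \<sigma> V f))
        + ennreal (E * (LINT x|?M. (g x)\<^sup>2)) * ennreal (LINT y|?M. (k y)\<^sup>2)
      = ennreal (\<tau> * enn2real (slobodeckij \<sigma> V f) + E * (LINT x|?M. (g x)\<^sup>2) * (LINT y|?M. (k y)\<^sup>2))"
    using \<open>\<tau> > 0\<close> E by (simp add: ennreal_mult)
  finally have "\<bar>integral\<^sup>L ?M F\<bar> \<le> \<tau> * enn2real (slobodeckij \<sigma> V f) + E * (LINT x|?M. (g x)\<^sup>2) * (LINT y|?M. (k y)\<^sup>2)"
    using \<open>\<tau> > 0\<close> E by (subst (asm) ennreal_le_iff) auto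
  then show ?thesis by (simp add: F_val abs_mult K_def E_def)
qed

lemma integral_square_rescale:
  assumes "continuous_on UNIV \<phi>" "h > 0"
  shows "(LINT x|lebesgue. (rescale x\<^sub>0 h \<phi> x)\<^sup>2) = h\<^sup>2 * (LINT x|lebesgue. (\<phi> x)\<^sup>2)"
    and "(LINT x|lebesgue. rescale x\<^sub>0 h \<phi> x) = h\<^sup>2 * (LINT x|lebesgue. \<phi> x)"
proof -
  have "continuous_on UNIV (\<lambda>x. (\<phi> x)\<^sup>2)" using assms(1) by (intro continuous_intros)
  from integral_rescale[of "\<lambda>_. 1", OF _ assms(2) this] integral_rescale[of "\<lambda>_. 1", OF _ assms(2,1)]
  show "(LINT x|lebesgue. (rescale x\<^sub>0 h \<phi> x)\<^sup>2) = h\<^sup>2 * (LINT x|lebesgue. (\<phi> x)\<^sup>2)"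
    and "(LINT x|lebesgue. rescale x\<^sub>0 h \<phi> x) = h\<^sup>2 * (LINT x|lebesgue. \<phi> x)"
    by (simp_all add: rescale_def)
qed

lemma test_function_integrals:
  assumes "\<phi> \<in> test_functions V" "V \<in> lmeasurable"
  shows "(LINT x|lebesgue_on V. (\<phi> x)\<^sup>2) = (LINT x|lebesgue. (\<phi> x)\<^sup>2)"
    "(LINT x|lebesgue_on V. \<phi> x) = (LINT x|lebesgue. \<phi> x)"
    "integrable (lebesgue_on V) \<phi>"
proof -
  have V: "V \<in> sets lebesgue" using assms(2) by auto
  show "(LINT x|lebesgue_on V. (\<phi> x)\<^sup>2) = (LINT x|lebesgue. (\<phi> x)\<^sup>2)"
    "(LINT x|lebesgue_on V. \<phi> x) = (LINT x|lebesgue. \<phi> x)"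
    using test_functionsD(5)[OF assms(1)] by (intro integral_lebesgue_on_support[OF V]; simp)+
  interpret finite_measure "lebesgue_on V" using assms(2) by (rule finite_measure_lebesgue_on)
  show "integrable (lebesgue_on V) \<phi>"
    using test_function_L2[OF assms] by (auto simp: L2_def intro: square_integrable_imp_integrable)
qed

text \<open>Each of the first \<open>m\<close> letters is moved onto \<open>f\<close>, earning a
  factor \<open>h\<close> and costing one weak derivative. At least one letter is left, so what
  remains to be paired has mean zero. Cauchy-Schwarz earns one more \<open>h\<close>, and for
  \<open>\<sigma> > 0\<close> the mean zero property earns \<open>h powr \<sigma>\<close> through
  the seminorm. The function \<open>\<kappa>\<close> is only an averaging weight with nonzero
  integral.\<close>

lemma sobolev_word_bound:
  assumes V: "V \<in> lmeasurable" and "\<sigma> \<ge> 0" and f: "f \<in> sobolev_aux m \<sigma> V"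
    and \<eta>: "\<eta> \<in> test_functions U" and len: "m < length a"
    and \<kappa>: "\<kappa> \<in> test_functions U" "(LINT x|lebesgue. \<kappa> x) \<noteq> 0"
    and U: "U \<subseteq> ball 0 \<rho>"
    and scale: "\<And>h. 0 < h \<Longrightarrow> h \<le> h\<^sub>1 \<Longrightarrow> (\<lambda>y. x\<^sub>0 + h *\<^sub>R y) ` U \<subseteq> V"
  shows "\<exists>C. \<forall>h. 0 < h \<and> h \<le> h\<^sub>1 \<longrightarrow>
    \<bar>LINT x|lebesgue_on V. f x * rescale x\<^sub>0 h (foldr partial a \<eta>) x\<bar> \<le> C * h powr (real m + \<sigma> + 1)"
  using f len
proof (induction m arbitrary: f a)
  case 0
  let ?\<phi> = "foldr partial a \<eta>"
  have \<phi>: "?\<phi> \<in> test_functions U" using \<eta> by (rule foldr_partial_test)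
  have \<phi>c: "continuous_on UNIV ?\<phi>" and \<kappa>c: "continuous_on UNIV \<kappa>"
    using test_functionsD(2) \<phi> \<kappa>(1) by blast+
  have f: "f \<in> L2 V" using 0 by simp
  define P where "P = (LINT x|lebesgue. (?\<phi> x)\<^sup>2)"
  have g: "rescale x\<^sub>0 h ?\<phi> \<in> test_functions V" and k: "rescale x\<^sub>0 h \<kappa> \<in> test_functions V"
    if "0 < h" "h \<le> h\<^sub>1" for h
    using test_functions_rescale[OF _ that(1) scale[OF that]] \<phi> \<kappa>(1) by blast+
  show ?case
  proof (cases "\<sigma> = 0")
    case True
    have "\<bar>LINT x|lebesgue_on V. f x * rescale x\<^sub>0 h ?\<phi> x\<bar>
        \<le> (sqrt (LINT x|lebesgue_on V. (f x)\<^sup>2) * sqrt P) * h powr (real 0 + \<sigma> + 1)" if h: "0 < h" "h \<le> h\<^sub>1" for h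
    proof -
      have "\<bar>LINT x|lebesgue_on V. f x * rescale x\<^sub>0 h ?\<phi> x\<bar>
          \<le> sqrt (LINT x|lebesgue_on V. (f x)\<^sup>2) * sqrt (LINT x|lebesgue_on V. (rescale x\<^sub>0 h ?\<phi> x)\<^sup>2)"
        by (rule L2_Cauchy_Schwarz[OF f test_function_L2[OF g[OF h] V]])
      also have "(LINT x|lebesgue_on V. (rescale x\<^sub>0 h ?\<phi> x)\<^sup>2) = h\<^sup>2 * P"
        using test_function_integrals(1)[OF g[OF h] V] integral_square_rescale(1)[OF \<phi>c h(1)] by (simp add: P_def)
      finally show ?thesis using True h(1) by (simp add: real_sqrt_mult mult_ac)
    qed
    then show ?thesis by blast
  next
    case False
    with \<open>\<sigma> \<ge> 0\<close> have "\<sigma> > 0" by simp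
    then have slob: "slobodeckij \<sigma> V f < \<infinity>" using 0 by simp
    define S where "S = enn2real (slobodeckij \<sigma> V f)"
    define Q k0 where "Q = (LINT x|lebesgue. (\<kappa> x)\<^sup>2)" and "k0 = \<bar>LINT x|lebesgue. \<kappa> x\<bar>"
    define C where "C = (S + (2 * \<rho>) powr (2 + 2 * \<sigma>) * P * Q) / k0"
    have "\<bar>LINT x|lebesgue_on V. f x * rescale x\<^sub>0 h ?\<phi> x\<bar> \<le> C * h powr (real 0 + \<sigma> + 1)" if h: "0 < h" "h \<le> h\<^sub>1" for h
    proof -
      let ?g = "rescale x\<^sub>0 h ?\<phi>" and ?k = "rescale x\<^sub>0 h \<kappa>"
      define I where "I = \<bar>LINT x|lebesgue_on V. f x * ?g x\<bar>"
      have supp: "norm (x - x\<^sub>0) \<le> h * \<rho>" if \<psi>: "\<psi> \<in> test_functions U" "rescale x\<^sub>0 h \<psi> x \<noteq> 0" for \<psi> x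
      proof -
        have "(1/h) *\<^sub>R (x - x\<^sub>0) \<in> U" using test_functionsD(5)[OF \<psi>(1)] \<psi>(2) by (auto simp: rescale_def)
        then have "norm ((1/h) *\<^sub>R (x - x\<^sub>0)) < \<rho>" using U by auto
        moreover have "norm ((1/h) *\<^sub>R (x - x\<^sub>0)) = norm (x - x\<^sub>0) / h"
          using h(1) unfolding norm_scaleR by simp
        ultimately have "norm (x - x\<^sub>0) / h < \<rho>" by (simp only:)
        then show ?thesis using h(1) by (simp add: field_simps)
      qed
      \<comment> \<open>Mean zero is annihilation of the constant \<open>1\<close>, for which a word
        of length one is enough.\<close>
      have "degree_below (length a) (\<lambda>x. 1)"
        using degree_below_monomial[of 0 0 "length a" 1] 0 by simp
      from integral_degree_below_word_eq_0[OF this \<eta> h(1)]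
      have g0: "(LINT x|lebesgue_on V. ?g x) = 0"
        using test_function_integrals(2)[OF g[OF h] V] by simp
      have diam: "norm (x - y) \<le> 2 * \<rho> * h" if xy: "?g x \<noteq> 0" "?k y \<noteq> 0" for x y
        using supp[OF \<phi> xy(1)] supp[OF \<kappa>(1) xy(2)] norm_triangle_ineq4[of "x - x\<^sub>0" "y - x\<^sub>0"] by (simp add: mult_ac)
      \<comment> \<open>A negative radius would empty \<open>U\<close> and force
        \<open>\<kappa> = 0\<close>; the sign is needed to split the power of
        \<open>2 * \<rho> * h\<close>.\<close>
      have \<rho>: "\<rho> \<ge> 0"
      proof (rule ccontr)
        assume "\<not> \<rho> \<ge> 0"
        then have "ball (0::real^2) \<rho> = {}" by (intro ball_empty) simp
        then have "U = {}" using U by blast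
        then have "\<kappa> x = 0" for x using test_functionsD(5)[OF \<kappa>(1)] by simp
        with \<kappa>(2) show False by simp
      qed
      \<comment> \<open>The weight \<open>h powr (3 + \<sigma>)\<close> balances the two terms: in
        the second, \<open>h powr (2 + 2 * \<sigma>)\<close> from the diameter and
        \<open>h powr 4\<close> from two squared norms, divided by the weight, give the same power.
        Cancelling \<open>h\<^sup>2\<close>, the scale of the integral of \<open>?k\<close>, leaves
        \<open>h powr (1 + \<sigma>)\<close>.\<close>
      have bound: "h\<^sup>2 * k0 * I \<le> h powr (3 + \<sigma>) * S + (2 * \<rho> * h) powr (2 + 2 * \<sigma>) / h powr (3 + \<sigma>) * (h\<^sup>2 * P) * (h\<^sup>2 * Q)"
        using slobodeckij_mean_bound[OF V f slob test_function_L2[OF g[OF h] V] test_function_integrals(3)[OF g[OF h] V] g0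
          test_function_L2[OF k[OF h] V] test_function_integrals(3)[OF k[OF h] V] diam, of "h powr (3 + \<sigma>)"]
          h(1) \<open>\<sigma> \<ge> 0\<close>
          test_function_integrals(1)[OF g[OF h] V] integral_square_rescale(1)[OF \<phi>c h(1)]
          test_function_integrals(1,2)[OF k[OF h] V] integral_square_rescale[OF \<kappa>c h(1)]
        by (simp add: I_def S_def P_def Q_def k0_def abs_mult)
      have powrs: "h powr (-(3 + \<sigma>)) = 1 / h powr (3 + \<sigma>)" "h powr 4 = h\<^sup>2 * h\<^sup>2"
          "(2 * \<rho> * h) powr (2 + 2 * \<sigma>) = (2 * \<rho>) powr (2 + 2 * \<sigma>) * h powr (2 + 2 * \<sigma>)"
        using h(1) \<rho> by (simp_all only: powr_minus_divide powr_mult) (simp add: powr_numeral power2_eq_square power4_eq_xxxx)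
      note bound
      also have "(2 * \<rho> * h) powr (2 + 2 * \<sigma>) / h powr (3 + \<sigma>) * (h\<^sup>2 * P) * (h\<^sup>2 * Q)
          = (2 * \<rho>) powr (2 + 2 * \<sigma>) * P * Q * (h powr (2 + 2 * \<sigma>) * h powr (-(3 + \<sigma>)) * h powr 4)"
        by (simp only: powrs) (simp add: mult_ac)
      also have "h powr (2 + 2 * \<sigma>) * h powr (-(3 + \<sigma>)) * h powr 4 = h powr (3 + \<sigma>)"
        unfolding powr_add[symmetric] by (simp add: algebra_simps)
      finally have "h\<^sup>2 * k0 * I \<le> (S + (2 * \<rho>) powr (2 + 2 * \<sigma>) * P * Q) * h powr (3 + \<sigma>)"
        by (simp add: algebra_simps)
      also have "h powr (3 + \<sigma>) = h\<^sup>2 * h powr (1 + \<sigma>)"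
        using h(1) by (simp add: powr_numeral[symmetric] powr_add[symmetric] del: powr_numeral)
      finally have "h\<^sup>2 * (k0 * I) \<le> h\<^sup>2 * ((S + (2 * \<rho>) powr (2 + 2 * \<sigma>) * P * Q) * h powr (1 + \<sigma>))"
        by (simp add: mult_ac)
      then have "k0 * I \<le> (S + (2 * \<rho>) powr (2 + 2 * \<sigma>) * P * Q) * h powr (1 + \<sigma>)"
        using h(1) by (simp add: mult_le_cancel_left)
      moreover have "k0 > 0" using \<kappa>(2) by (simp add: k0_def)
      ultimately show ?thesis by (simp add: I_def[symmetric] C_def field_simps)
    qed
    then show ?thesis by blast
  qed
next
  case (Suc m)
  obtain j b where a: "a = j # b" using Suc.prems(2) by (cases a) auto
  let ?\<psi> = "foldr partial b \<eta>"
  have \<psi>: "?\<psi> \<in> test_functions U" using \<eta> by (rule foldr_partial_test)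
  obtain g where g: "has_weak_partial V j f g" "g \<in> sobolev_aux m \<sigma> V" using Suc.prems(1) by auto
  obtain C where C: "\<And>h. 0 < h \<Longrightarrow> h \<le> h\<^sub>1 \<Longrightarrow>
      \<bar>LINT x|lebesgue_on V. g x * rescale x\<^sub>0 h ?\<psi> x\<bar> \<le> C * h powr (real m + \<sigma> + 1)"
    using Suc.IH[OF g(2), of b] Suc.prems(2) a by auto
  have "\<bar>LINT x|lebesgue_on V. f x * rescale x\<^sub>0 h (foldr partial a \<eta>) x\<bar> \<le> C * h powr (real (Suc m) + \<sigma> + 1)"
    if h: "0 < h" "h \<le> h\<^sub>1" for h
  proof -
    have "(LINT x|lebesgue_on V. f x * rescale x\<^sub>0 h (foldr partial a \<eta>) x)
        = (LINT x|lebesgue_on V. h * (f x * partial j (rescale x\<^sub>0 h ?\<psi>) x))"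
      by (simp add: a rescale_partial[OF \<psi> h(1)] mult_ac)
    also have "\<dots> = - h * (LINT x|lebesgue_on V. g x * rescale x\<^sub>0 h ?\<psi> x)"
      using g(1) test_functions_rescale[OF \<psi> h(1) scale[OF h]] by (simp add: has_weak_partial_def)
    finally have "\<bar>LINT x|lebesgue_on V. f x * rescale x\<^sub>0 h (foldr partial a \<eta>) x\<bar>
        = h * \<bar>LINT x|lebesgue_on V. g x * rescale x\<^sub>0 h ?\<psi> x\<bar>"
      using h(1) by (simp add: abs_mult)
    also have "\<dots> \<le> h * (C * h powr (real m + \<sigma> + 1))" using C[OF h] h(1) by (intro mult_left_mono) auto
    also have "\<dots> = C * h powr (real (Suc m) + \<sigma> + 1)"
      using h(1) powr_add[of h 1 "real m + \<sigma> + 1"] by (simp add: algebra_simps)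
    finally show ?thesis .
  qed
  then show ?case by blast
qed

section \<open>The singular function\<close>

text \<open>Rotates the bisector of the sector onto the positive real axis, so that the branch cut of \<open>Arg\<close>
  lies outside the open sector even for \<open>\<omega> = 2 * pi\<close>.\<close>

definition sector_rotation :: "real \<Rightarrow> real \<Rightarrow> real^2 \<Rightarrow> complex" where
  "sector_rotation \<alpha> \<omega> y = cis (- (\<alpha> + \<omega> / 2)) * Complex (y $ 1) (y $ 2)"

section \<open>Polar coordinates and the angle as a continuous function\<close>

lemma polar_0: "polar 0 r \<theta> $ 1 = r * cos \<theta>" "polar 0 r \<theta> $ 2 = r * sin \<theta>"
  by (simp_all add: polar_def)

lemma polar_shift: "x\<^sub>0 + h *\<^sub>R polar 0 r \<theta> = polar x\<^sub>0 (h * r) \<theta>"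
  by (simp add: polar_def)

lemma sectorI: "0 < r \<Longrightarrow> \<alpha> < \<theta> \<Longrightarrow> \<theta> < \<alpha> + \<omega> \<Longrightarrow> polar x\<^sub>0 r \<theta> \<in> sector x\<^sub>0 \<alpha> \<omega>"
  unfolding sector_def by blast

lemma norm_polar_0: "r \<ge> 0 \<Longrightarrow> norm (polar 0 r \<theta>) = r"
proof -
  assume "r \<ge> 0"
  have "(r * cos \<theta>)\<^sup>2 + (r * sin \<theta>)\<^sup>2 = r\<^sup>2"
    by (simp add: power_mult_distrib flip: distrib_left)
  with \<open>r \<ge> 0\<close> show ?thesis
    by (simp add: norm_vec_def L2_set_def sum_2 polar_0)
qed

lemma sector_rotation_polar: "sector_rotation \<alpha> \<omega> (polar 0 r \<theta>) = rcis r (\<theta> - (\<alpha> + \<omega> / 2))"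
proof -
  have "Complex (r * cos \<theta>) (r * sin \<theta>) = rcis r \<theta>" by (simp add: complex_eq_iff)
  moreover have "- (\<alpha> + \<omega> / 2) + \<theta> = \<theta> - (\<alpha> + \<omega> / 2)" by simp
  ultimately show ?thesis
    unfolding sector_rotation_def polar_0 by (simp only: rcis_def cis_mult mult.left_commute)
qed

text \<open>The parametric form of the sector hides its topology; through \<open>Arg\<close> it
  becomes a preimage, from which openness and continuity of the angle follow.\<close>

lemma sector_0_eq:
  assumes "0 < \<omega>" "\<omega> \<le> 2 * pi"
  shows "sector 0 \<alpha> \<omega> = {y. sector_rotation \<alpha> \<omega> y \<notin> \<real>\<^sub>\<le>\<^sub>0 \<and> \<bar>Arg (sector_rotation \<alpha> \<omega> y)\<bar> < \<omega> / 2}"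
    and "\<And>r \<theta>. 0 < r \<Longrightarrow> \<alpha> < \<theta> \<Longrightarrow> \<theta> < \<alpha> + \<omega> \<Longrightarrow> Arg (sector_rotation \<alpha> \<omega> (polar 0 r \<theta>)) = \<theta> - (\<alpha> + \<omega> / 2)"
proof -
  show ang: "Arg (sector_rotation \<alpha> \<omega> (polar 0 r \<theta>)) = \<theta> - (\<alpha> + \<omega> / 2)"
    if "0 < r" "\<alpha> < \<theta>" "\<theta> < \<alpha> + \<omega>" for r \<theta>
    using that assms by (simp add: sector_rotation_polar Arg_rcis)
  show "sector 0 \<alpha> \<omega> = {y. sector_rotation \<alpha> \<omega> y \<notin> \<real>\<^sub>\<le>\<^sub>0 \<and> \<bar>Arg (sector_rotation \<alpha> \<omega> y)\<bar> < \<omega> / 2}"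
  proof (intro equalityI subsetI CollectI)
    fix y assume "y \<in> sector 0 \<alpha> \<omega>"
    then obtain r \<theta> where y: "y = polar 0 r \<theta>" and r: "0 < r" "\<alpha> < \<theta>" "\<theta> < \<alpha> + \<omega>"
      by (auto simp: sector_def)
    have A: "Arg (sector_rotation \<alpha> \<omega> y) = \<theta> - (\<alpha> + \<omega> / 2)" using ang[OF r] y by simp
    have "sector_rotation \<alpha> \<omega> y \<noteq> 0" using r(1) by (simp add: y sector_rotation_polar)
    \<comment> \<open>The rotated angle is strictly below \<open>\<omega> / 2\<close>, which is at
      most \<open>pi\<close>, so it misses the value of \<open>Arg\<close> on the cut.\<close>
    moreover have "Arg (sector_rotation \<alpha> \<omega> y) \<noteq> pi" using A r assms by auto
    ultimately have "sector_rotation \<alpha> \<omega> y \<notin> \<real>\<^sub>\<le>\<^sub>0"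
      by (auto simp: complex_nonpos_Reals_iff Arg_eq_pi complex_eq_iff)
    moreover have "\<bar>\<theta> - (\<alpha> + \<omega> / 2)\<bar> < \<omega> / 2" using r by (simp only: abs_less_iff) argo
    ultimately show "sector_rotation \<alpha> \<omega> y \<notin> \<real>\<^sub>\<le>\<^sub>0 \<and> \<bar>Arg (sector_rotation \<alpha> \<omega> y)\<bar> < \<omega> / 2" using A by simp
  next
    fix y assume "y \<in> {y. sector_rotation \<alpha> \<omega> y \<notin> \<real>\<^sub>\<le>\<^sub>0 \<and> \<bar>Arg (sector_rotation \<alpha> \<omega> y)\<bar> < \<omega> / 2}"
    then have y: "sector_rotation \<alpha> \<omega> y \<noteq> 0" "\<bar>Arg (sector_rotation \<alpha> \<omega> y)\<bar> < \<omega> / 2" by auto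
    define z where "z = sector_rotation \<alpha> \<omega> y"
    have "Complex (y $ 1) (y $ 2) = cis (\<alpha> + \<omega> / 2) * z"
      by (simp add: z_def sector_rotation_def mult.assoc[symmetric] cis_mult)
    also have "z = rcis (cmod z) (Arg z)" by (simp add: rcis_cmod_Arg)
    also have "cis (\<alpha> + \<omega> / 2) * rcis (cmod z) (Arg z) = rcis (cmod z) (\<alpha> + \<omega> / 2 + Arg z)"
      by (simp add: rcis_def cis_mult mult.left_commute)
    finally have "y = polar 0 (cmod z) (\<alpha> + \<omega> / 2 + Arg z)"
      by (simp add: complex_eq_iff vec_eq_iff forall_2 polar_0)
    moreover have "0 < cmod z" "\<alpha> < \<alpha> + \<omega> / 2 + Arg z" "\<alpha> + \<omega> / 2 + Arg z < \<alpha> + \<omega>"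
      using y unfolding z_def[symmetric] by (simp, argo, argo)
    ultimately show "y \<in> sector 0 \<alpha> \<omega>" using sectorI by metis
  qed
qed

lemma sector_rotation_continuous: "continuous_on S (sector_rotation \<alpha> \<omega>)"
  unfolding sector_rotation_def Complex_eq by (intro continuous_intros)

lemma open_sector_0:
  assumes "0 < \<omega>" "\<omega> \<le> 2 * pi"
  shows "open (sector 0 \<alpha> \<omega>)"
proof -
  have "open {y. sector_rotation \<alpha> \<omega> y \<in> - \<real>\<^sub>\<le>\<^sub>0}"
    using open_vimage[of "- \<real>\<^sub>\<le>\<^sub>0" "sector_rotation \<alpha> \<omega>"] sector_rotation_continuous
    by (simp add: vimage_def open_Compl)
  moreover have "continuous_on {y. sector_rotation \<alpha> \<omega> y \<in> - \<real>\<^sub>\<le>\<^sub>0} (\<lambda>y. Arg (sector_rotation \<alpha> \<omega> y))"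
    by (intro continuous_on_compose2[OF continuous_on_Arg sector_rotation_continuous]) auto
  ultimately have "open ({y. sector_rotation \<alpha> \<omega> y \<in> - \<real>\<^sub>\<le>\<^sub>0} \<inter> (\<lambda>y. Arg (sector_rotation \<alpha> \<omega> y)) -` {- (\<omega>/2)<..<\<omega>/2})"
    by (intro continuous_open_preimage) auto
  also have "\<dots> = sector 0 \<alpha> \<omega>"
    unfolding sector_0_eq(1)[OF assms] by (auto simp: abs_less_iff)
  finally show ?thesis .
qed

text \<open>Extension by \<open>0\<close> outside the open sector keeps homogeneity, because the
  sector is a cone, and gives a Borel function on the plane. Compactness of the closed angular
  interval supplies \<open>C\<close>.\<close>

lemma singular_function_exists:
  assumes "0 < \<omega>" "\<omega> \<le> 2 * pi" "continuous_on {\<alpha>..\<alpha> + \<omega>} f"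
  obtains s :: "real^2 \<Rightarrow> real" and C where
    "s \<in> borel_measurable borel" "continuous_on (sector 0 \<alpha> \<omega>) s"
    "\<And>t x. t > 0 \<Longrightarrow> s (t *\<^sub>R x) = t powr lam * s x"
    "C \<ge> 0" "\<And>x. \<bar>s x\<bar> \<le> C * norm x powr lam"
    "\<And>r \<theta>. 0 < r \<Longrightarrow> \<alpha> < \<theta> \<Longrightarrow> \<theta> < \<alpha> + \<omega> \<Longrightarrow> s (polar 0 r \<theta>) = r powr lam * f \<theta>"
proof -
  let ?S = "sector 0 \<alpha> \<omega>"
  define p where "p y = norm y powr lam * f (\<alpha> + \<omega> / 2 + Arg (sector_rotation \<alpha> \<omega> y))" for y :: "real^2"
  define s where "s y = indicator ?S y *\<^sub>R p y" for y
  have val: "s (polar 0 r \<theta>) = r powr lam * f \<theta>" if r: "0 < r" "\<alpha> < \<theta>" "\<theta> < \<alpha> + \<omega>" for r \<theta>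
  proof -
    have "polar 0 r \<theta> \<in> ?S" using r by (auto simp: sector_def)
    then show ?thesis using r by (simp add: s_def p_def norm_polar_0 sector_0_eq(2)[OF assms(1,2)])
  qed
  have not0: "y \<noteq> 0" if y: "y \<in> ?S" for y
  proof -
    obtain r \<theta> where "0 < r" "y = polar 0 r \<theta>" using y by (auto simp: sector_def)
    then show ?thesis using norm_polar_0[of r \<theta>] by auto
  qed
  have Arg_c: "continuous_on ?S (\<lambda>y. \<alpha> + \<omega> / 2 + Arg (sector_rotation \<alpha> \<omega> y))"
    by (intro continuous_intros continuous_on_compose2[OF continuous_on_Arg sector_rotation_continuous])
       (auto simp: sector_0_eq(1)[OF assms(1,2)])
  have "continuous_on ?S (\<lambda>y. f (\<alpha> + \<omega> / 2 + Arg (sector_rotation \<alpha> \<omega> y)))"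
    by (rule continuous_on_compose2[OF assms(3) Arg_c])
       (auto simp: sector_0_eq(1)[OF assms(1,2)] abs_less_iff)
  then have p_c: "continuous_on ?S p"
    unfolding p_def using not0 by (intro continuous_intros) auto
  have s_meas: "s \<in> borel_measurable borel"
    unfolding s_def[abs_def] using p_c open_sector_0[OF assms(1,2)]
    by (intro borel_measurable_continuous_on_indicator) auto
  have s_c: "continuous_on ?S s"
    by (rule continuous_on_eq[OF p_c]) (simp add: s_def)
  have scale: "t *\<^sub>R y \<in> ?S" if ty: "t > 0" "y \<in> ?S" for t y
  proof -
    obtain r \<theta> where "y = polar 0 r \<theta>" "0 < r" "\<alpha> < \<theta>" "\<theta> < \<alpha> + \<omega>" using ty(2) by (auto simp: sector_def)
    then show ?thesis using ty(1) polar_shift[of 0 t r \<theta>] sectorI[of "t * r" \<alpha> \<theta> \<omega> 0] by simp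
  qed
  have hom: "s (t *\<^sub>R x) = t powr lam * s x" if "t > 0" for t x
  proof (cases "x \<in> ?S")
    case True
    then obtain r \<theta> where x: "x = polar 0 r \<theta>" and r: "0 < r" "\<alpha> < \<theta>" "\<theta> < \<alpha> + \<omega>" by (auto simp: sector_def)
    have "s (t *\<^sub>R x) = (t * r) powr lam * f \<theta>"
      using val[of "t * r" \<theta>] r that polar_shift[of 0 t r \<theta>] by (simp add: x)
    then show ?thesis using val[OF r] r that by (simp add: x powr_mult)
  next
    case False
    then have "t *\<^sub>R x \<notin> ?S" using scale[of "1 / t" "t *\<^sub>R x"] that by auto
    with False show ?thesis by (simp add: s_def)
  qed
  have "compact (f ` {\<alpha>..\<alpha> + \<omega>})" by (intro compact_continuous_image assms(3)) auto
  then obtain C where C: "C > 0" "\<And>\<theta>. \<theta> \<in> {\<alpha>..\<alpha> + \<omega>} \<Longrightarrow> \<bar>f \<theta>\<bar> \<le> C"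
    using compact_imp_bounded bounded_pos by (metis imageI real_norm_def)
  have bnd: "\<bar>s x\<bar> \<le> C * norm x powr lam" for x
  proof (cases "x \<in> ?S")
    case True
    then obtain r \<theta> where x: "x = polar 0 r \<theta>" and r: "0 < r" "\<alpha> < \<theta>" "\<theta> < \<alpha> + \<omega>" by (auto simp: sector_def)
    then show ?thesis using val[OF r] C(2)[of \<theta>] by (simp add: norm_polar_0 abs_mult mult.commute)
  next
    case False
    then show ?thesis using C(1) by (simp add: s_def)
  qed
  show ?thesis using that[OF s_meas s_c hom _ bnd val] C(1) by simp
qed

text \<open>Near \<open>z\<close> the function \<open>s\<close> keeps its sign and stays above half
  of its modulus at \<open>z\<close>, so a nonnegative bump there cannot integrate it to
  \<open>0\<close>. The integral of \<open>\<zeta>\<close> itself is recorded because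
  \<open>\<zeta>\<close> later serves as the averaging weight.\<close>

lemma bump_integral_nonzero:
  fixes s :: "real^2 \<Rightarrow> real"
  assumes "open U" "z \<in> U" "continuous_on U s" "s \<in> borel_measurable borel" "s z \<noteq> 0"
  obtains \<zeta> where "\<zeta> \<in> tensor_tests U" "(LINT x|lebesgue. \<zeta> x) \<noteq> 0" "(LINT x|lebesgue. s x * \<zeta> x) \<noteq> 0"
proof -
  have "isCont s z" using assms(1-3) continuous_on_eq_continuous_at by blast
  then obtain e1 where e1: "e1 > 0" "\<And>x. dist x z < e1 \<Longrightarrow> \<bar>s x - s z\<bar> < \<bar>s z\<bar> / 2"
    using assms(5) unfolding continuous_at_eps_delta dist_real_def
    by (metis dist_real_def half_gt_zero zero_less_abs_iff)
  obtain e2 where e2: "e2 > 0" "ball z e2 \<subseteq> U" using assms(1,2) open_contains_ball by blast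
  define e where "e = min e1 e2"
  \<comment> \<open>The support is a closed square of half side \<open>\<delta>\<close>; its points
    are within \<open>2 * \<delta> = e / 2\<close> of \<open>z\<close>, hence inside the open ball
    of radius \<open>e\<close>.\<close>
  define \<delta> where "\<delta> = e / 4"
  have pos: "e > 0" "\<delta> > 0" using e1 e2 by (auto simp: e_def \<delta>_def)
  define \<zeta> where "\<zeta> = tensor (bump1 (z $ 1) \<delta>) (bump1 (z $ 2) \<delta>)"
  define B where "B = {x :: real^2. \<bar>x $ 1 - z $ 1\<bar> < \<delta> \<and> \<bar>x $ 2 - z $ 2\<bar> < \<delta>}"
  define D where "D = {x :: real^2. \<bar>x $ 1 - z $ 1\<bar> \<le> \<delta> \<and> \<bar>x $ 2 - z $ 2\<bar> \<le> \<delta>}"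
  have \<zeta>: "\<zeta> x \<ge> 0" "\<zeta> x > 0 \<longleftrightarrow> x \<in> B" for x
    using bump1(2,3)[of "z $ 1" \<delta> "x $ 1"] bump1(2,3)[of "z $ 2" \<delta> "x $ 2"]
    by (auto simp: \<zeta>_def tensor_def B_def zero_less_mult_iff)
  have nz: "\<zeta> x \<noteq> 0 \<longleftrightarrow> x \<in> B" for x using \<zeta>[of x] by linarith
  have "closed D" unfolding D_def
    by (intro closed_Collect_conj closed_Collect_le continuous_intros)
  have "open B" unfolding B_def
    by (intro open_Collect_conj open_Collect_less continuous_intros)
  have "z \<in> B" using pos by (simp add: B_def)
  have D: "D \<subseteq> ball z e"
  proof
    fix x assume x: "x \<in> D"
    have "norm (x - z) \<le> \<bar>(x - z) $ 1\<bar> + \<bar>(x - z) $ 2\<bar>"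
      using norm_le_l1_cart[of "x - z"] by (simp add: sum_2)
    also have "\<dots> < e" using x pos by (simp add: D_def \<delta>_def)
    finally show "x \<in> ball z e" by (simp add: dist_norm norm_minus_commute)
  qed
  have cl: "closure {x. \<zeta> x \<noteq> 0} \<subseteq> D"
    using \<open>closed D\<close> by (intro closure_minimal) (auto simp: nz B_def D_def)
  have "bounded D" using D bounded_subset bounded_ball by blast
  then have "compact (closure {x. \<zeta> x \<noteq> 0})"
    using cl bounded_subset compact_eq_bounded_closed closed_closure by blast
  moreover have "D \<subseteq> U" using D e2(2) by (force simp: e_def)
  moreover have "C_k k \<zeta>" for k unfolding \<zeta>_def by (intro C_k_tensor bump1)
  ultimately have t: "\<zeta> \<in> test_functions U" using cl by (auto simp: test_functions_def)
  then have tt: "\<zeta> \<in> tensor_tests U" using bump1(1) by (auto simp: tensor_tests_def \<zeta>_def)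
  obtain M where M: "\<And>x. \<bar>\<zeta> x\<bar> \<le> M"
    using continuous_compact_support_bounded[OF test_functionsD(2)[OF t], of "{x. \<zeta> x \<noteq> 0}"]
      test_functions_support_bounded[OF t] by blast
  have \<zeta>_int: "integrable lebesgue \<zeta>"
    using integrable_mult_test[OF t, of "\<lambda>_. 1"] by simp
  have "\<not> (AE x in lebesgue. \<zeta> x = 0)"
  proof
    assume "AE x in lebesgue. \<zeta> x = 0"
    moreover have eq: "{x \<in> space lebesgue. \<not> \<zeta> x = 0} = B" using nz by auto
    moreover have "B \<in> sets lebesgue" using \<open>open B\<close> by simp
    ultimately have "B \<in> null_sets lebesgue"
      using AE_iff_null[of lebesgue "\<lambda>x. \<zeta> x = 0"] by simp
    then have "negligible B" by (simp add: negligible_iff_null_sets)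
    then show False using open_not_negligible \<open>open B\<close> \<open>z \<in> B\<close> by blast
  qed
  then have "(LINT x|lebesgue. \<zeta> x) \<noteq> 0"
    using integral_nonneg_eq_0_iff_AE[OF \<zeta>_int] \<zeta>(1) by simp
  moreover have "(LINT x|lebesgue. \<zeta> x) \<ge> 0" using \<zeta>(1) by simp
  ultimately have \<zeta>pos: "(LINT x|lebesgue. \<zeta> x) > 0" by simp
  have close: "\<bar>s x - s z\<bar> < \<bar>s z\<bar> / 2" if "\<zeta> x \<noteq> 0" for x
  proof -
    have "x \<in> ball z e" using that nz D by (auto simp: B_def D_def subset_iff)
    then show ?thesis using e1(2)[of x] by (simp add: e_def dist_commute)
  qed
  have s\<zeta>_int: "integrable lebesgue (\<lambda>x. s x * \<zeta> x)"
  proof (rule integrable_bounded_support)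
    have "\<zeta> \<in> borel_measurable borel" using test_functionsD(2)[OF t] by (rule borel_measurable_continuous_onI)
    then show "(\<lambda>x. s x * \<zeta> x) \<in> borel_measurable lebesgue"
      using assms(4) by (intro measurable_completion) simp
    show "\<bar>s x * \<zeta> x\<bar> \<le> (3 / 2 * \<bar>s z\<bar>) * M" for x
    proof (cases "\<zeta> x = 0")
      case True
      then show ?thesis using M[of x] by simp
    next
      case False
      then have "\<bar>s x\<bar> \<le> 3 / 2 * \<bar>s z\<bar>" using close[of x] by linarith
      then show ?thesis unfolding abs_mult by (intro mult_mono M) auto
    qed
    show "s x * \<zeta> x = 0" if "x \<notin> {x. \<zeta> x \<noteq> 0}" for x using that by simp
    show "bounded {x. \<zeta> x \<noteq> 0}" by (rule test_functions_support_bounded[OF t])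
  qed
  have "0 < (LINT x|lebesgue. \<bar>s z\<bar> / 2 * \<zeta> x)" using \<zeta>pos assms(5) by simp
  also have "\<dots> \<le> (LINT x|lebesgue. sgn (s z) * (s x * \<zeta> x))"
  proof (rule integral_mono)
    show "\<bar>s z\<bar> / 2 * \<zeta> x \<le> sgn (s z) * (s x * \<zeta> x)" for x
    proof (cases "\<zeta> x = 0")
      case False
      have "\<bar>s z\<bar> / 2 \<le> sgn (s z) * s x" using close[OF False] assms(5) by (auto simp: sgn_if abs_if split: if_splits)
      from mult_right_mono[OF this \<zeta>(1)[of x]] show ?thesis by (simp only: mult.assoc)
    qed simp
  qed (use \<zeta>_int s\<zeta>_int in auto)
  finally have "(LINT x|lebesgue. s x * \<zeta> x) \<noteq> 0" by auto
  with tt \<zeta>pos show ?thesis using that by force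
qed

section \<open>The lower bound\<close>

text \<open>The three parts live on different sets, but the scaled test function is supported in the
  scaled copy of \<open>U\<close>, where the expansion holds almost everywhere, so all integrals can
  be taken over the plane. There the polynomial drops out and homogeneity turns dilation into
  \<open>h powr (2 + lam)\<close>.\<close>

lemma integral_test_corner_expansion:
  fixes s e w q :: "real^2 \<Rightarrow> real"
  assumes V: "V \<in> lmeasurable" and \<Omega>: "\<Omega> \<in> lmeasurable"
    and s: "s \<in> borel_measurable borel" "\<And>t x. t > 0 \<Longrightarrow> s (t *\<^sub>R x) = t powr lam * s x"
      "\<And>x. \<bar>s x\<bar> \<le> C * norm x powr lam" "C \<ge> 0" "lam > 0"
    and \<xi>: "\<xi> \<in> test_functions U" and "h > 0"
    and sub: "(\<lambda>y. x\<^sub>0 + h *\<^sub>R y) ` U \<subseteq> \<Omega>" "(\<lambda>y. x\<^sub>0 + h *\<^sub>R y) ` U \<subseteq> V"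
    and w: "w \<in> L2 V" and e: "e \<in> L2 \<Omega>"
    and q: "continuous_on UNIV q" "(LINT x|lebesgue. q x * rescale x\<^sub>0 h \<xi> x) = 0"
    and eq: "AE x in lebesgue. x \<in> (\<lambda>y. x\<^sub>0 + h *\<^sub>R y) ` U \<longrightarrow> e x = \<Lambda> * s (x - x\<^sub>0) + w x - q x"
  shows "(LINT x|lebesgue_on \<Omega>. e x * rescale x\<^sub>0 h \<xi> x)
    = \<Lambda> * (h powr (2 + lam) * (LINT x|lebesgue. s x * \<xi> x)) + (LINT x|lebesgue_on V. w x * rescale x\<^sub>0 h \<xi> x)"
proof -
  let ?g = "rescale x\<^sub>0 h \<xi>"
  have gU: "?g \<in> test_functions ((\<lambda>y. x\<^sub>0 + h *\<^sub>R y) ` U)"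
    by (rule test_functions_rescale[OF \<xi> \<open>h > 0\<close>]) simp
  have g\<Omega>: "?g \<in> test_functions \<Omega>" and gV: "?g \<in> test_functions V"
    by (rule test_functions_rescale[OF \<xi> \<open>h > 0\<close>], fact)+
  have sets: "\<Omega> \<in> sets lebesgue" "V \<in> sets lebesgue" using V \<Omega> by auto
  have off: "e x * ?g x = 0" if "x \<notin> \<Omega>" for x using test_functionsD(5)[OF g\<Omega> that] by simp
  have offV: "w x * ?g x = 0" if "x \<notin> V" for x using test_functionsD(5)[OF gV that] by simp
  have ext: "(\<lambda>x. if x \<in> A then k x else 0) = k" if "\<And>x. x \<notin> A \<Longrightarrow> k x = 0" for A and k :: "real^2 \<Rightarrow> real"
    using that by auto
  \<comment> \<open>\<open>e\<close> is measurable on \<open>\<Omega>\<close> only; the product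
    vanishes outside, which makes it measurable on the plane.\<close>
  have e_meas: "(\<lambda>x. e x * ?g x) \<in> borel_measurable lebesgue"
    using borel_measurable_if_I[of "\<lambda>x. e x * ?g x" \<Omega>] sets L2_mult_integrable[OF e test_function_L2[OF g\<Omega> \<Omega>]]
    by (simp add: ext off del: mult_eq_0_iff)
  have k1: "integrable lebesgue (\<lambda>x. s (x - x\<^sub>0) * ?g x)"
    by (rule integrable_growth[OF s(1,3,4,5) test_functionsD(2)[OF gU] test_functions_support_bounded[OF gU]])
  have k2: "integrable lebesgue (\<lambda>x. w x * ?g x)"
  proof -
    have "integrable (lebesgue_on V) (\<lambda>x. w x * ?g x)"
      by (rule L2_mult_integrable[OF w test_function_L2[OF gV V]])
    then have "integrable lebesgue (\<lambda>x. indicator V x *\<^sub>R (w x * ?g x))"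
      using sets(2) by (simp add: integrable_restrict_space)
    also have "(\<lambda>x. indicator V x *\<^sub>R (w x * ?g x)) = (\<lambda>x. w x * ?g x)"
      using offV by (auto simp: fun_eq_iff indicator_def simp del: mult_eq_0_iff)
    finally show ?thesis .
  qed
  have k3: "integrable lebesgue (\<lambda>x. q x * ?g x)" by (rule integrable_mult_test[OF gU q(1)])
  have "(LINT x|lebesgue_on \<Omega>. e x * ?g x) = (LINT x|lebesgue. e x * ?g x)"
    by (rule integral_lebesgue_on_support[OF sets(1) off])
  also have "\<dots> = (LINT x|lebesgue. \<Lambda> * (s (x - x\<^sub>0) * ?g x) + w x * ?g x - q x * ?g x)"
  proof (rule integral_cong_AE[OF e_meas])
    show "(\<lambda>x. \<Lambda> * (s (x - x\<^sub>0) * ?g x) + w x * ?g x - q x * ?g x) \<in> borel_measurable lebesgue"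
      by (intro borel_measurable_integrable Bochner_Integration.integrable_diff Bochner_Integration.integrable_add
          integrable_mult_right k1 k2 k3)
    show "AE x in lebesgue. e x * ?g x = \<Lambda> * (s (x - x\<^sub>0) * ?g x) + w x * ?g x - q x * ?g x"
      using eq
    proof (rule AE_mp, intro AE_I2 impI)
      fix x assume x: "x \<in> (\<lambda>y. x\<^sub>0 + h *\<^sub>R y) ` U \<longrightarrow> e x = \<Lambda> * s (x - x\<^sub>0) + w x - q x"
      show "e x * ?g x = \<Lambda> * (s (x - x\<^sub>0) * ?g x) + w x * ?g x - q x * ?g x"
      proof (cases "x \<in> (\<lambda>y. x\<^sub>0 + h *\<^sub>R y) ` U")
        case True
        with x have "e x = \<Lambda> * s (x - x\<^sub>0) + w x - q x" by blast
        then show ?thesis by (simp only: left_diff_distrib distrib_right mult.assoc)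
      next
        case False
        then show ?thesis using test_functionsD(5)[OF gU] by simp
      qed
    qed
  qed
  also have "\<dots> = \<Lambda> * (LINT x|lebesgue. s (x - x\<^sub>0) * ?g x) + (LINT x|lebesgue. w x * ?g x)"
    using k1 k2 k3 q(2) by simp
  also have "(LINT x|lebesgue. s (x - x\<^sub>0) * ?g x) = h powr (2 + lam) * (LINT x|lebesgue. s x * \<xi> x)"
    using integral_rescale[OF s(1) \<open>h > 0\<close> test_functionsD(2)[OF \<xi>], of x\<^sub>0] \<open>h > 0\<close>
    by (simp add: s(2) powr_add mult.assoc)
  also have "(LINT x|lebesgue. w x * ?g x) = (LINT x|lebesgue_on V. w x * ?g x)"
    by (rule integral_lebesgue_on_support[OF sets(2) offV, symmetric])
  finally show ?thesis .
qed

text \<open>One entry of the weak gradient is dominated by the full norm; the existence assumption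
  is what makes the chosen \<open>weak_partial\<close> an actual weak derivative.\<close>

lemma grad_L2_norm_test_bound:
  assumes \<Omega>: "\<Omega> \<in> lmeasurable" and wp: "\<And>i j. \<exists>g. has_weak_partial \<Omega> j (\<lambda>x. v x $ i) g"
    and \<psi>: "\<psi> \<in> test_functions \<Omega>"
  shows "\<bar>LINT x|lebesgue_on \<Omega>. v x $ i * partial j \<psi> x\<bar> \<le> grad_L2_norm \<Omega> v * sqrt (LINT x|lebesgue. (\<psi> x)\<^sup>2)"
proof -
  define G where "G i j = weak_partial \<Omega> j (\<lambda>x. v x $ i)" for i j
  have G: "has_weak_partial \<Omega> j (\<lambda>x. v x $ i) (G i j)" for i j
    unfolding G_def weak_partial_def using wp by (rule someI_ex)
  then have GL: "G i j \<in> L2 \<Omega>" for i j by (simp add: has_weak_partial_def)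
  have "\<bar>LINT x|lebesgue_on \<Omega>. v x $ i * partial j \<psi> x\<bar> = \<bar>LINT x|lebesgue_on \<Omega>. G i j x * \<psi> x\<bar>"
    using G[of j i] \<psi> by (simp add: has_weak_partial_def)
  also have "\<dots> \<le> sqrt (LINT x|lebesgue_on \<Omega>. (G i j x)\<^sup>2) * sqrt (LINT x|lebesgue_on \<Omega>. (\<psi> x)\<^sup>2)"
    by (rule L2_Cauchy_Schwarz[OF GL test_function_L2[OF \<psi> \<Omega>]])
  also have "(LINT x|lebesgue_on \<Omega>. (\<psi> x)\<^sup>2) = (LINT x|lebesgue. (\<psi> x)\<^sup>2)"
    by (rule test_function_integrals(1)[OF \<psi> \<Omega>])
  also have "sqrt (LINT x|lebesgue_on \<Omega>. (G i j x)\<^sup>2) \<le> grad_L2_norm \<Omega> v"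
    unfolding grad_L2_norm_def G_def[symmetric]
  proof (intro real_sqrt_le_mono integral_mono)
    show "integrable (lebesgue_on \<Omega>) (\<lambda>x. (G i j x)\<^sup>2)" using GL by (simp add: L2_def)
    show "integrable (lebesgue_on \<Omega>) (\<lambda>x. \<Sum>i\<in>UNIV. \<Sum>j\<in>UNIV. (G i j x)\<^sup>2)"
      using GL by (intro Bochner_Integration.integrable_sum) (simp add: L2_def)
    show "(G i j x)\<^sup>2 \<le> (\<Sum>i\<in>UNIV. \<Sum>j\<in>UNIV. (G i j x)\<^sup>2)" for x
    proof -
      have "(G i j x)\<^sup>2 \<le> (\<Sum>j\<in>UNIV. (G i j x)\<^sup>2)" by (rule member_le_sum) auto
      also have "\<dots> \<le> (\<Sum>i\<in>UNIV. \<Sum>j\<in>UNIV. (G i j x)\<^sup>2)"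
        by (rule member_le_sum[where f = "\<lambda>i. \<Sum>j\<in>UNIV. (G i j x)\<^sup>2"]) (auto intro: sum_nonneg)
      finally show ?thesis .
    qed
  qed
  finally show ?thesis by (simp add: mult_right_mono)
qed

lemma sobolev_aux_L2: "f \<in> sobolev_aux m \<sigma> V \<Longrightarrow> f \<in> L2 V"
  by (cases m) auto

text \<open>A ball is connected: meeting both \<open>K\<close> and its complement, it would contain
  a frontier point nearer than \<open>r\<close>.\<close>

lemma ball_subset_of_infdist_frontier:
  fixes x :: "'a::real_normed_vector"
  assumes "x \<in> K" "r \<le> infdist x (frontier K)"
  shows "ball x r \<subseteq> K"
proof (rule ccontr)
  assume "\<not> ball x r \<subseteq> K"
  then obtain y where y: "y \<in> ball x r" "y \<notin> K" by blast
  then have "dist x y < r" by simp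
  then have "0 < r" by (rule le_less_trans[OF zero_le_dist])
  then have "ball x r \<inter> frontier K \<noteq> {}"
    using y assms(1) centre_in_ball[of x r]
    by (intro connected_Int_frontier connected_ball) blast+
  then obtain z where "z \<in> frontier K" "dist x z < r" by auto
  with infdist_le[of z "frontier K" x] assms(2) show False by simp
qed

theorem proposition2:
  fixes \<Omega> :: "(real^2) set" and x\<^sub>0 :: "real^2" and \<alpha> \<omega> :: real
    and \<Phi> :: "real \<Rightarrow> real^2" and \<Lambda> lam \<epsilon> \<rho> :: real and p :: nat
    and u w :: "real^2 \<Rightarrow> real^2"
    and \<F> :: "(real^2) set set set"
  assumes "open \<Omega>" and "connected \<Omega>" and "bounded \<Omega>"
    and "corner_at \<Omega> x\<^sub>0 \<alpha> \<omega>"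
    and "smooth_on_interval \<alpha> (\<alpha> + \<omega>) \<Phi>" and "\<exists>\<theta>\<in>{\<alpha>..\<alpha> + \<omega>}. \<Phi> \<theta> \<noteq> 0"
    and "p \<ge> 1"
    and "\<And>\<T>. \<T> \<in> \<F> \<Longrightarrow> cartesian_mesh \<T>" and "\<And>\<T>. \<T> \<in> \<F> \<Longrightarrow> \<Omega> \<subseteq> \<Union>\<T>"
    and "quasi_uniform \<F>"
    and "u \<in> sobolev_vec 1 \<Omega>"
    and "corner_expansion \<Omega> x\<^sub>0 \<alpha> \<omega> \<Lambda> lam \<Phi> \<epsilon> u w"
    and "\<epsilon> > 0" and "\<Lambda> \<noteq> 0" and "lam \<notin> \<nat>" and "0 < lam" and "lam < real p"
    and "\<rho> > 0"
    and "\<And>\<T>. \<T> \<in> \<F> \<Longrightarrow> \<exists>K\<in>active_mesh \<Omega> \<T>.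
           x\<^sub>0 \<in> interior K \<and> infdist x\<^sub>0 (frontier K) \<ge> \<rho> * mesh_size \<T>"
  shows "\<exists>c>0. \<exists>h\<^sub>1>0. \<forall>\<T>\<in>\<F>. mesh_size \<T> \<le> h\<^sub>1 \<longrightarrow>
           (\<forall>u\<^sub>h\<in>fe_space \<Omega> \<T> p.
              grad_L2_norm \<Omega> (\<lambda>x. u x - u\<^sub>h x) \<ge> c * \<bar>\<Lambda>\<bar> * mesh_size \<T> powr lam)"
proof -
  obtain R1 where \<omega>: "0 < \<omega>" "\<omega> \<le> 2 * pi" and R1: "R1 > 0" "\<Omega> \<inter> ball x\<^sub>0 R1 = sector x\<^sub>0 \<alpha> \<omega> \<inter> ball x\<^sub>0 R1"
    using assms(4) unfolding corner_at_def by blast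
  obtain R2 where R2: "R2 > 0" "w \<in> sobolev_vec (1 + lam + \<epsilon>) (\<Omega> \<inter> ball x\<^sub>0 R2)"
    and expansion: "AE x in lebesgue_on (\<Omega> \<inter> ball x\<^sub>0 R2).
           \<forall>r \<theta>. 0 < r \<and> \<alpha> < \<theta> \<and> \<theta> < \<alpha> + \<omega> \<and> x = polar x\<^sub>0 r \<theta>
             \<longrightarrow> u x = (\<Lambda> * r powr lam) *\<^sub>R \<Phi> \<theta> + w x"
    using assms(12) unfolding corner_expansion_def by blast
  define V where "V = \<Omega> \<inter> ball x\<^sub>0 R2"
  have \<Omega>: "\<Omega> \<in> lmeasurable" using bounded_open_lmeasurable assms(1,3) by blast
  have V: "V \<in> lmeasurable" unfolding V_def using assms(1,3) by (intro bounded_open_lmeasurable) auto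
  have \<Phi>_cont: "continuous_on {\<alpha>..\<alpha> + \<omega>} \<Phi>"
    using assms(5) unfolding smooth_on_interval_def
    by (metis continuous_on_eq_continuous_within has_vector_derivative_continuous)
  \<comment> \<open>The given nonzero value may sit at an end point, which the open sector omits;
    continuity moves it inside.\<close>
  have "\<exists>\<theta>\<in>{\<alpha><..<\<alpha> + \<omega>}. \<Phi> \<theta> \<noteq> 0"
  proof (rule ccontr)
    assume "\<not> (\<exists>\<theta>\<in>{\<alpha><..<\<alpha> + \<omega>}. \<Phi> \<theta> \<noteq> 0)"
    then have zero: "\<And>\<theta>. \<theta> \<in> {\<alpha><..<\<alpha> + \<omega>} \<Longrightarrow> \<Phi> \<theta> = 0" by blast
    have cl: "closure {\<alpha><..<\<alpha> + \<omega>} = {\<alpha>..\<alpha> + \<omega>}" using \<omega>(1) by simp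
    have "\<Phi> \<theta> = 0" if "\<theta> \<in> {\<alpha>..\<alpha> + \<omega>}" for \<theta>
      by (rule continuous_constant_on_closure[of "{\<alpha><..<\<alpha> + \<omega>}", unfolded cl, OF \<Phi>_cont zero that])
    with assms(6) show False by blast
  qed
  \<comment> \<open>From here the argument is scalar: one nonvanishing component \<open>i\<close> of
    \<open>\<Phi>\<close> is fixed, and \<open>s\<close> will be that component of the singular part
    without \<open>\<Lambda>\<close>.\<close>
  then obtain \<theta>0 i where \<theta>0: "\<alpha> < \<theta>0" "\<theta>0 < \<alpha> + \<omega>" and i: "\<Phi> \<theta>0 $ i \<noteq> 0"
    by (auto simp: vec_eq_iff)
  have \<Phi>i_cont: "continuous_on {\<alpha>..\<alpha> + \<omega>} (\<lambda>\<theta>. \<Phi> \<theta> $ i)"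
    using \<Phi>_cont by (intro continuous_intros)
  obtain s C where s: "s \<in> borel_measurable borel" "continuous_on (sector 0 \<alpha> \<omega>) s"
      "\<And>t x. t > 0 \<Longrightarrow> s (t *\<^sub>R x) = t powr lam * s x" "C \<ge> 0" "\<And>x. \<bar>s x\<bar> \<le> C * norm x powr lam"
    and s_polar: "\<And>r \<theta>. 0 < r \<Longrightarrow> \<alpha> < \<theta> \<Longrightarrow> \<theta> < \<alpha> + \<omega> \<Longrightarrow> s (polar 0 r \<theta>) = r powr lam * (\<Phi> \<theta> $ i)"
    by (rule singular_function_exists[OF \<omega> \<Phi>i_cont, of lam]) (rule that; assumption)
  \<comment> \<open>The reference set has radius \<open>\<rho>\<close>, so that its copy scaled by
    \<open>h\<close> lies in the ball of radius \<open>\<rho> * h\<close>, hence in the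
    cell.\<close>
  define U where "U = sector 0 \<alpha> \<omega> \<inter> ball 0 \<rho>"
  have "open U" unfolding U_def using open_sector_0[OF \<omega>] by blast
  define z where "z = polar 0 (\<rho> / 2) \<theta>0"
  have "z \<in> U" using \<theta>0 \<open>\<rho> > 0\<close> sectorI[of "\<rho> / 2" \<alpha> \<theta>0 \<omega> 0] norm_polar_0[of "\<rho> / 2" \<theta>0]
    by (simp add: U_def z_def)
  have "s z \<noteq> 0" using s_polar[of "\<rho> / 2" \<theta>0] \<theta>0 i \<open>\<rho> > 0\<close> by (simp add: z_def)
  have s_U: "continuous_on U s" unfolding U_def by (rule continuous_on_subset[OF s(2)]) blast
  obtain \<zeta> where \<zeta>: "\<zeta> \<in> tensor_tests U" "(LINT x|lebesgue. \<zeta> x) \<noteq> 0" "(LINT x|lebesgue. s x * \<zeta> x) \<noteq> 0"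
    by (rule bump_integral_nonzero[OF \<open>open U\<close> \<open>z \<in> U\<close> s_U s(1) \<open>s z \<noteq> 0\<close>])
  define m where "m = nat \<lfloor>1 + lam + \<epsilon>\<rfloor>"
  define \<sigma> where "\<sigma> = frac (1 + lam + \<epsilon>)"
  have m\<sigma>: "real m + \<sigma> = 1 + lam + \<epsilon>"
    using \<open>0 < lam\<close> \<open>\<epsilon> > 0\<close> by (simp add: m_def \<sigma>_def frac_def)
  have tests: "\<phi> \<in> test_functions U" if "\<phi> \<in> tensor_tests U" for \<phi> using that by (simp add: tensor_tests_def)
  \<comment> \<open>One word serves both purposes: its length exceeds \<open>2 * p\<close>, for the
    polynomials, and \<open>m\<close>, for the remainder.\<close>
  have "\<exists>a \<eta>. length a = Suc (m + 2 * p) \<and> \<eta> \<in> tensor_tests U \<and> (LINT x|lebesgue. s x * foldr partial a \<eta> x) \<noteq> 0"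
  proof (rule homogeneous_functional_word_nonzero[where L = "\<lambda>\<phi>. LINT x|lebesgue. s x * \<phi> x" and \<mu> = lam, OF _ _ \<zeta>(1,3)])
    show "(LINT x|lebesgue. s x * (\<phi> x + \<psi> x)) = (LINT x|lebesgue. s x * \<phi> x) + (LINT x|lebesgue. s x * \<psi> x)"
      if "\<phi> \<in> test_functions U" "\<psi> \<in> test_functions U" for \<phi> \<psi>
      using integrable_growth[OF s(1,5,4) \<open>0 < lam\<close> test_functionsD(2)[OF that(1)] test_functions_support_bounded[OF that(1)], of 0] integrable_growth[OF s(1,5,4) \<open>0 < lam\<close> test_functionsD(2)[OF that(2)] test_functions_support_bounded[OF that(2)], of 0]
      by (simp add: distrib_left)
    show "(\<Sum>i\<in>UNIV. LINT x|lebesgue. s x * partial i (\<lambda>x. x $ i * \<phi> x) x) = - lam * (LINT x|lebesgue. s x * \<phi> x)"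
      if "\<phi> \<in> tensor_tests U" for \<phi>
      by (rule homogeneous_euler[OF s(1,3,5) \<open>0 < lam\<close> s(4) tests[OF that]])
    show "lam \<noteq> real k" for k using \<open>lam \<notin> \<nat>\<close> by auto
  qed
  then obtain a \<eta> where a: "length a = Suc (m + 2 * p)" and "\<eta> \<in> tensor_tests U"
      and A0: "(LINT x|lebesgue. s x * foldr partial a \<eta> x) \<noteq> 0" by blast
  then have \<eta>: "\<eta> \<in> test_functions U" using tests by blast
  obtain j b where ab: "a = j # b" using a by (cases a) auto
  define \<psi> where "\<psi> = foldr partial b \<eta>"
  have \<psi>: "\<psi> \<in> test_functions U" unfolding \<psi>_def using \<eta> by (rule foldr_partial_test)
  have \<xi>: "foldr partial a \<eta> = partial j \<psi>" by (simp add: ab \<psi>_def)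
  define A where "A = \<bar>LINT x|lebesgue. s x * partial j \<psi> x\<bar>"
  have A: "A > 0" using A0 by (simp add: A_def \<xi>)
  \<comment> \<open>The summand \<open>1\<close> makes the later divisor positive without an
    argument that \<open>\<psi>\<close> is nonzero.\<close>
  define P where "P = sqrt (LINT x|lebesgue. (\<psi> x)\<^sup>2) + 1"
  have P: "P > 0" "sqrt (LINT x|lebesgue. (\<psi> x)\<^sup>2) \<le> P" unfolding P_def
    by (auto intro!: add_nonneg_pos)
  \<comment> \<open>Up to this size the ball of radius \<open>\<rho> * h\<close> stays where
    \<open>\<Omega>\<close> is an exact sector and where the expansion holds.\<close>
  define h0 where "h0 = min R1 R2 / \<rho>"
  have h0: "h0 > 0" using R1 R2 \<open>\<rho> > 0\<close> by (simp add: h0_def)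
  have scale: "(\<lambda>y. x\<^sub>0 + h *\<^sub>R y) ` U \<subseteq> \<Omega> \<inter> V \<inter> ball x\<^sub>0 (\<rho> * h)" if h: "0 < h" "h \<le> h0" for h
  proof
    fix x assume "x \<in> (\<lambda>y. x\<^sub>0 + h *\<^sub>R y) ` U"
    then obtain y where y: "y \<in> U" "x = x\<^sub>0 + h *\<^sub>R y" by blast
    then obtain r \<theta> where r: "y = polar 0 r \<theta>" "0 < r" "\<alpha> < \<theta>" "\<theta> < \<alpha> + \<omega>" by (auto simp: U_def sector_def)
    have "x \<in> sector x\<^sub>0 \<alpha> \<omega>" using r h sectorI[of "h * r" \<alpha> \<theta> \<omega> x\<^sub>0] by (simp add: y(2) polar_shift)
    moreover have "norm y < \<rho>" using y(1) by (simp add: U_def)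
    then have n: "norm (h *\<^sub>R y) < \<rho> * h" using h(1) by simp
    have "\<rho> * h \<le> min R1 R2" using h(2) \<open>\<rho> > 0\<close> by (simp add: h0_def field_simps)
    with n have "x \<in> ball x\<^sub>0 R1" "x \<in> ball x\<^sub>0 R2" "x \<in> ball x\<^sub>0 (\<rho> * h)" by (auto simp: y(2) dist_norm)
    ultimately show "x \<in> \<Omega> \<inter> V \<inter> ball x\<^sub>0 (\<rho> * h)" using R1(2) unfolding V_def by blast
  qed
  have wi: "(\<lambda>x. w x $ i) \<in> sobolev_aux m \<sigma> V"
    using R2(2) by (simp add: sobolev_vec_def sobolev_def V_def m_def \<sigma>_def)
  have "\<exists>C. \<forall>h. 0 < h \<and> h \<le> h0 \<longrightarrow>
      \<bar>LINT x|lebesgue_on V. w x $ i * rescale x\<^sub>0 h (foldr partial a \<eta>) x\<bar> \<le> C * h powr (real m + \<sigma> + 1)"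
  proof (rule sobolev_word_bound[OF V _ wi \<eta> _ tests[OF \<zeta>(1)] \<zeta>(2)])
    show "0 \<le> \<sigma>" by (simp add: \<sigma>_def)
    show "m < length a" by (simp add: a)
    show "U \<subseteq> ball 0 \<rho>" by (simp add: U_def)
    show "\<And>h. 0 < h \<Longrightarrow> h \<le> h0 \<Longrightarrow> (\<lambda>y. x\<^sub>0 + h *\<^sub>R y) ` U \<subseteq> V" using scale by blast
  qed
  then obtain D where D: "\<And>h. 0 < h \<Longrightarrow> h \<le> h0 \<Longrightarrow>
      \<bar>LINT x|lebesgue_on V. w x $ i * rescale x\<^sub>0 h (partial j \<psi>) x\<bar> \<le> D * h powr (real m + \<sigma> + 1)"
    unfolding \<xi> by blast
  \<comment> \<open>Half of the singular term is sacrificed to absorb the remainder.\<close>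
  define B where "B = \<bar>\<Lambda>\<bar> * A / 2"
  have B: "B > 0" using A \<open>\<Lambda> \<noteq> 0\<close> by (simp add: B_def)
  \<comment> \<open>Obtained by solving \<open>(\<bar>D\<bar> + 1) * h powr \<epsilon> = B\<close>
    for \<open>h\<close>; the \<open>1\<close> covers \<open>D = 0\<close>, and the modulus an
    unknown sign.\<close>
  define h1 where "h1 = min h0 ((B / (\<bar>D\<bar> + 1)) powr (1 / \<epsilon>))"
  have h1: "h1 > 0" using h0 B by (simp add: h1_def)
  have remainder: "D * h powr (real m + \<sigma> + 1) \<le> B * h powr (2 + lam)" if h: "0 < h" "h \<le> h1" for h
  proof -
    have "h powr \<epsilon> \<le> ((B / (\<bar>D\<bar> + 1)) powr (1 / \<epsilon>)) powr \<epsilon>"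
      using h \<open>\<epsilon> > 0\<close> by (intro powr_mono2) (auto simp: h1_def)
    also have "\<dots> = B / (\<bar>D\<bar> + 1)" using B \<open>\<epsilon> > 0\<close> by (simp add: powr_powr)
    finally have "(\<bar>D\<bar> + 1) * h powr \<epsilon> \<le> B" by (simp add: field_simps)
    moreover have "D * h powr \<epsilon> \<le> (\<bar>D\<bar> + 1) * h powr \<epsilon>" by (intro mult_right_mono) auto
    ultimately have "D * h powr \<epsilon> * h powr (2 + lam) \<le> B * h powr (2 + lam)" by (intro mult_right_mono) auto
    moreover have "h powr (real m + \<sigma> + 1) = h powr \<epsilon> * h powr (2 + lam)"
      unfolding m\<sigma> powr_add[symmetric] by (simp add: algebra_simps)
    ultimately show ?thesis by (simp add: mult_ac)
  qed
  \<comment> \<open>The constant depends on the reference functions alone; the strength of the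
    remainder and \<open>\<Lambda>\<close> influence only the threshold \<open>h1\<close>.\<close>
  have main: "A / (2 * P) * \<bar>\<Lambda>\<bar> * mesh_size \<T> powr lam \<le> grad_L2_norm \<Omega> (\<lambda>x. u x - u\<^sub>h x)"
    if \<T>: "\<T> \<in> \<F>" and hT: "mesh_size \<T> \<le> h1" and uh: "u\<^sub>h \<in> fe_space \<Omega> \<T> p" for \<T> u\<^sub>h
  proof -
    define h where "h = mesh_size \<T>"
    define e where "e x = u x - u\<^sub>h x" for x
    obtain K where K: "K \<in> active_mesh \<Omega> \<T>" "x\<^sub>0 \<in> interior K" "infdist x\<^sub>0 (frontier K) \<ge> \<rho> * h"
      using assms(19)[OF \<T>] by (auto simp: h_def)
    note mesh = cartesian_mesh_cells[OF assms(8)[OF \<T>]]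
    have K\<T>: "K \<in> \<T>" using K(1) by (simp add: active_mesh_def)
    have "diameter K \<le> h" unfolding h_def mesh_size_def using mesh(1) K\<T> by (intro Max_ge) auto
    with mesh(3)[OF K\<T>] have h: "0 < h" "h \<le> h1" "h \<le> h0" using hT by (auto simp: h_def h1_def)
    have ball_K: "ball x\<^sub>0 (\<rho> * h) \<subseteq> K"
      using K(2,3) interior_subset by (intro ball_subset_of_infdist_frontier) auto
    obtain q where q: "q \<in> Q_poly p" "\<And>x. x \<in> K \<Longrightarrow> u\<^sub>h x $ i = q x"
      using uh K(1) unfolding fe_space_def by blast
    have wp: "\<exists>g. has_weak_partial \<Omega> l (\<lambda>x. e x $ k) g" for k l
    proof -
      \<comment> \<open>Order \<open>1\<close> has floor \<open>1\<close> and fractional part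
        \<open>0\<close>, so membership amounts to weak first derivatives in
        \<open>L2\<close>.\<close>
      have "(\<lambda>x. u x $ k) \<in> sobolev_aux (Suc 0) 0 \<Omega>"
        using assms(11) by (simp add: sobolev_vec_def sobolev_def)
      then obtain g1 where g1: "has_weak_partial \<Omega> l (\<lambda>x. u x $ k) g1" by auto
      obtain g2 where g2: "has_weak_partial \<Omega> l (\<lambda>x. u\<^sub>h x $ k) g2"
        using fe_space_weak_partial[OF assms(8)[OF \<T>] assms(1) assms(9)[OF \<T>] uh] by blast
      from has_weak_partial_diff[OF g1 g2 \<Omega>] show ?thesis unfolding e_def by auto
    qed
    then have eL: "(\<lambda>x. e x $ i) \<in> L2 \<Omega>" by (meson has_weak_partial_def)
    have sub: "(\<lambda>y. x\<^sub>0 + h *\<^sub>R y) ` U \<subseteq> \<Omega>" "(\<lambda>y. x\<^sub>0 + h *\<^sub>R y) ` U \<subseteq> V" "(\<lambda>y. x\<^sub>0 + h *\<^sub>R y) ` U \<subseteq> K"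
      using scale[OF h(1,3)] ball_K by blast+
    have \<xi>t: "partial j \<psi> \<in> test_functions U" using \<psi> by (rule test_functions_partial)
    define X where "X = (LINT x|lebesgue_on \<Omega>. e x $ i * rescale x\<^sub>0 h (partial j \<psi>) x)"
    have "X = \<Lambda> * (h powr (2 + lam) * (LINT x|lebesgue. s x * partial j \<psi> x))
        + (LINT x|lebesgue_on V. w x $ i * rescale x\<^sub>0 h (partial j \<psi>) x)"
      unfolding X_def
    proof (rule integral_test_corner_expansion[OF V \<Omega> s(1,3,5,4) \<open>0 < lam\<close> \<xi>t h(1) sub(1,2) _ eL])
      show "(\<lambda>x. w x $ i) \<in> L2 V" using wi by (rule sobolev_aux_L2)
      show "continuous_on UNIV q" using C_k_continuous[OF Q_poly_C_1[OF q(1)]] .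
      have "degree_below (length a) q" using q(1) a by (intro degree_below_Q_poly) auto
      then show "(LINT x|lebesgue. q x * rescale x\<^sub>0 h (partial j \<psi>) x) = 0"
        using integral_degree_below_word_eq_0[OF _ \<eta> h(1)] \<xi> by metis
      have "AE x in lebesgue. x \<in> V \<longrightarrow> (\<forall>r \<theta>. 0 < r \<and> \<alpha> < \<theta> \<and> \<theta> < \<alpha> + \<omega> \<and> x = polar x\<^sub>0 r \<theta>
             \<longrightarrow> u x = (\<Lambda> * r powr lam) *\<^sub>R \<Phi> \<theta> + w x)"
        using expansion[folded V_def] V by (subst (asm) AE_restrict_space_iff) auto
      then show "AE x in lebesgue. x \<in> (\<lambda>y. x\<^sub>0 + h *\<^sub>R y) ` U \<longrightarrow> e x $ i = \<Lambda> * s (x - x\<^sub>0) + w x $ i - q x"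
      proof (rule AE_mp, intro AE_I2 impI)
        fix x assume x: "x \<in> V \<longrightarrow> (\<forall>r \<theta>. 0 < r \<and> \<alpha> < \<theta> \<and> \<theta> < \<alpha> + \<omega> \<and> x = polar x\<^sub>0 r \<theta>
             \<longrightarrow> u x = (\<Lambda> * r powr lam) *\<^sub>R \<Phi> \<theta> + w x)" and xU: "x \<in> (\<lambda>y. x\<^sub>0 + h *\<^sub>R y) ` U"
        then obtain y where y: "y \<in> U" "x = x\<^sub>0 + h *\<^sub>R y" by blast
        then obtain r \<theta> where r: "y = polar 0 r \<theta>" "0 < r" "\<alpha> < \<theta>" "\<theta> < \<alpha> + \<omega>" by (auto simp: U_def sector_def)
        have "x - x\<^sub>0 = h *\<^sub>R y" using y(2) by simp
        then have xp: "x = polar x\<^sub>0 (h * r) \<theta>" "x - x\<^sub>0 = polar 0 (h * r) \<theta>"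
          using y(2) r(1) polar_shift[of x\<^sub>0 h r \<theta>] polar_shift[of 0 h r \<theta>] by simp_all
        have hr: "0 < h * r" using h(1) r(2) by simp
        \<comment> \<open>The expansion is quantified over all polar representations of
          \<open>x\<close>, so the one scaled from \<open>y\<close> applies directly.\<close>
        have "u x = (\<Lambda> * (h * r) powr lam) *\<^sub>R \<Phi> \<theta> + w x" using x xU sub(2) xp(1) hr r(3,4) by blast
        moreover have "s (x - x\<^sub>0) = (h * r) powr lam * (\<Phi> \<theta> $ i)" unfolding xp(2) by (rule s_polar[OF hr r(3,4)])
        moreover have "u\<^sub>h x $ i = q x" using q(2) sub(3) xU by blast
        ultimately show "e x $ i = \<Lambda> * s (x - x\<^sub>0) + w x $ i - q x" by (simp add: e_def)
      qed
    qed
    moreover have "\<bar>\<Lambda> * (h powr (2 + lam) * (LINT x|lebesgue. s x * partial j \<psi> x))\<bar>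
        = \<bar>\<Lambda>\<bar> * (h powr (2 + lam) * A)"
      by (simp add: abs_mult A_def)
    ultimately have "\<bar>X\<bar> \<ge> \<bar>\<Lambda>\<bar> * (h powr (2 + lam) * A) - D * h powr (real m + \<sigma> + 1)"
      using D[OF h(1,3)] by linarith
    then have lower: "\<bar>X\<bar> \<ge> B * h powr (2 + lam)"
      using remainder[OF h(1,2)] by (simp add: B_def field_simps)
    \<comment> \<open>The other side of the duality: the outermost derivative of the word is the one
      that becomes the gradient of the error.\<close>
    have "X = h * (LINT x|lebesgue_on \<Omega>. e x $ i * partial j (rescale x\<^sub>0 h \<psi>) x)"
      unfolding X_def by (simp add: rescale_partial[OF \<psi> h(1)] mult.left_commute)
    then have "\<bar>X\<bar> = h * \<bar>LINT x|lebesgue_on \<Omega>. e x $ i * partial j (rescale x\<^sub>0 h \<psi>) x\<bar>"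
      using h(1) by (simp add: abs_mult)
    also have "\<dots> \<le> h * (grad_L2_norm \<Omega> e * sqrt (LINT x|lebesgue. (rescale x\<^sub>0 h \<psi> x)\<^sup>2))"
      using grad_L2_norm_test_bound[OF \<Omega> wp test_functions_rescale[OF \<psi> h(1) sub(1)]] h(1)
      by (intro mult_left_mono) auto
    also have "(LINT x|lebesgue. (rescale x\<^sub>0 h \<psi> x)\<^sup>2) = h\<^sup>2 * (LINT x|lebesgue. (\<psi> x)\<^sup>2)"
      by (rule integral_square_rescale(1)[OF test_functionsD(2)[OF \<psi>] h(1)])
    also have "h * (grad_L2_norm \<Omega> e * sqrt (h\<^sup>2 * (LINT x|lebesgue. (\<psi> x)\<^sup>2)))
        = h\<^sup>2 * (grad_L2_norm \<Omega> e * sqrt (LINT x|lebesgue. (\<psi> x)\<^sup>2))"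
      using h(1) by (simp add: real_sqrt_mult power2_eq_square mult_ac)
    also have "\<dots> \<le> h\<^sup>2 * (grad_L2_norm \<Omega> e * P)"
    proof -
      have "0 \<le> grad_L2_norm \<Omega> e" unfolding grad_L2_norm_def
        by (intro real_sqrt_ge_zero integral_nonneg_AE AE_I2 sum_nonneg zero_le_power2)
      then show ?thesis using P(2) by (intro mult_left_mono) auto
    qed
    finally have "B * h powr (2 + lam) \<le> h\<^sup>2 * (grad_L2_norm \<Omega> e * P)" using lower by linarith
    moreover have "h powr (2 + lam) = h\<^sup>2 * h powr lam" using h(1) by (simp add: powr_add)
    ultimately have "h\<^sup>2 * (B * h powr lam) \<le> h\<^sup>2 * (grad_L2_norm \<Omega> e * P)" by (simp add: mult_ac)
    then have "B * h powr lam \<le> grad_L2_norm \<Omega> e * P" using h(1) by simp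
    moreover have "A / (2 * P) * \<bar>\<Lambda>\<bar> * h powr lam = B * h powr lam / P" by (simp add: B_def)
    ultimately have "A / (2 * P) * \<bar>\<Lambda>\<bar> * h powr lam \<le> grad_L2_norm \<Omega> e" using P(1) by (simp add: pos_divide_le_eq)
    then show ?thesis unfolding h_def e_def[abs_def] .
  qed
  show ?thesis
    using main A P(1) h1 by (intro exI[of _ "A / (2 * P)"] conjI exI[of _ h1]) auto
qed

end
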